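(* Let $G=\mathrm{SL}_{2\ell}$ over $\mathbb{C}$ ($\ell\ge2$) and let $\sigma$ be its diagram automorphism of order $2$ (type $(A_{2\ell-1},2)$). Let $\mathcal{M}'=\bigcup_{j=0}^{\lfloor\ell/2\rfloor}\mathcal{M}_{(1^{2j}0^{\ell-2j})}$. Then $\pi$ maps $\mathcal{M}'$ isomorphically onto $\mathcal{N}_{\mathfrak p,2}$. Moreover, for each $0\le j\le\lfloor\ell/2\rfloor$, $\pi$ maps $\mathcal{M}_{(1^{2j}0^{\ell-2j})}$ isomorphically onto the nilpotent orbit $[2^{2j}1^{2\ell-4j}]$.
   Context: $\sigma(A)=JA^{-T}J^{-1}$ on $G$, where $J$ is the antidiagonal $2\ell\times2\ell$ matrix with entries $J_{i,2\ell+1-i}=(-1)^{i-1}$ (the matrix of a symplectic form). $\mathfrak p=\{A\in\mathfrak{sl}_{2\ell}: A=JA^TJ^{-1}\}$ is the $(-1)$-eigenspace of $\sigma$ on $\mathfrak{sl}_{2\ell}$, $K=G^\sigma\cong\mathrm{Sp}_{2\ell}$ acts on $\mathfrak p$ by conjugation, $\mathcal{N}_{\mathfrak p}$ is the set of nilpotent elements of $\mathfrak p$, and $\mathcal{N}_{\mathfrak p,2}=\{x\in\mathcal{N}_{\mathfrak p}:x^2=0\}$. $[2^{2j}1^{2\ell-4j}]$ is the $K$-orbit of nilpotent elements of $\mathfrak p$ with $2j$ Jordan blocks of size $2$ and the rest of size $1$. $\mathcal{O}=\mathbb{C}[[t]]$, $\mathcal{K}=\mathbb{C}((t))$, $\mathcal{O}^-=\mathbb{C}[t^{-1}]$,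 with $\sigma(t)=-t$, $\sigma|_{\mathbb C}=\mathrm{Id}$; $\sigma$ acts on $G(\mathcal K)$ etc. through both $G$ and $t$. $\mathcal{G}r=G(\mathcal{K})^\sigma/G(\mathcal{O})^\sigma$ with base point $e_0$. Let $T$ be the diagonal torus. $X_*(T)_\sigma=X_*(T)/(\mathrm{Id}-\sigma)X_*(T)$ is identified with $\{a\in\mathbb{Z}^\ell:\sum a_i\in2\mathbb{Z}\}$ by sending the class $\bar\lambda$ of $\lambda=(b_1,\dots,b_{2\ell})$, $\sum b_i=0$, to $(a_1,\dots,a_\ell)$, $a_i=b_i-b_{2\ell+1-i}$ (so the images of the simple coroots $\check\alpha_1,\dots,\check\alpha_\ell$ become the standard simple roots $e_i-e_{i+1}$ $(i<\ell)$ and $2e_\ell$ of type $C_\ell$). Put $n^\lambda=t^\lambda\sigma(t^\lambda)$ and, for $a_1\ge\dots\ge a_\ell\ge0$, $\mathcal{G}r_{\bar\lambda}=G(\mathcal{O})^\sigma n^\lambda\cdot e_0$. $\mathcal{G}r_0^-=G(\mathcal{O}^-)^\sigma\cdot e_0\simeq G(\mathcal{O}^-)_0^\sigma$, where $G(\mathcal{O}^-)_0$ is the kernel of evaluation at $t=\infty$; $\mathcal{M}_{\bar\lambda}=\mathcal{G}r_{\bar\lambda}\cap\mathcal{G}r_0^-$. $(1^{2j}0^{\ell-2j})$ is the tuple of $2j$ ones followed by zeros. All spaces are regarded as varieties (reduced). $\pi:\mathcal{G}r_0^-\simeq G(\mathcal{O}^-)_0^\sigma\to\mathfrak p$ sends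 $I+xt^{-1}+(\text{terms in }t^{-2},t^{-3},\dots)$ to $x$. *)

theory Defs
  imports
    Complex_Main
    "HOL-Computational_Algebra.Formal_Laurent_Series"
    "HOL-Algebra.Left_Coset"
    "Jordan_Normal_Form.Gauss_Jordan_Elimination"
    "Jordan_Normal_Form.Jordan_Normal_Form"
begin

section \<open>Reduced varieties in affine space\<close>

text \<open>The space \<open>'v \<Rightarrow> complex\<close> is the affine space with coordinates indexed by \<open>'v\<close>. The index
  type may be infinite: a variety is required to live in a coordinate subspace of finite
  dimension, as for the finite-dimensional subvarieties of an ind-affine space.\<close>

inductive_set polyfun :: "(('v \<Rightarrow> complex) \<Rightarrow> complex) set" where
  const: "(\<lambda>_. c) \<in> polyfun"
| coord: "(\<lambda>v. v i) \<in> polyfun"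
| add: "p \<in> polyfun \<Longrightarrow> q \<in> polyfun \<Longrightarrow> (\<lambda>v. p v + q v) \<in> polyfun"
| mult: "p \<in> polyfun \<Longrightarrow> q \<in> polyfun \<Longrightarrow> (\<lambda>v. p v * q v) \<in> polyfun"

text \<open>Zariski locally closed subsets: the common zeros of \<open>S\<close> minus the common zeros of \<open>T\<close>.\<close>

definition quasi_affine :: "('v \<Rightarrow> complex) set \<Rightarrow> bool" where
  "quasi_affine V \<longleftrightarrow> (\<exists>I S T. finite I \<and> S \<subseteq> polyfun \<and> T \<subseteq> polyfun \<and>
     V = {v. (\<forall>i. i \<notin> I \<longrightarrow> v i = 0) \<and> (\<forall>p\<in>S. p v = 0) \<and> (\<exists>q\<in>T. q v \<noteq> 0)})"

definition regular_on :: "('v \<Rightarrow> complex) set \<Rightarrow> (('v \<Rightarrow> complex) \<Rightarrow> complex) \<Rightarrow> bool" where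
  "regular_on V f \<longleftrightarrow> (\<forall>v\<in>V. \<exists>p\<in>polyfun. \<exists>q\<in>polyfun. q v \<noteq> 0 \<and>
     (\<forall>w\<in>V. q w \<noteq> 0 \<longrightarrow> f w = p w / q w))"

definition morphism ::
    "('v \<Rightarrow> complex) set \<Rightarrow> ('w \<Rightarrow> complex) set \<Rightarrow> (('v \<Rightarrow> complex) \<Rightarrow> 'w \<Rightarrow> complex) \<Rightarrow> bool" where
  "morphism V W F \<longleftrightarrow> F ` V \<subseteq> W \<and> (\<forall>i. regular_on V (\<lambda>v. F v i))"

definition variety_iso ::
    "('v \<Rightarrow> complex) set \<Rightarrow> ('w \<Rightarrow> complex) set \<Rightarrow> (('v \<Rightarrow> complex) \<Rightarrow> 'w \<Rightarrow> complex) \<Rightarrow> bool" where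
  "variety_iso V W F \<longleftrightarrow> quasi_affine V \<and> quasi_affine W \<and> bij_betw F V W \<and>
     morphism V W F \<and> morphism W V (inv_into V F)"

text \<open>\<open>f\<close> is an isomorphism from \<open>X\<close> to \<open>Y\<close>, where \<open>X\<close> and \<open>Y\<close> carry the variety structures
  given by the embeddings \<open>\<phi>\<close> and \<open>\<psi>\<close> into affine spaces.\<close>

definition iso_via ::
    "('a \<Rightarrow> 'v \<Rightarrow> complex) \<Rightarrow> 'a set \<Rightarrow> ('b \<Rightarrow> 'w \<Rightarrow> complex) \<Rightarrow> 'b set \<Rightarrow> ('a \<Rightarrow> 'b) \<Rightarrow> bool" where
  "iso_via \<phi> X \<psi> Y f \<longleftrightarrow> inj_on \<phi> X \<and> inj_on \<psi> Y \<and> f ` X \<subseteq> Y \<and>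
     variety_iso (\<phi> ` X) (\<psi> ` Y) (\<lambda>v. \<psi> (f (inv_into X \<phi> v)))"


section \<open>The group, its automorphism, and the symmetric space\<close>

text \<open>Matrix indices start at 0, so the antidiagonal entry in row \<open>i\<close> sits in column \<open>2l - 1 - i\<close>
  and has sign \<open>(-1)^i\<close>.\<close>

definition J :: "nat \<Rightarrow> 'a::field mat" where
  "J l = mat (2*l) (2*l) (\<lambda>(i,j). if i + j = 2*l - 1 then (-1)^i else 0)"

abbreviation minv :: "'a::field mat \<Rightarrow> 'a mat" where
  "minv A \<equiv> the (mat_inverse A)"

definition sigma :: "nat \<Rightarrow> 'a::field mat \<Rightarrow> 'a mat" where
  "sigma l A = J l * transpose_mat (minv A) * minv (J l)"

definition SL :: "nat \<Rightarrow> 'a::field set \<Rightarrow> 'a mat set" where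
  "SL n R = {A \<in> carrier_mat n n. elements_mat A \<subseteq> R \<and> det A = 1}"

definition K :: "nat \<Rightarrow> complex mat set" where
  "K l = {A \<in> SL (2*l) UNIV. sigma l A = A}"

definition \<pp> :: "nat \<Rightarrow> complex mat set" where
  "\<pp> l = {A \<in> carrier_mat (2*l) (2*l). (\<Sum>i<2*l. A $$ (i,i)) = 0 \<and>
     A = J l * transpose_mat A * minv (J l)}"

definition N\<pp> :: "nat \<Rightarrow> complex mat set" where
  "N\<pp> l = {x \<in> \<pp> l. \<exists>k. x ^\<^sub>m k = 0\<^sub>m (2*l) (2*l)}"

definition N\<pp>2 :: "nat \<Rightarrow> complex mat set" where
  "N\<pp>2 l = {x \<in> N\<pp> l. x ^\<^sub>m 2 = 0\<^sub>m (2*l) (2*l)}"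

text \<open>\<open>jordan_orbit l j\<close> is $[2^{2j}1^{2l-4j}]$, the set of nilpotent elements of \<open>\<pp> l\<close> of that
  Jordan type.\<close>

definition jordan_orbit :: "nat \<Rightarrow> nat \<Rightarrow> complex mat set" where
  "jordan_orbit l j =
     {x \<in> N\<pp> l. jordan_nf x (replicate (2*j) (2,0) @ replicate (2*l - 4*j) (1,0))}"

definition is_K_orbit :: "nat \<Rightarrow> complex mat set \<Rightarrow> bool" where
  "is_K_orbit l \<Omega> \<longleftrightarrow> (\<exists>x\<in>\<pp> l. \<Omega> = {k * x * minv k | k. k \<in> K l})"

definition mat_coord :: "complex mat \<Rightarrow> nat \<times> nat \<Rightarrow> complex" where
  "mat_coord A = (\<lambda>(i,j). if i < dim_row A \<and> j < dim_col A then A $$ (i,j) else 0)"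


section \<open>The twisted affine Grassmannian\<close>

text \<open>\<open>complex fls\<close> is $\mathcal{K}$; \<open>\<O>\<close> is $\mathbb{C}[[t]]$ and \<open>\<O>m\<close> is $\mathbb{C}[t^{-1}]$,
  as subsets of $\mathcal{K}$. (A formal Laurent series has only finitely many
  coefficients of negative index.)\<close>

definition \<O> :: "complex fls set" where
  "\<O> = {f. \<forall>n<0. fls_nth f n = 0}"

definition \<O>m :: "complex fls set" where
  "\<O>m = {f. \<forall>n>0. fls_nth f n = 0}"

text \<open>The automorphism of $G(\mathcal{K})$ combining \<open>sigma\<close> with the substitution $t \mapsto -t$.\<close>

definition loop_sigma :: "nat \<Rightarrow> complex fls mat \<Rightarrow> complex fls mat" where
  "loop_sigma l A = sigma l (map_mat (\<lambda>f. fls_compose_fps f (- fps_X)) A)"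

definition GK :: "nat \<Rightarrow> complex fls mat monoid" where
  "GK l = \<lparr>carrier = {A \<in> SL (2*l) UNIV. loop_sigma l A = A}, mult = (*), one = 1\<^sub>m (2*l)\<rparr>"

definition GO :: "nat \<Rightarrow> complex fls mat set" where
  "GO l = {A \<in> SL (2*l) \<O>. loop_sigma l A = A}"

definition GOm :: "nat \<Rightarrow> complex fls mat set" where
  "GOm l = {A \<in> SL (2*l) \<O>m. loop_sigma l A = A}"

definition GOm0 :: "nat \<Rightarrow> complex fls mat set" where
  "GOm0 l = {A \<in> GOm l. map_mat (\<lambda>f. fls_nth f 0) A = 1\<^sub>m (2*l)}"

text \<open>A point of the Grassmannian is a left coset, that is, a set of matrices. So the action of
  \<open>g\<close> on a point \<open>c\<close> is again written \<open>g <#\<^bsub>GK l\<^esub> c\<close>, and the base point is \<open>GO l\<close> itself.\<close>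

definition Gr :: "nat \<Rightarrow> complex fls mat set set" where
  "Gr l = lcosets\<^bsub>GK l\<^esub> (GO l)"

definition base_point :: "nat \<Rightarrow> complex fls mat set" where
  "base_point l = GO l"

definition cocharacters :: "nat \<Rightarrow> int list set" where
  "cocharacters l = {b. length b = 2*l \<and> sum_list b = 0}"

text \<open>The image of a cocharacter in the coinvariants, the latter identified with the integer
  vectors of length \<open>l\<close> and even sum.\<close>

definition coinv :: "nat \<Rightarrow> int list \<Rightarrow> int list" where
  "coinv l b = map (\<lambda>i. b ! i - b ! (2*l - 1 - i)) [0..<l]"

definition t_pow :: "nat \<Rightarrow> int list \<Rightarrow> complex fls mat" where
  "t_pow l b = mat_diag (2*l) (\<lambda>i. fls_X_intpow (b ! i))"

definition n_elt :: "nat \<Rightarrow> int list \<Rightarrow> complex fls mat" where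
  "n_elt l b = t_pow l b * loop_sigma l (t_pow l b)"

definition Gr_stratum :: "nat \<Rightarrow> int list \<Rightarrow> complex fls mat set set" where
  "Gr_stratum l b = {h <#\<^bsub>GK l\<^esub> (n_elt l b <#\<^bsub>GK l\<^esub> base_point l) | h. h \<in> GO l}"

definition Gr0m :: "nat \<Rightarrow> complex fls mat set set" where
  "Gr0m l = {g <#\<^bsub>GK l\<^esub> base_point l | g. g \<in> GOm l}"

definition M :: "nat \<Rightarrow> int list \<Rightarrow> complex fls mat set set" where
  "M l b = Gr_stratum l b \<inter> Gr0m l"

text \<open>The identification of \<open>Gr0m l\<close> with \<open>GOm0 l\<close>: each coset in \<open>Gr0m l\<close> contains exactly one
  element of \<open>GOm0 l\<close>.\<close>

definition rep :: "nat \<Rightarrow> complex fls mat set \<Rightarrow> complex fls mat" where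
  "rep l c = (THE g. g \<in> c \<and> g \<in> GOm0 l)"

definition \<pi> :: "nat \<Rightarrow> complex fls mat set \<Rightarrow> complex mat" where
  "\<pi> l c = map_mat (\<lambda>f. fls_nth f (-1)) (rep l c)"

text \<open>The coordinates on \<open>Gr0m l\<close>: the coefficients of $t^{-k}$, \<open>k \<ge> 0\<close>, in the matrix entries of
  the representative in \<open>GOm0 l\<close>.\<close>

definition gr_coord :: "nat \<Rightarrow> complex fls mat set \<Rightarrow> nat \<times> nat \<times> nat \<Rightarrow> complex" where
  "gr_coord l c = (\<lambda>(i,j,k). if i < 2*l \<and> j < 2*l then fls_nth (rep l c $$ (i,j)) (- int k) else 0)"

definition ones_zeros :: "nat \<Rightarrow> nat \<Rightarrow> int list" where
  "ones_zeros l j = replicate (2*j) 1 @ replicate (l - 2*j) 0"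

text \<open>The cocharacters lifting \<open>ones_zeros l j\<close> exist. The stratum does not depend on the
  lift: two lifts give \<open>n_elt\<close>'s differing by a diagonal sign matrix in \<open>GO l\<close>.\<close>

lemma ones_zeros_lift:
  assumes "j \<le> l div 2"
  shows "\<exists>b \<in> cocharacters l. coinv l b = ones_zeros l j"
proof -
  define b :: "int list" where "b = replicate j 1 @ replicate (2*l - 3*j) 0 @
    replicate j (-1) @ replicate j 0"
  have "b \<in> cocharacters l"
    using assms by (auto simp: cocharacters_def b_def sum_list_replicate)
  moreover have "coinv l b = ones_zeros l j"
    using assms
    by (intro nth_equalityI) (auto simp: coinv_def ones_zeros_def b_def nth_append)
  ultimately show ?thesis by blast
qed

end

theory Submission
  imports Defs
begin

text \<open>A point of $G(\mathcal{O})^\sigma n^\lambda G(\mathcal{O})^\sigma$ with $\lambda = (1^{2j}0^{l-2j})$ has at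
  most a simple pole at \<open>t = 0\<close>, so its representative in $G(\mathcal{O}^-)_0^\sigma$ is $I + xt^{-1}$. The
  equation $A(t) J A(-t)^T = J$ of the twisted group then says exactly that \<open>x J = J x\<^sup>T\<close> and
  \<open>x\<^sup>2 = 0\<close>, and the residue of the pole shows that \<open>x\<close> has rank \<open>2j\<close>. Conversely, self-adjoint \<open>x\<close>
  with \<open>x\<^sup>2 = 0\<close> are classified up to \<open>K\<close> by their rank: for \<open>\<omega>(u, x v) = 1\<close> the vectors \<open>u, v, x u,
  x v\<close> span a hyperbolic \<open>x\<close>-stable subspace which can be split off, and Witt's extension theorem
  turns the resulting basis into an element of \<open>K\<close>. For the normal form, the factorization of
  $I + xt^{-1}$ is a computation in copies of \<open>SL\<^sub>2\<close>. In the coordinates used, both directions of the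
  isomorphism are then given by coordinate functions.\<close>

section \<open>The symplectic form and its isometries\<close>

text \<open>Self-adjointness makes \<open>sympl l u (x v)\<close> an alternating form in
  \<open>u\<close> and \<open>v\<close>; this is why only even ranks occur and why frames consist of
  pairs. \<open>K\<close> demands determinant 1, while an isometry is only shown to have determinant
  1 or -1, so the elements of \<open>K\<close> that realize Witt's theorem are built as products of
  transvections. The normal form then serves repeatedly: trace 0 on \<open>N\<pp>2\<close>,
  determinant 1 of \<open>1 + s x\<close>, the exact rank of \<open>x\<close> and the position of
  its coset in the stratum are all checked on \<open>std_nilpotent\<close> and carried over by
  conjugation. For the orbits to be varieties, an upper bound on the rank must become a set of
  vanishing conditions; on self-adjoint \<open>x\<close> of square zero it is the failure of the
  next lower bound. Both claims of the theorem come from a single parametrization, sending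
  \<open>x\<close> to the coset of \<open>1 + t^(-1) x\<close>, restricted once to the whole cone
  and once to an orbit.\<close>

lemma J_carrier [simp, intro]: "J l \<in> carrier_mat (2*l) (2*l)"
  and dim_J [simp]: "dim_row (J l) = 2*l" "dim_col (J l) = 2*l"
  by (auto simp: J_def)

lemma index_J: "i < 2*l \<Longrightarrow> j < 2*l \<Longrightarrow> J l $$ (i,j) = (if i + j = 2*l - 1 then (-1)^i else 0)"
  by (simp add: J_def)

text \<open>The two exponents have the odd sum \<open>2*l - 1\<close>, hence opposite parity. This
  sign makes \<open>J\<close> skew-symmetric and its square \<open>-1\<close>.\<close>

lemma minus_one_power_flip:
  assumes "(i::nat) < 2*l"
  shows "(-1::'a::ring_1) ^ (2*l - Suc i) = - ((-1) ^ i)"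
proof -
  have "even (2*l - Suc i) \<longleftrightarrow> odd i" using assms by presburger
  then show ?thesis by (cases "even i") auto
qed

lemma sum_flip:
  fixes l :: nat and f :: "nat \<Rightarrow> 'a::comm_monoid_add"
  assumes "i < 2*l"
  shows "(\<Sum>k<2*l. if i + k = 2*l - 1 then f k else 0) = f (2*l - 1 - i)"
proof -
  have "(\<Sum>k<2*l. if i + k = 2*l - 1 then f k else 0) = (\<Sum>k<2*l. if k = 2*l - 1 - i then f k else 0)"
    using assms by (intro sum.cong) auto
  then show ?thesis using assms by simp
qed

lemma J_square: "J l * J l = - (1\<^sub>m (2*l) :: 'a::field mat)"
proof (rule eq_matI)
  fix i j assume "i < dim_row (- (1\<^sub>m (2*l) :: 'a mat))" "j < dim_col (- (1\<^sub>m (2*l) :: 'a mat))"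
  then have ij: "i < 2*l" "j < 2*l" by auto
  have "(J l * J l :: 'a mat) $$ (i,j) = (\<Sum>k<2*l. J l $$ (i,k) * J l $$ (k,j))"
    using ij by (simp add: scalar_prod_def atLeast0LessThan)
  also have "\<dots> = (\<Sum>k<2*l. if i + k = 2*l - 1 then (-1)^i * J l $$ (k,j) else 0)"
    using ij by (intro sum.cong) (auto simp: index_J)
  also have "\<dots> = (-1)^i * J l $$ (2*l - 1 - i, j)"
    using ij by (simp only: sum_flip)
  also have "\<dots> = (- (1\<^sub>m (2*l))) $$ (i,j)"
    using ij by (auto simp: index_J minus_one_power_flip simp flip: power_mult_distrib)
  finally show "(J l * J l :: 'a mat) $$ (i,j) = (- (1\<^sub>m (2*l))) $$ (i,j)" .
qed auto

lemma transpose_J: "transpose_mat (J l) = - (J l :: 'a::field mat)"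
proof (rule eq_matI)
  fix i j assume "i < dim_row (- (J l :: 'a mat))" "j < dim_col (- (J l :: 'a mat))"
  then have ij: "i < 2*l" "j < 2*l" by auto
  show "transpose_mat (J l) $$ (i,j) = (- (J l :: 'a mat)) $$ (i,j)"
  proof (cases "i + j = 2*l - 1")
    case True
    then have "j = 2*l - 1 - i" by auto
    then show ?thesis using ij True minus_one_power_flip[of i l, where 'a='a]
      by (simp add: index_J)
  qed (use ij in \<open>auto simp: index_J\<close>)
qed auto

text \<open>\<open>minv\<close> is \<open>the\<close> of an option, so the point is that
  \<open>mat_inverse\<close> returns \<open>Some\<close>: a right inverse of a square matrix is also
  a left inverse, which makes \<open>A\<close> a unit of the matrix ring.\<close>

lemma minv_eqI:
  fixes A :: "'a::field mat"
  assumes A: "A \<in> carrier_mat n n" and B: "B \<in> carrier_mat n n" and AB: "A * B = 1\<^sub>m n"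
  shows "minv A = B"
proof -
  have BA: "B * A = 1\<^sub>m n" using mat_mult_left_right_inverse[OF A B AB] .
  have "A \<in> Units (ring_mat TYPE('a) n ())"
    using A B AB BA by (auto simp: Units_def ring_mat_def)
  then obtain C where C: "mat_inverse A = Some C"
    using mat_inverse(1)[OF A, where b="()"] by (cases "mat_inverse A") auto
  then have C': "C * A = 1\<^sub>m n" "C \<in> carrier_mat n n" using mat_inverse(2)[OF A] by auto
  have "C = C * (A * B)" using AB C' by simp
  also have "\<dots> = B" using A B C' by (simp flip: assoc_mult_mat)
  finally show ?thesis using C by simp
qed

lemma minv_if_det:
  fixes A :: "'a::field mat"
  assumes A: "A \<in> carrier_mat n n" and d: "det A \<noteq> 0"
  shows "minv A \<in> carrier_mat n n" "A * minv A = 1\<^sub>m n" "minv A * A = 1\<^sub>m n"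
proof -
  have "A \<in> Units (ring_mat TYPE('a) n ())"
    using det_non_zero_imp_unit[OF A d] .
  then obtain B where "B \<in> carrier_mat n n" "A * B = 1\<^sub>m n" "B * A = 1\<^sub>m n"
    by (auto simp: Units_def ring_mat_def)
  moreover from this have "minv A = B" using A minv_eqI by blast
  ultimately show "minv A \<in> carrier_mat n n" "A * minv A = 1\<^sub>m n" "minv A * A = 1\<^sub>m n" by auto
qed

lemma J_mult_uminus: "J l * (- J l) = (1\<^sub>m (2*l) :: 'a::field mat)" 
  "(- J l) * J l = (1\<^sub>m (2*l) :: 'a::field mat)"
proof -
  show "J l * (- J l) = (1\<^sub>m (2*l) :: 'a::field mat)"
    using uminus_mult_right_mat[of "J l" "J l :: 'a mat"]  by (simp add: J_square uminus_uminus_mat)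
  then show "(- J l) * J l = (1\<^sub>m (2*l) :: 'a::field mat)" 
    using mat_mult_left_right_inverse[OF J_carrier] by auto
qed

lemma minv_J: "minv (J l) = - (J l :: 'a::field mat)"
  by (rule minv_eqI[of _ "2*l"]) (auto simp: J_mult_uminus)

text \<open>Clears both inverses from the definition of \<open>sigma\<close>. Two matrices are kept
  apart because in the loop group \<open>B\<close> is \<open>A\<close> with \<open>t\<close>
  replaced by \<open>-t\<close>; for \<open>K\<close> they coincide.\<close>

lemma sigma_eq_iff:
  fixes A B :: "'a::field mat"
  assumes A: "A \<in> carrier_mat (2*l) (2*l)" and B: "B \<in> carrier_mat (2*l) (2*l)" and d: "det B \<noteq> 0"
  shows "sigma l B = A \<longleftrightarrow> A * J l * transpose_mat B = J l"
proof -
  let ?n = "2*l" let ?C = "minv B"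
  note inv = minv_if_det[OF B d]
  have [simp]: "?C \<in> carrier_mat ?n ?n" using inv by simp
  have t1: "transpose_mat ?C * transpose_mat B = 1\<^sub>m ?n"
    using transpose_mult[OF B, of ?C ?n] inv by simp
  have t2: "transpose_mat B * transpose_mat ?C = 1\<^sub>m ?n"
    using transpose_mult[of ?C ?n ?n B ?n] B inv by simp
  have s: "sigma l B = J l * transpose_mat ?C * (- J l)" by (simp add: sigma_def minv_J)
  show ?thesis
  proof
    assume eq: "sigma l B = A"
    have "A * J l = J l * transpose_mat ?C * ((- J l) * J l)"
      unfolding eq[symmetric] s by (rule assoc_mult_mat[of _ ?n ?n _ ?n _ ?n]) (auto intro!: mult_carrier_mat)
    also have "\<dots> = J l * transpose_mat ?C"
      by (simp add: J_mult_uminus right_mult_one_mat[of _ ?n ?n] mult_carrier_mat[of _ ?n ?n _ ?n])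
    finally have "A * J l * transpose_mat B = J l * (transpose_mat ?C * transpose_mat B)"
      using B by (simp add: assoc_mult_mat[of _ ?n ?n _ ?n _ ?n])
    then show "A * J l * transpose_mat B = J l" by (simp add: t1)
  next
    assume eq: "A * J l * transpose_mat B = J l"
    have "sigma l B = (A * J l * transpose_mat B) * transpose_mat ?C * (- J l)"
      unfolding eq s ..
    also have "\<dots> = (A * J l) * (transpose_mat B * transpose_mat ?C) * (- J l)"
      using A B by (simp add: assoc_mult_mat[of _ ?n ?n _ ?n _ ?n] mult_carrier_mat[of _ ?n ?n _ ?n])
    also have "\<dots> = A * (J l * (- J l))"
      unfolding t2 using A by (simp add: assoc_mult_mat[of _ ?n ?n _ ?n _ ?n] mult_carrier_mat[of _ ?n ?n _ ?n] right_mult_one_mat[of _ ?n ?n])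
    finally show "sigma l B = A" using A by (simp add: J_mult_uminus)
  qed
qed

lemma K_iff: "A \<in> K l \<longleftrightarrow> A \<in> carrier_mat (2*l) (2*l) \<and> det A = 1 \<and> A * J l * transpose_mat A = J l"
  using sigma_eq_iff[of A l A] by (auto simp: K_def SL_def)

section \<open>The symplectic form on vectors and its isometries\<close>

definition sympl :: "nat \<Rightarrow> complex vec \<Rightarrow> complex vec \<Rightarrow> complex" where
  "sympl l u v = u \<bullet> (J l *\<^sub>v v)"

lemma sympl_add:
  assumes "u \<in> carrier_vec (2*l)" "v \<in> carrier_vec (2*l)" "w \<in> carrier_vec (2*l)"
  shows "sympl l (u + v) w = sympl l u w + sympl l v w" "sympl l u (v + w) = sympl l u v + sympl l u w"
  using assms
  by (simp_all add: sympl_def mult_add_distrib_mat_vec[of _ "2*l" "2*l"] add_scalar_prod_distrib[of _ "2*l"]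
      scalar_prod_add_distrib[of _ "2*l"] mult_mat_vec_carrier[of _ "2*l" "2*l"])

lemma sympl_smult:
  assumes "u \<in> carrier_vec (2*l)" "v \<in> carrier_vec (2*l)"
  shows "sympl l (c \<cdot>\<^sub>v u) v = c * sympl l u v" "sympl l u (c \<cdot>\<^sub>v v) = c * sympl l u v"
  using assms
  by (simp_all add: sympl_def mult_mat_vec[of _ "2*l" "2*l"] mult_mat_vec_carrier[of _ "2*l" "2*l"])

lemma sympl_swap:
  assumes "u \<in> carrier_vec (2*l)" "v \<in> carrier_vec (2*l)"
  shows "sympl l v u = - sympl l u v"
proof -
  have "sympl l v u = (transpose_mat (J l) *\<^sub>v v) \<bullet> u"
    unfolding sympl_def using assms by (intro transpose_vec_mult_scalar[symmetric, of _ "2*l" "2*l"]) auto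
  also have "\<dots> = - ((J l *\<^sub>v v) \<bullet> u)"
    using assms by (simp add: transpose_J uminus_mult_mat_vec mult_mat_vec_carrier[of _ "2*l" "2*l"])
  also have "\<dots> = - sympl l u v"
    using assms by (simp add: sympl_def comm_scalar_prod[of u "2*l"] mult_mat_vec_carrier[of _ "2*l" "2*l"])
  finally show ?thesis .
qed

lemma sympl_self: "u \<in> carrier_vec (2*l) \<Longrightarrow> sympl l u u = 0"
  using sympl_swap[of u l u] by simp

lemma sympl_diff:
  assumes "u \<in> carrier_vec (2*l)" "v \<in> carrier_vec (2*l)" "w \<in> carrier_vec (2*l)"
  shows "sympl l (u - v) w = sympl l u w - sympl l v w" "sympl l u (v - w) = sympl l u v - sympl l u w"
proof -
  have uv: "x - y + y = x" if "x \<in> carrier_vec (2*l)" "y \<in> carrier_vec (2*l)" for x y :: "complex vec"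
    using that by auto
  show "sympl l (u - v) w = sympl l u w - sympl l v w"
    using assms sympl_add(1)[of "u - v" l v w] by (simp add: uv[of u v])
  show "sympl l u (v - w) = sympl l u v - sympl l u w"
    using assms sympl_add(2)[of u l "v - w" w] by (simp add: uv[of v w])
qed

lemma mult_unit_vec:
  fixes A :: "'a::semiring_1 mat"
  assumes "A \<in> carrier_mat m n" "j < n"
  shows "A *\<^sub>v unit_vec n j = col A j"
  using assms by (intro eq_vecI) (auto simp: scalar_prod_right_unit)

lemma sympl_unit: 
  assumes "i < 2*l" "j < 2*l"
  shows "sympl l (unit_vec (2*l) i) (unit_vec (2*l) j) = J l $$ (i,j)"
  using assms by (simp add: sympl_def scalar_prod_left_unit mult_unit_vec[of _ "2*l" "2*l"])

lemma sympl_nondeg: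
  assumes v: "v \<in> carrier_vec (2*l)" and *: "\<And>i. i < 2*l \<Longrightarrow> sympl l (unit_vec (2*l) i) v = 0"
  shows "v = 0\<^sub>v (2*l)"
proof -
  have "J l *\<^sub>v v = 0\<^sub>v (2*l)"
  proof (rule eq_vecI)
    fix i assume "i < dim_vec (0\<^sub>v (2*l))"
    then show "(J l *\<^sub>v v) $ i = 0\<^sub>v (2*l) $ i"
      using *[of i] v
      by (simp add: sympl_def scalar_prod_left_unit mult_mat_vec_carrier[of _ "2*l" "2*l"] del: index_mult_mat_vec)
  qed simp
  then have "(- J l) *\<^sub>v (J l *\<^sub>v v) = 0\<^sub>v (2*l)" by (auto intro!: eq_vecI simp: scalar_prod_def)
  then show ?thesis
    using v by (simp add: J_mult_uminus flip: assoc_mult_mat_vec[of _ "2*l" "2*l" _ "2*l"])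
qed

lemma eq_mat_on_vecI:
  fixes A B :: "'a::comm_semiring_1 mat"
  assumes A: "A \<in> carrier_mat m n" and B: "B \<in> carrier_mat m n"
    and eq: "\<And>j. j < n \<Longrightarrow> A *\<^sub>v unit_vec n j = B *\<^sub>v unit_vec n j"
  shows "A = B"
proof (rule eq_matI)
  fix i j assume "i < dim_row B" "j < dim_col B"
  with A B have ij: "i < m" "j < n" by auto
  with eq[of j] mult_unit_vec[OF A] mult_unit_vec[OF B] have "col A j = col B j" by simp
  then have "col A j $ i = col B j $ i" by simp
  with ij A B show "A $$ (i,j) = B $$ (i,j)" by simp
qed (use A B in auto)

definition isometry :: "nat \<Rightarrow> complex mat \<Rightarrow> bool" where
  "isometry l A \<longleftrightarrow> A \<in> carrier_mat (2*l) (2*l) \<and>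
     (\<forall>u\<in>carrier_vec (2*l). \<forall>v\<in>carrier_vec (2*l). sympl l (A *\<^sub>v u) (A *\<^sub>v v) = sympl l u v)"

lemma sympl_mult_mat:
  assumes A: "A \<in> carrier_mat (2*l) (2*l)" and u: "u \<in> carrier_vec (2*l)" and v: "v \<in> carrier_vec (2*l)"
  shows "sympl l (A *\<^sub>v u) (A *\<^sub>v v) = u \<bullet> ((transpose_mat A * J l * A) *\<^sub>v v)"
proof -
  let ?n = "2*l"
  let ?w = "J l *\<^sub>v (A *\<^sub>v v)"
  have w: "?w \<in> carrier_vec ?n" using A v by (simp add: mult_mat_vec_carrier[of _ ?n ?n])
  have "sympl l (A *\<^sub>v u) (A *\<^sub>v v) = ?w \<bullet> (A *\<^sub>v u)"
    unfolding sympl_def using A u v w by (intro comm_scalar_prod[of _ ?n]) (auto simp: mult_mat_vec_carrier[of _ ?n ?n])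
  also have "\<dots> = (transpose_mat A *\<^sub>v ?w) \<bullet> u"
    using A u w by (simp add: transpose_vec_mult_scalar[of _ ?n ?n])
  also have "\<dots> = u \<bullet> (transpose_mat A *\<^sub>v ?w)"
    using A u w by (intro comm_scalar_prod[of _ ?n]) (auto simp: mult_mat_vec_carrier[of _ ?n ?n])
  finally show ?thesis 
    using A v by (simp add: assoc_mult_mat_vec[of _ ?n ?n _ ?n] mult_carrier_mat[of _ ?n ?n _ ?n] mult_mat_vec_carrier[of _ ?n ?n])
qed

lemma isometry_iff:
  "isometry l A \<longleftrightarrow> A \<in> carrier_mat (2*l) (2*l) \<and> transpose_mat A * J l * A = J l"
proof (cases "A \<in> carrier_mat (2*l) (2*l)")
  case True
  let ?n = "2*l" let ?B = "transpose_mat A * J l * A"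
  have B: "?B \<in> carrier_mat ?n ?n" using True by (auto intro!: mult_carrier_mat)
  have "?B = J l" if *: "\<And>u v. u \<in> carrier_vec ?n \<Longrightarrow> v \<in> carrier_vec ?n \<Longrightarrow> sympl l (A *\<^sub>v u) (A *\<^sub>v v) = sympl l u v"
  proof (rule eq_matI)
    fix i j assume "i < dim_row (J l :: complex mat)" "j < dim_col (J l :: complex mat)"
    then have ij: "i < ?n" "j < ?n" by auto
    have "?B $$ (i,j) = unit_vec ?n i \<bullet> (?B *\<^sub>v unit_vec ?n j)"
      using ij B by (simp add: mult_unit_vec[of _ "2*l" "2*l"] scalar_prod_left_unit del: index_mult_mat)
    also have "\<dots> = sympl l (unit_vec ?n i) (unit_vec ?n j)"
      using *[of "unit_vec ?n i" "unit_vec ?n j"] sympl_mult_mat[OF True, of "unit_vec ?n i" "unit_vec ?n j"] by simp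
    finally show "?B $$ (i,j) = J l $$ (i,j)" using ij by (simp add: sympl_unit)
  qed (use True in auto)
  then show ?thesis using True by (auto simp: isometry_def sympl_mult_mat) (simp_all add: sympl_def)
qed (simp add: isometry_def)

text \<open>\<open>sigma\<close> leads to \<open>A J A^T = J\<close>, whereas preserving the form on
  vectors means \<open>A^T J A = J\<close>. The first equation exhibits a right inverse of
  \<open>A\<close>, which is also a left inverse, and this yields the second; applying the same to
  the transpose gives the converse.\<close>

lemma isometry_iff_rows:
  "isometry l A \<longleftrightarrow> A \<in> carrier_mat (2*l) (2*l) \<and> A * J l * transpose_mat A = J l"
proof -
  let ?n = "2*l"
  have key: "transpose_mat B * J l * B = J l" 
    if B: "B \<in> carrier_mat ?n ?n" and eq: "B * J l * transpose_mat B = J l" for B :: "complex mat"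
  proof -
    have "B * (J l * transpose_mat B * (- J l)) = (B * J l * transpose_mat B) * (- J l)"
      using B by (simp add: assoc_mult_mat[of _ ?n ?n _ ?n _ ?n] mult_carrier_mat[of _ ?n ?n _ ?n])
    then have "B * (J l * transpose_mat B * (- J l)) = 1\<^sub>m ?n"
      by (simp add: eq J_mult_uminus)
    from mat_mult_left_right_inverse[OF B _ this] B
    have 1: "(J l * transpose_mat B * (- J l)) * B = 1\<^sub>m ?n" by (simp add: mult_carrier_mat[of _ ?n ?n _ ?n])
    let ?X = "transpose_mat B * J l * B"
    have X: "?X \<in> carrier_mat ?n ?n" using B by (auto intro!: mult_carrier_mat)
    have "J l * (- ?X) = (J l * transpose_mat B * (- J l)) * B"
      using B X by (simp add: assoc_mult_mat[of _ ?n ?n _ ?n _ ?n] mult_carrier_mat[of _ ?n ?n _ ?n])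
    with 1 have 2: "J l * (- ?X) = 1\<^sub>m ?n" by simp
    have "- ?X = ((- J l) * J l) * (- ?X)"
      unfolding J_mult_uminus using X by (intro left_mult_one_mat[of _ ?n ?n, symmetric]) auto
    also have "\<dots> = (- J l) * (J l * (- ?X))"
      using X by (intro assoc_mult_mat[of _ ?n ?n _ ?n _ ?n]) auto
    also have "\<dots> = - J l" unfolding 2 by (intro right_mult_one_mat[of _ ?n ?n]) auto
    finally show ?thesis by (metis uminus_uminus_mat)
  qed
  have key': "B * J l * transpose_mat B = J l" 
    if B: "B \<in> carrier_mat ?n ?n" and eq: "transpose_mat B * J l * B = J l" for B :: "complex mat"
    using key[of "transpose_mat B"] B eq by simp
  show ?thesis unfolding isometry_iff using key key' by blast
qed

lemma K_iff_isometry: "A \<in> K l \<longleftrightarrow> isometry l A \<and> det A = 1"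
  by (auto simp: K_iff isometry_iff_rows)

lemma isometry_det_square: "isometry l A \<Longrightarrow> det A * det A = 1"
proof -
  assume A: "isometry l A"
  then have c: "A \<in> carrier_mat (2*l) (2*l)" and eq: "transpose_mat A * J l * A = J l"
    by (auto simp: isometry_iff)
  have "det (transpose_mat A * J l * A) = det A * det (J l) * det A"
    using c by (subst det_mult[of _ "2*l"] | simp add: det_transpose[of _ "2*l"] mult_carrier_mat[of _ "2*l" "2*l" _ "2*l"])+
  then have "det A * det A * det (J l) = det (J l)" by (simp add: eq)
  moreover have "det (J l) * det (- J l) = (1::complex)"
    using arg_cong[OF J_mult_uminus(1)[of l, where 'a=complex], of det]
    by (subst det_mult[symmetric, of _ "2*l"]) auto
  moreover from this have "det (J l) \<noteq> (0::complex)" by auto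
  ultimately show ?thesis by simp
qed

lemma isometry_mult:
  assumes "isometry l A" "isometry l B" shows "isometry l (A * B)"
  using assms by (auto simp: isometry_def assoc_mult_mat_vec[of _ "2*l" "2*l" _ "2*l"] mult_mat_vec_carrier[of _ "2*l" "2*l"])

lemma K_carrier: "k \<in> K l \<Longrightarrow> k \<in> carrier_mat (2*l) (2*l)"
  by (simp add: K_iff)

lemma K_mult: "A \<in> K l \<Longrightarrow> B \<in> K l \<Longrightarrow> A * B \<in> K l"
  using det_mult[OF K_carrier K_carrier, of A l B] by (simp add: K_iff_isometry isometry_mult)

lemma K_one: "1\<^sub>m (2*l) \<in> K l"
  by (auto simp: K_iff)

lemma K_inverse:
  assumes k: "k \<in> K l"
  shows "minv k \<in> K l" "k * minv k = 1\<^sub>m (2*l)" "minv k * k = 1\<^sub>m (2*l)"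
proof -
  have d: "det k \<noteq> 0" using k by (simp add: K_iff)
  note inv = minv_if_det[OF K_carrier[OF k] d]
  show "k * minv k = 1\<^sub>m (2*l)" "minv k * k = 1\<^sub>m (2*l)" using inv by auto
  have "det k * det (minv k) = 1"
    using arg_cong[OF inv(2), of det] det_mult[OF K_carrier[OF k] inv(1)] by simp
  then have "det (minv k) = 1" using k by (simp add: K_iff)
  moreover have "isometry l (minv k)"
    unfolding isometry_def
  proof (intro conjI ballI)
    fix u v :: "complex vec" assume uv: "u \<in> carrier_vec (2*l)" "v \<in> carrier_vec (2*l)"
    have "sympl l (k *\<^sub>v (minv k *\<^sub>v u)) (k *\<^sub>v (minv k *\<^sub>v v)) = sympl l (minv k *\<^sub>v u) (minv k *\<^sub>v v)"
      using k uv inv(1) by (simp add: K_iff_isometry isometry_def mult_mat_vec_carrier[of _ "2*l" "2*l"])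
    then show "sympl l (minv k *\<^sub>v u) (minv k *\<^sub>v v) = sympl l u v"
      using uv inv(1,2) K_carrier[OF k] by (simp flip: assoc_mult_mat_vec[of _ "2*l" "2*l" _ "2*l"])
  qed (use inv in auto)
  ultimately show "minv k \<in> K l" by (simp add: K_iff_isometry)
qed

section \<open>Transvections and Witt's extension theorem\<close>

text \<open>The map adding \<open>a * sympl l v w\<close> times \<open>v\<close> to
  \<open>w\<close>. The functional \<open>sympl l v\<close> is the scalar product with
  \<open>J^T v = - J v\<close>, whence the minus sign.\<close>

definition transvection :: "nat \<Rightarrow> complex vec \<Rightarrow> complex \<Rightarrow> complex mat" where
  "transvection l v a = 1\<^sub>m (2*l) + mat (2*l) (2*l) (\<lambda>(i,j). a * v $ i * (- (J l *\<^sub>v v) $ j))"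

lemma transvection_carrier: "transvection l v a \<in> carrier_mat (2*l) (2*l)"
  by (simp add: transvection_def)

lemma transvection_apply:
  assumes v: "v \<in> carrier_vec (2*l)" and w: "w \<in> carrier_vec (2*l)"
  shows "transvection l v a *\<^sub>v w = w + (a * sympl l v w) \<cdot>\<^sub>v v"
proof -
  let ?V = "mat (2*l) (2*l) (\<lambda>(i,j). a * v $ i * (- (J l *\<^sub>v v) $ j))"
  have Jv: "J l *\<^sub>v v \<in> carrier_vec (2*l)" using v by (simp add: mult_mat_vec_carrier[of _ "2*l" "2*l"])
  have s: "sympl l v w = (\<Sum>j<2*l. (- (J l *\<^sub>v v) $ j) * w $ j)"
    using sympl_swap[OF w v] w v Jv
    by (simp add: sympl_def scalar_prod_def sum_negf atLeast0LessThan mult.commute del: index_mult_mat_vec)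
  have "?V *\<^sub>v w = (a * sympl l v w) \<cdot>\<^sub>v v"
  proof (rule eq_vecI)
    fix i assume "i < dim_vec ((a * sympl l v w) \<cdot>\<^sub>v v)"
    then have i: "i < 2*l" using v by simp
    have "(?V *\<^sub>v w) $ i = (\<Sum>j<2*l. a * v $ i * (- (J l *\<^sub>v v) $ j) * w $ j)"
      using i w by (simp add: scalar_prod_def atLeast0LessThan)
    also have "\<dots> = a * v $ i * sympl l v w"
      unfolding s sum_distrib_left by (intro sum.cong) (auto simp: mult.assoc)
    finally show "(?V *\<^sub>v w) $ i = ((a * sympl l v w) \<cdot>\<^sub>v v) $ i"
      using i v by simp
  qed (use v in simp)
  then show ?thesis
    using w by (simp add: transvection_def add_mult_distrib_mat_vec[of _ "2*l" "2*l"])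
qed

lemma isometry_transvection:
  assumes v: "v \<in> carrier_vec (2*l)"
  shows "isometry l (transvection l v a)"
  unfolding isometry_def
proof (intro conjI ballI)
  fix u w :: "complex vec" assume uw: "u \<in> carrier_vec (2*l)" "w \<in> carrier_vec (2*l)"
  then show "sympl l (transvection l v a *\<^sub>v u) (transvection l v a *\<^sub>v w) = sympl l u w"
    using v sympl_swap[OF uw(1) v]
    by (simp add: transvection_apply sympl_add sympl_smult sympl_self algebra_simps)
qed (rule transvection_carrier)

text \<open>Isometries have determinant \<open>\<plusminus>1\<close>, and a transvection is the square of a transvection.\<close>

lemma transvection_in_K:
  assumes v: "v \<in> carrier_vec (2*l)"
  shows "transvection l v a \<in> K l"
proof -
  let ?T = "transvection l v (a/2)"
  have "transvection l v a = ?T * ?T"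
  proof (rule eq_mat_on_vecI[of _ "2*l" "2*l"])
    fix j assume "j < 2*l"
    let ?e = "unit_vec (2*l) j"
    have "?T *\<^sub>v (?T *\<^sub>v ?e) = ?e + (a * sympl l v ?e) \<cdot>\<^sub>v v"
      using v by (simp add: transvection_apply sympl_add sympl_smult sympl_self)
        (auto intro!: eq_vecI simp: algebra_simps)
    then show "transvection l v a *\<^sub>v ?e = ?T * ?T *\<^sub>v ?e"
      using v by (simp add: transvection_apply transvection_carrier
          assoc_mult_mat_vec[OF transvection_carrier transvection_carrier])
  qed (auto intro!: transvection_carrier mult_carrier_mat)
  then have "det (transvection l v a) = 1"
    using isometry_det_square[OF isometry_transvection[OF v, of "a/2"]]
    by (simp add: det_mult[OF transvection_carrier transvection_carrier])
  then show ?thesis by (simp add: K_iff_isometry isometry_transvection v)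
qed

text \<open>A transvection along \<open>p - q\<close> moves \<open>p\<close> by a multiple of
  \<open>p - q\<close> and fixes everything orthogonal to \<open>p - q\<close>. Since
  \<open>sympl l (p - q) p = sympl l p q\<close>, the coefficient \<open>- 1 / sympl l p q\<close>
  makes the displacement exactly \<open>- (p - q)\<close>.\<close>

lemma K_move_direct:
  assumes p: "p \<in> carrier_vec (2*l)" and q: "q \<in> carrier_vec (2*l)" and pq: "sympl l p q \<noteq> 0"
  shows "\<exists>T\<in>K l. T *\<^sub>v p = q \<and> (\<forall>h\<in>carrier_vec (2*l). sympl l p h = sympl l q h \<longrightarrow> T *\<^sub>v h = h)"
proof (intro bexI conjI ballI impI)
  let ?T = "transvection l (p - q) (- 1 / sympl l p q)"
  have d: "p - q \<in> carrier_vec (2*l)" using p q by simp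
  have "- 1 / sympl l p q * sympl l (p - q) p = - 1"
    using p q pq sympl_swap[OF p q] by (simp add: sympl_diff sympl_self)
  then have "?T *\<^sub>v p = p + (- 1) \<cdot>\<^sub>v (p - q)"
    using transvection_apply[OF d p] by simp
  also have "\<dots> = q" using p q by (auto intro!: eq_vecI)
  finally show "?T *\<^sub>v p = q" .
  show "?T \<in> K l" using d by (rule transvection_in_K)
  fix h :: "complex vec" assume h: "h \<in> carrier_vec (2*l)" and "sympl l p h = sympl l q h"
  then have "sympl l (p - q) h = 0" using p q by (simp add: sympl_diff)
  then have "?T *\<^sub>v h = h + 0 \<cdot>\<^sub>v (p - q)" using transvection_apply[OF d h] by simp
  moreover have "0 \<cdot>\<^sub>v (p - q) = 0\<^sub>v (2*l)" using d p q by (intro eq_vecI) auto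
  ultimately show "?T *\<^sub>v h = h" using h d by simp
qed

lemma K_apply_carrier: "T \<in> K l \<Longrightarrow> v \<in> carrier_vec (2*l) \<Longrightarrow> T *\<^sub>v v \<in> carrier_vec (2*l)"
  using K_carrier by (auto simp: mult_mat_vec_carrier[of _ "2*l" "2*l"])

lemma K_mult_apply: "A \<in> K l \<Longrightarrow> B \<in> K l \<Longrightarrow> v \<in> carrier_vec (2*l) \<Longrightarrow> A * B *\<^sub>v v = A *\<^sub>v (B *\<^sub>v v)"
  using K_carrier by (simp add: assoc_mult_mat_vec[of _ "2*l" "2*l" _ "2*l"])

lemma K_symp:
  "T \<in> K l \<Longrightarrow> u \<in> carrier_vec (2*l) \<Longrightarrow> v \<in> carrier_vec (2*l) \<Longrightarrow> sympl l (T *\<^sub>v u) (T *\<^sub>v v) = sympl l u v"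
  by (simp add: K_iff_isometry isometry_def)

lemma K_inverse_apply:
  "T \<in> K l \<Longrightarrow> v \<in> carrier_vec (2*l) \<Longrightarrow> T *\<^sub>v (minv T *\<^sub>v v) = v"
  "T \<in> K l \<Longrightarrow> v \<in> carrier_vec (2*l) \<Longrightarrow> minv T *\<^sub>v (T *\<^sub>v v) = v"
  using K_inverse[of T l] K_mult_apply[of T l "minv T" v] K_mult_apply[of "minv T" l T v] by auto

text \<open>For orthogonal \<open>p\<close> and \<open>q\<close> no single transvection as in
  \<open>K_move_direct\<close> is available; the way leads through a vector \<open>z\<close>
  orthogonal to neither.\<close>

lemma K_move:
  assumes p: "p \<in> carrier_vec (2*l)" and q: "q \<in> carrier_vec (2*l)" and z: "z \<in> carrier_vec (2*l)"
    and pz: "sympl l p z \<noteq> 0" and zq: "sympl l z q \<noteq> 0" and H: "H \<subseteq> carrier_vec (2*l)"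
    and Hz: "\<And>h. h \<in> H \<Longrightarrow> sympl l p h = sympl l z h" and Hq: "\<And>h. h \<in> H \<Longrightarrow> sympl l z h = sympl l q h"
  shows "\<exists>T\<in>K l. T *\<^sub>v p = q \<and> (\<forall>h\<in>H. T *\<^sub>v h = h)"
proof -
  obtain A where A: "A \<in> K l" "A *\<^sub>v p = z" "\<forall>h\<in>H. A *\<^sub>v h = h"
    using K_move_direct[OF p z pz] H Hz by blast
  obtain B where B: "B \<in> K l" "B *\<^sub>v z = q" "\<forall>h\<in>H. B *\<^sub>v h = h"
    using K_move_direct[OF z q zq] H Hq by blast
  show ?thesis
    using A B H p by (intro bexI[of _ "B * A"] conjI ballI K_mult) (auto simp: K_mult_apply)
qed

text \<open>The value \<open>(-1)^a\<close> is the pairing of the standard vectors with indices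
  \<open>a\<close> and \<open>2*l - 1 - a\<close> under \<open>J\<close>, so such a family has the
  same Gram matrix as these standard vectors.\<close>

definition hyperbolic :: "nat \<Rightarrow> nat \<Rightarrow> (nat \<Rightarrow> complex vec) \<Rightarrow> (nat \<Rightarrow> complex vec) \<Rightarrow> bool" where
  "hyperbolic l r u w \<longleftrightarrow> (\<forall>a<r. u a \<in> carrier_vec (2*l) \<and> w a \<in> carrier_vec (2*l)) \<and>
     (\<forall>a<r. \<forall>b<r. sympl l (u a) (u b) = 0 \<and> sympl l (w a) (w b) = 0 \<and>
        sympl l (u a) (w b) = (if a = b then (-1)^a else 0))"

text \<open>Induction on the number of pairs. The new pair is pulled back by the isometry already
  found, and the next standard pair is moved onto it in two moves, each fixing the vectors already
  in place.\<close>

lemma witt_extension: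
  assumes "r \<le> l" "hyperbolic l r u w"
  shows "\<exists>k\<in>K l. \<forall>a<r. k *\<^sub>v unit_vec (2*l) a = u a \<and> k *\<^sub>v unit_vec (2*l) (2*l - 1 - a) = w a"
  using assms
proof (induction r)
  case 0
  then show ?case using K_one by auto
next
  case (Suc r)
  let ?C = "carrier_vec (2*l) :: complex vec set"
  define e e' :: "nat \<Rightarrow> complex vec"
    where "e = (\<lambda>a. unit_vec (2*l) a)" and "e' = (\<lambda>a. unit_vec (2*l) (2*l - 1 - a))"
  have eC: "e a \<in> ?C" "e' a \<in> ?C" for a by (auto simp: e_def e'_def)
  have ee: "sympl l (e a) (e b) = 0" "sympl l (e' a) (e' b) = 0"
    "sympl l (e a) (e' b) = (if a = b then (-1)^a else 0)" if "a \<le> r" "b \<le> r" for a b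
    using that Suc.prems(1) by (auto simp: e_def e'_def sympl_unit index_J)
  have e'e: "sympl l (e' a) (e b) = (if a = b then - ((-1)^a) else 0)" if "a \<le> r" "b \<le> r" for a b
    using ee(3)[OF that(2,1)] sympl_swap[OF eC(1)[of b] eC(2)[of a]] by auto
  from Suc.prems have "hyperbolic l r u w" by (auto simp: hyperbolic_def)
  with Suc obtain k where k: "k \<in> K l" and ku: "\<And>a. a < r \<Longrightarrow> k *\<^sub>v e a = u a"
    and kw: "\<And>a. a < r \<Longrightarrow> k *\<^sub>v e' a = w a" by (auto simp: e_def e'_def)
  have uwC: "u a \<in> ?C" "w a \<in> ?C" if "a \<le> r" for a
    using Suc.prems(2) that by (auto simp: hyperbolic_def)
  have uw: "sympl l (u a) (u b) = 0" "sympl l (w a) (w b) = 0" 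
    "sympl l (u a) (w b) = (if a = b then (-1)^a else 0)" if "a \<le> r" "b \<le> r" for a b
    using Suc.prems(2) that by (auto simp: hyperbolic_def)
  have wu: "sympl l (w a) (u b) = (if a = b then - ((-1)^a) else 0)" if "a \<le> r" "b \<le> r" for a b
    using uw(3)[OF that(2,1)] sympl_swap[OF uwC(1)[OF that(2)] uwC(2)[OF that(1)]] by auto
  \<comment> \<open>Pulled back by \<open>k\<close>, the new pair is orthogonal to the first
    \<open>r\<close> standard pairs, collected in \<open>H\<close> below, so it can be reached while
    \<open>H\<close> stays fixed.\<close>
  define f g where "f = minv k *\<^sub>v u r" and "g = minv k *\<^sub>v w r"
  have fgC: "f \<in> ?C" "g \<in> ?C" 
    using K_apply_carrier[OF K_inverse(1)[OF k]] uwC[of r] by (auto simp: f_def g_def)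
  have kf: "k *\<^sub>v f = u r" "k *\<^sub>v g = w r" 
    using K_inverse_apply(1)[OF k] uwC[of r] by (auto simp: f_def g_def)
  define H where "H = e ` {..<r} \<union> e' ` {..<r}"
  have HC: "H \<subseteq> ?C" using eC by (auto simp: H_def)
  have eH: "sympl l (e r) h = 0" "sympl l (e' r) h = 0" if "h \<in> H" for h
    using that by (auto simp: H_def ee e'e)
  have fH: "sympl l f h = 0" "sympl l g h = 0" if h: "h \<in> H" for h
  proof -
    have "sympl l (u r) (k *\<^sub>v h) = 0" "sympl l (w r) (k *\<^sub>v h) = 0"
      using h by (auto simp: H_def ku kw uw wu)
    moreover have "sympl l (k *\<^sub>v f) (k *\<^sub>v h) = sympl l f h" "sympl l (k *\<^sub>v g) (k *\<^sub>v h) = sympl l g h"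
      using K_symp[OF k] fgC HC h by auto
    ultimately show "sympl l f h = 0" "sympl l g h = 0" by (auto simp: kf)
  qed
  have fg: "sympl l f g = (-1)^r" using K_symp[OF k fgC] uw(3)[of r r] by (simp add: kf)
  have gf: "sympl l g f = - ((-1)^r)" using sympl_swap[OF fgC] fg by simp
  \<comment> \<open>\<open>e' r\<close> is not orthogonal to \<open>e r\<close>, and
    \<open>g\<close> is not orthogonal to \<open>f\<close>. If one of them also fails to be
    orthogonal to the other vector, it serves as \<open>z\<close>; if neither does, the cross terms
    vanish and their sum serves.\<close>
  have "\<exists>z\<in>?C. sympl l (e r) z \<noteq> 0 \<and> sympl l z f \<noteq> 0 \<and> (\<forall>h\<in>H. sympl l z h = 0)"
  proof (cases "sympl l (e r) g = 0 \<and> sympl l (e' r) f = 0")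
    case True
    then show ?thesis using eC fgC HC eH fH
      by (intro bexI[of _ "e' r + g"]) (auto simp: sympl_add gf ee subset_iff)
  next
    case False
    show ?thesis
    proof (cases "sympl l (e r) g = 0")
      case True
      then have "sympl l (e' r) f \<noteq> 0" "sympl l (e r) (e' r) \<noteq> 0" using False ee(3)[of r r] by auto
      then show ?thesis using eC(2) eH(2) by blast
    next
      case False
      moreover have "sympl l g f \<noteq> 0" using gf by simp
      ultimately show ?thesis using fgC(2) fH(2) by blast
    qed
  qed
  then obtain z where "z \<in> ?C" "sympl l (e r) z \<noteq> 0" "sympl l z f \<noteq> 0" "\<forall>h\<in>H. sympl l z h = 0" by blast
  then obtain A where A: "A \<in> K l" "A *\<^sub>v e r = f" "\<forall>h\<in>H. A *\<^sub>v h = h"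
    using K_move[OF eC(1) fgC(1), of z r H] HC eH fH by auto
  define g' where "g' = minv A *\<^sub>v g"
  have g'C: "g' \<in> ?C" using K_apply_carrier[OF K_inverse(1)[OF A(1)]] fgC by (auto simp: g'_def)
  have Ag': "A *\<^sub>v g' = g" using K_inverse_apply(1)[OF A(1)] fgC by (auto simp: g'_def)
  have g'H: "sympl l g' h = 0" if "h \<in> H" for h
    using K_symp[OF A(1) g'C, of h] HC that A(3) fH(2)[OF that] by (auto simp: Ag')
  have eg': "sympl l (e r) g' = (-1)^r"
    using K_symp[OF A(1) eC(1)[of r] g'C] by (simp add: A(2) Ag' fg)
  have g'e: "sympl l g' (e r) = - ((-1)^r)" using sympl_swap[OF eC(1)[of r] g'C] eg' by simp
  have HeC: "insert (e r) H \<subseteq> ?C" using HC eC by auto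
  \<comment> \<open>The second move must also fix \<open>e r\<close>, already sent to
    \<open>f\<close> by \<open>A\<close>. This is possible because \<open>e' r\<close> and
    \<open>g'\<close> have the same pairing with \<open>e r\<close>.\<close>
  have same: "sympl l (e' r) h = sympl l g' h" if "h \<in> insert (e r) H" for h
    using that eH g'H by (auto simp: e'e g'e)
  have "\<exists>B\<in>K l. B *\<^sub>v e' r = g' \<and> (\<forall>h\<in>insert (e r) H. B *\<^sub>v h = h)"
  proof (cases "sympl l (e' r) g' = 0")
    \<comment> \<open>The intermediate vector is \<open>e' r + e r\<close>: adding
      \<open>e r\<close> changes no pairing with \<open>insert (e r) H\<close>, since
      \<open>e r\<close> is orthogonal to that set, but it breaks the orthogonality to
      \<open>e' r\<close> and to \<open>g'\<close>.\<close>
    case True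
    show ?thesis
    proof (rule K_move[OF eC(2) g'C _ _ _ HeC])
      show "sympl l (e' r) (e' r + e r) \<noteq> 0" using eC by (simp add: sympl_add ee e'e)
      show "sympl l (e' r + e r) g' \<noteq> 0" using True eC g'C by (simp add: sympl_add eg')
      have s: "sympl l (e r) h = 0" if "h \<in> insert (e r) H" for h using that eH ee by auto
      then show s': "sympl l (e' r) h = sympl l (e' r + e r) h" if "h \<in> insert (e r) H" for h
        using that HeC eC by (auto simp: sympl_add)
      show "sympl l (e' r + e r) h = sympl l g' h" if "h \<in> insert (e r) H" for h
        using s'[OF that] same[OF that] by simp
    qed (use eC in auto)
  next
    case False
    then show ?thesis using K_move_direct[OF eC(2) g'C False] HeC same by blast
  qed
  then obtain B where B: "B \<in> K l" "B *\<^sub>v e' r = g'" "\<forall>h\<in>insert (e r) H. B *\<^sub>v h = h" by blast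
  \<comment> \<open>\<open>B\<close> acts first, sending \<open>e' r\<close> to \<open>g'\<close>
    and fixing \<open>e r\<close>; \<open>A\<close> then sends this pair to \<open>f\<close> and
    \<open>g\<close>, and \<open>k\<close> carries it to \<open>u r\<close> and
    \<open>w r\<close>.\<close>
  let ?T = "k * A * B"
  have T: "?T *\<^sub>v v = k *\<^sub>v (A *\<^sub>v (B *\<^sub>v v))" if "v \<in> ?C" for v
    using K_mult_apply[OF K_mult[OF k A(1)] B(1) that] K_mult_apply[OF k A(1) K_apply_carrier[OF B(1) that]] by simp
  have "?T *\<^sub>v e a = u a \<and> ?T *\<^sub>v e' a = w a" if "a < Suc r" for a
  proof (cases "a = r")
    case True
    then show ?thesis using A B by (simp add: T eC Ag' kf)
  next
    case False
    then have "a < r" using that by simp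
    moreover from this have "e a \<in> H" "e' a \<in> H" by (auto simp: H_def)
    ultimately show ?thesis using A B by (simp add: T eC ku kw)
  qed
  moreover have "?T \<in> K l" using k A B by (simp add: K_mult)
  ultimately show ?case unfolding e_def e'_def by blast
qed

lemma hyperbolic_mono: "hyperbolic l r u w \<Longrightarrow> s \<le> r \<Longrightarrow> hyperbolic l s u w"
  by (auto simp: hyperbolic_def)

text \<open>By Witt's theorem the first \<open>l\<close> pairs are the image of the whole standard
  basis. A further vector \<open>u l\<close>, orthogonal to all of them, is zero by nondegeneracy,
  which contradicts its nonzero pairing with \<open>w l\<close>.\<close>

lemma hyperbolic_bound:
  assumes h: "hyperbolic l r u w" shows "r \<le> l"
proof (rule ccontr)
  assume "\<not> r \<le> l"
  then have lr: "l < r" by simp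
  obtain k where k: "k \<in> K l"
    and ku: "\<And>a. a < l \<Longrightarrow> k *\<^sub>v unit_vec (2*l) a = u a \<and> k *\<^sub>v unit_vec (2*l) (2*l - 1 - a) = w a"
    using witt_extension[of l l u w] hyperbolic_mono[OF h] lr by auto
  have C: "u l \<in> carrier_vec (2*l)" "w l \<in> carrier_vec (2*l)" using h lr by (auto simp: hyperbolic_def)
  let ?f = "minv k *\<^sub>v u l"
  have f: "?f \<in> carrier_vec (2*l)" using K_apply_carrier[OF K_inverse(1)[OF k]] C by auto
  have "?f = 0\<^sub>v (2*l)"
  proof (rule sympl_nondeg[OF f])
    fix i assume i: "i < 2*l"
    have "sympl l (k *\<^sub>v unit_vec (2*l) i) (u l) = 0"
    proof (cases "i < l")
      case True
      then show ?thesis using ku[of i] h lr by (auto simp: hyperbolic_def)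
    next
      case False
      then have a: "2*l - 1 - i < l" "2*l - 1 - (2*l - 1 - i) = i" using i by auto
      then have "k *\<^sub>v unit_vec (2*l) i = w (2*l - 1 - i)" using ku[of "2*l - 1 - i"] by simp
      moreover have "sympl l (u l) (w (2*l - 1 - i)) = 0" 
        using h lr a(1) by (auto simp: hyperbolic_def)
      moreover have "w (2*l - 1 - i) \<in> carrier_vec (2*l)" using h lr a(1) by (auto simp: hyperbolic_def)
      ultimately show ?thesis using sympl_swap[OF C(1)] by simp
    qed
    then show "sympl l (unit_vec (2*l) i) ?f = 0"
      using K_symp[OF k, of "unit_vec (2*l) i" ?f] f K_inverse_apply(1)[OF k C(1)] by simp
  qed
  then have "u l = k *\<^sub>v 0\<^sub>v (2*l)" using K_inverse_apply(1)[OF k C(1)] by simp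
  also have "\<dots> = 0\<^sub>v (2*l)" using K_carrier[OF k] by (auto intro!: eq_vecI simp: scalar_prod_def)
  finally have "sympl l (u l) (w l) = 0" using C by (simp add: sympl_def mult_mat_vec_carrier[of _ "2*l" "2*l"])
  then show False using h lr by (auto simp: hyperbolic_def)
qed

section \<open>Self-adjoint matrices of square zero\<close>

lemma smult_zero_vec_right: "c \<cdot>\<^sub>v 0\<^sub>v n = (0\<^sub>v n :: 'a::mult_zero vec)"
  by (rule eq_vecI) auto

lemma sympl_zero: "u \<in> carrier_vec (2*l) \<Longrightarrow> sympl l u (0\<^sub>v (2*l)) = 0"
  using sympl_smult(2)[of u l "0\<^sub>v (2*l)" 0] by (simp add: smult_zero_vec_right)

definition flip :: "nat \<Rightarrow> nat" where
  "flip a = (if even a then a + 1 else a - 1)"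

lemma flip_flip [simp]: "flip (flip a) = a" by (auto simp: flip_def)

lemma flip_less: "flip a < 2*j \<longleftrightarrow> a < 2*j" unfolding flip_def by presburger

lemma even_flip [simp]: "even (flip a) \<longleftrightarrow> odd a" by (auto simp: flip_def)

lemma flip_eq_iff: "flip a = b \<longleftrightarrow> a = flip b" by auto

text \<open>The normal form sends \<open>e\<^sub>p\<close>, for \<open>p < 2j\<close>, to the hyperbolic partner of the vector indexed by
  \<open>flip p\<close>. Since $J_{p,2l-1-p} = (-1)^p$, exchanging \<open>2i\<close> and \<open>2i+1\<close> makes all entries \<open>1\<close>.\<close>

definition std_nilpotent :: "nat \<Rightarrow> nat \<Rightarrow> 'a::{zero,one} mat" where
  "std_nilpotent l j = mat (2*l) (2*l) (\<lambda>(q,p). if p < 2*j \<and> q + flip p + 1 = 2*l then 1 else 0)"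

text \<open>The conditions of \<open>N\<pp>2 l\<close> with the inverse of \<open>J\<close> cleared
  and without the trace; \<open>N\<pp>2_iff\<close> obtains trace 0 from the classification.\<close>

definition self_adjoint_sq0 :: "nat \<Rightarrow> complex mat \<Rightarrow> bool" where
  "self_adjoint_sq0 l x \<longleftrightarrow> x \<in> carrier_mat (2*l) (2*l) \<and> x * J l = J l * transpose_mat x \<and>
     x * x = 0\<^sub>m (2*l) (2*l)"

lemma std_nilpotent_carrier [simp, intro]: "std_nilpotent l j \<in> carrier_mat (2*l) (2*l)"
  and dim_std_nilpotent [simp]: "dim_row (std_nilpotent l j) = 2*l" "dim_col (std_nilpotent l j) = 2*l"
  by (auto simp: std_nilpotent_def)

lemma adjoint_left:
  fixes x :: "'a::field mat"
  assumes x: "x \<in> carrier_mat (2*l) (2*l)" and sa: "x * J l = J l * transpose_mat x"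
  shows "J l * x = transpose_mat x * J l"
proof -
  let ?n = "2*l"
  have "(- J l) * (x * J l) * (- J l) = (- J l) * (J l * transpose_mat x) * (- J l)" by (simp only: sa)
  then have "(- J l) * x * (J l * (- J l)) = ((- J l) * J l) * transpose_mat x * (- J l)"
    using x by (simp add: assoc_mult_mat[of _ ?n ?n _ ?n _ ?n] mult_carrier_mat[of _ ?n ?n _ ?n])
  then have "(- J l) * x = transpose_mat x * (- J l)"
    using x unfolding J_mult_uminus
    by (simp add: mult_carrier_mat[of _ ?n ?n _ ?n] left_mult_one_mat[of _ ?n ?n] right_mult_one_mat[of _ ?n ?n])
  then show ?thesis using x by simp
qed

lemma self_adjoint_sq0_apply:
  assumes x: "self_adjoint_sq0 l x" and u: "u \<in> carrier_vec (2*l)" and v: "v \<in> carrier_vec (2*l)"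
  shows "sympl l (x *\<^sub>v u) v = sympl l u (x *\<^sub>v v)" "x *\<^sub>v (x *\<^sub>v v) = 0\<^sub>v (2*l)" "x *\<^sub>v v \<in> carrier_vec (2*l)"
proof -
  let ?n = "2*l"
  have xc: "x \<in> carrier_mat ?n ?n" and sa: "x * J l = J l * transpose_mat x" and xx: "x * x = 0\<^sub>m ?n ?n"
    using x by (auto simp: self_adjoint_sq0_def)
  show xv: "x *\<^sub>v v \<in> carrier_vec ?n" using xc v by (simp add: mult_mat_vec_carrier[of _ ?n ?n])
  have "x *\<^sub>v (x *\<^sub>v v) = (x * x) *\<^sub>v v" using xc v by (simp add: assoc_mult_mat_vec[of _ ?n ?n _ ?n])
  then show "x *\<^sub>v (x *\<^sub>v v) = 0\<^sub>v ?n" using v unfolding xx by (auto intro!: eq_vecI)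
  note Jx = adjoint_left[OF xc sa]
  have "sympl l (x *\<^sub>v u) v = (J l *\<^sub>v v) \<bullet> (x *\<^sub>v u)"
    unfolding sympl_def using xc u v by (intro comm_scalar_prod[of _ ?n]) (auto simp: mult_mat_vec_carrier[of _ ?n ?n])
  also have "\<dots> = (transpose_mat x *\<^sub>v (J l *\<^sub>v v)) \<bullet> u"
    using xc u v by (intro transpose_vec_mult_scalar[of _ ?n ?n, symmetric]) (auto simp: mult_mat_vec_carrier[of _ ?n ?n])
  also have "\<dots> = ((transpose_mat x * J l) *\<^sub>v v) \<bullet> u"
    using xc v by (simp add: assoc_mult_mat_vec[of _ ?n ?n _ ?n])
  also have "\<dots> = (J l *\<^sub>v (x *\<^sub>v v)) \<bullet> u"
    using xc v by (simp add: Jx[symmetric] assoc_mult_mat_vec[of _ ?n ?n _ ?n])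
  also have "\<dots> = sympl l u (x *\<^sub>v v)"
    unfolding sympl_def using u xv by (intro comm_scalar_prod[of _ ?n]) (auto simp: mult_mat_vec_carrier[of _ ?n ?n])
  finally show "sympl l (x *\<^sub>v u) v = sympl l u (x *\<^sub>v v)" .
qed

section \<open>Frames and the classification under \<open>K\<close>\<close>

text \<open>A frame of length \<open>j\<close> is a family of \<open>2j\<close> vectors such that the vectors
  $u_{2i}$, $u_{2i+1}$, $x u_{2i}$, $x u_{2i+1}$ span mutually orthogonal hyperbolic \<open>x\<close>-stable subspaces.\<close>

definition frame :: "nat \<Rightarrow> complex mat \<Rightarrow> nat \<Rightarrow> (nat \<Rightarrow> complex vec) \<Rightarrow> bool" where
  "frame l x j u \<longleftrightarrow> hyperbolic l (2*j) u (\<lambda>a. x *\<^sub>v u (flip a))"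

text \<open>By self-adjointness \<open>sympl l a (x b)\<close> is alternating in \<open>a\<close>
  and \<open>b\<close>, so \<open>p\<close> and \<open>q\<close> behave like a hyperbolic pair for
  it. It remains to normalize their pairing to 1 and to make them orthogonal for
  \<open>sympl\<close> itself; both corrections of \<open>q\<close> preserve orthogonality to the
  old frame.\<close>

lemma frame_extend:
  assumes x: "self_adjoint_sq0 l x" and f: "frame l x j u"
    and p: "p \<in> carrier_vec (2*l)" and q: "q \<in> carrier_vec (2*l)" and pq: "sympl l p (x *\<^sub>v q) \<noteq> 0"
    and orth: "\<And>a. a < 2*j \<Longrightarrow> sympl l (u a) p = 0 \<and> sympl l (u a) q = 0 \<and>
       sympl l (u a) (x *\<^sub>v p) = 0 \<and> sympl l (u a) (x *\<^sub>v q) = 0"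
  shows "\<exists>u. frame l x (Suc j) u"
proof -
  let ?C = "carrier_vec (2*l) :: complex vec set"
  note X = self_adjoint_sq0_apply[OF x]
  have uC: "u a \<in> ?C" if "a < 2*j" for a using that f by (auto simp: frame_def hyperbolic_def)
  define c where "c = 1 / sympl l p (x *\<^sub>v q)"
  define q1 where "q1 = c \<cdot>\<^sub>v q"
  have q1: "q1 \<in> ?C" using q by (simp add: q1_def)
  have xc: "x \<in> carrier_mat (2*l) (2*l)" using x by (simp add: self_adjoint_sq0_def)
  have xq1: "x *\<^sub>v q1 = c \<cdot>\<^sub>v (x *\<^sub>v q)" unfolding q1_def using xc q by (rule mult_mat_vec)
  have pq1: "sympl l p (x *\<^sub>v q1) = 1" 
    using pq p X(3)[OF q q] by (simp add: xq1 sympl_smult c_def)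
  have oq1: "sympl l (u a) q1 = 0" "sympl l (u a) (x *\<^sub>v q1) = 0" if "a < 2*j" for a
    using orth[OF that] uC[OF that] X(3)[OF q q] q by (simp_all add: xq1 sympl_smult) (simp add: q1_def sympl_smult)
  \<comment> \<open>As \<open>x q1\<close> pairs to 1 with \<open>p\<close>, the subtraction kills
    \<open>sympl l p q1\<close>. It leaves \<open>x q1\<close> unchanged because \<open>x\<close>
    has square zero.\<close>
  define q2 where "q2 = q1 - sympl l p q1 \<cdot>\<^sub>v (x *\<^sub>v q1)"
  have q2: "q2 \<in> ?C" using q1 X(3)[OF q1 q1] by (simp add: q2_def)
  have "x *\<^sub>v q2 = x *\<^sub>v q1 - sympl l p q1 \<cdot>\<^sub>v (x *\<^sub>v (x *\<^sub>v q1))"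
    using xc q1 X(3)[OF q1 q1] by (simp add: q2_def mult_minus_distrib_mat_vec[of _ "2*l" "2*l"] mult_mat_vec[of _ "2*l" "2*l"])
  also have "\<dots> = x *\<^sub>v q1" unfolding X(2)[OF q1 q1] smult_zero_vec_right using X(3)[OF q1 q1] by (intro eq_vecI) auto
  finally have xq2: "x *\<^sub>v q2 = x *\<^sub>v q1" .
  have pq2: "sympl l p q2 = 0" using p q1 X(3)[OF q1 q1] 
    by (simp add: q2_def sympl_diff sympl_smult pq1)
  have oq2: "sympl l (u a) q2 = 0" "sympl l (u a) (x *\<^sub>v q2) = 0" if "a < 2*j" for a
    using oq1[OF that] uC[OF that] X(3)[OF q1 q1] q1 by (simp_all add: xq2) (simp add: q2_def sympl_smult sympl_diff)
  have pxq2: "sympl l p (x *\<^sub>v q2) = 1" by (simp add: xq2 pq1)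
  \<comment> \<open>The partners under \<open>flip\<close> are \<open>x q2\<close> for
    \<open>p\<close> and \<open>x p\<close> for \<open>q2\<close>. The pairings are 1 and, by the
    alternating property, -1, which are the signs \<open>(-1)^(2*j)\<close> and
    \<open>(-1)^(2*j+1)\<close> demanded by \<open>hyperbolic\<close>.\<close>
  define v where "v = u(2*j := p, 2*j+1 := q2)"
  have vC: "v a \<in> ?C" if "a < 2 * Suc j" for a
    using that f p q2 by (auto simp: v_def frame_def hyperbolic_def)
  have skew: "sympl l a (x *\<^sub>v b) = - sympl l b (x *\<^sub>v a)" if "a \<in> ?C" "b \<in> ?C" for a b
    using X(1)[OF that] sympl_swap[OF that(2) X(3)[OF that(1) that(1)]] by simp
  have old: "sympl l (u a) (u b) = 0" "sympl l (u a) (x *\<^sub>v u (flip b)) = (if a = b then (-1)^a else 0)"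
    if "a < 2*j" "b < 2*j" for a b
    using that f by (auto simp: frame_def hyperbolic_def)
  have old': "sympl l (u a) (x *\<^sub>v u b) = (if a = flip b then (-1)^a else 0)"
    if "a < 2*j" "b < 2*j" for a b
    using old(2)[of a "flip b"] that by (simp add: flip_less)
  have skew0: "sympl l a (x *\<^sub>v a) = 0" if "a \<in> ?C" for a using skew[OF that that] by simp
  have vu: "sympl l (v a) (v b) = 0" if "a < 2 * Suc j" "b < 2 * Suc j" for a b
  proof -
    have s: "sympl l p (u b) = 0" "sympl l q2 (u b) = 0" if "b < 2*j" for b
      using sympl_swap[OF uC[OF that] p] sympl_swap[OF uC[OF that] q2] orth[OF that] oq2[OF that] by auto
    have "sympl l q2 p = 0" using sympl_swap[OF p q2] pq2 by simp
    then show ?thesis using that s orth oq2 old pq2 p q2 by (auto simp: v_def sympl_self less_Suc_eq)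
  qed
  have vx: "sympl l (v a) (x *\<^sub>v v b) = (if a = flip b then (-1)^a else 0)" if "a < 2 * Suc j" "b < 2 * Suc j" for a b
  proof -
    have s: "sympl l p (x *\<^sub>v u b) = 0" "sympl l q2 (x *\<^sub>v u b) = 0" if "b < 2*j" for b
      using skew[OF uC[OF that] p] skew[OF uC[OF that] q2] orth[OF that] oq2[OF that] by auto
    have t: "sympl l q2 (x *\<^sub>v p) = -1" using skew[OF q2 p] pxq2 by simp
    have fl: "flip (2*j) = 2*j+1" "flip (2*j+1) = 2*j" by (auto simp: flip_def)
    have fne: "2*j \<noteq> flip b" "Suc (2*j) \<noteq> flip b" "b \<noteq> flip (2*j)" if "b < 2*j" for b
      using that flip_less[of b j] by auto
    consider "a < 2*j" | "a = 2*j" | "a = 2*j+1" using \<open>a < 2 * Suc j\<close> by fastforce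
    then show ?thesis
    proof cases
      case 1
      consider "b < 2*j" | "b = 2*j" | "b = 2*j+1" using \<open>b < 2 * Suc j\<close> by fastforce
      then show ?thesis
      proof cases
        case b1: 1
        then show ?thesis using 1 old'[OF 1 b1] by (simp add: v_def)
      next
        case b2: 2
        have "a \<noteq> flip b" using 1 b2 fl(1) by simp
        then show ?thesis using 1 b2 orth[OF 1] by (simp add: v_def)
      next
        case b3: 3
        have "a \<noteq> flip b" using 1 b3 fl(2) by simp
        then show ?thesis using 1 b3 oq2[OF 1] by (simp add: v_def)
      qed
    next
      case 2
      consider "b < 2*j" | "b = 2*j" | "b = 2*j+1" using \<open>b < 2 * Suc j\<close> by fastforce
      then show ?thesis using 2 s pxq2 skew0[OF p] fl fne by cases (auto simp: v_def)
    next
      case 3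
      consider "b < 2*j" | "b = 2*j" | "b = 2*j+1" using \<open>b < 2 * Suc j\<close> by fastforce
      then show ?thesis using 3 s t skew0[OF q2] fl fne by cases (auto simp: v_def)
    qed
  qed
  have "frame l x (Suc j) v"
    unfolding frame_def hyperbolic_def
  proof (intro conjI allI impI)
    fix a b assume a: "a < 2 * Suc j" and b: "b < 2 * Suc j"
    have fb: "flip a < 2 * Suc j" "flip b < 2 * Suc j" using a b by (auto simp: flip_less simp del: mult_Suc_right)
    show "sympl l (x *\<^sub>v v (flip a)) (x *\<^sub>v v (flip b)) = 0"
      using X[OF vC[OF fb(1)] vC[OF fb(2)]] X[OF vC[OF fb(1)] X(3)[OF vC[OF fb(2)] vC[OF fb(2)]]] vC[OF fb(1)]
      by (simp add: sympl_zero)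
    show "sympl l (v a) (x *\<^sub>v v (flip b)) = (if a = b then (-1)^a else 0)"
      using vx[OF a fb(2)] by simp
  next
    fix a assume a: "a < 2 * Suc j"
    then have fa: "flip a < 2 * Suc j" by (simp only: flip_less)
    show "v a \<in> ?C" using vC[OF a] .
    show "x *\<^sub>v v (flip a) \<in> ?C" using X(3)[OF vC[OF fa] vC[OF fa]] .
  qed (rule vu)
  then show ?thesis by blast
qed

lemma std_nilpotent_index:
  "q < 2*l \<Longrightarrow> p < 2*l \<Longrightarrow> std_nilpotent l j $$ (q,p) = (if p < 2*j \<and> q + flip p + 1 = 2*l then 1 else 0)"
  by (simp add: std_nilpotent_def)

lemma std_nilpotent_unit:
  fixes l j p :: nat
  assumes j: "2*j \<le> l" and p: "p < 2*l"
  shows "std_nilpotent l j *\<^sub>v unit_vec (2*l) p =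
    (if p < 2*j then unit_vec (2*l) (2*l - 1 - flip p) else (0\<^sub>v (2*l) :: 'a::semiring_1 vec))"
proof -
  have "q + flip p + 1 = 2*l \<longleftrightarrow> q = 2*l - 1 - flip p" if "p < 2*j" for q
    using that j flip_less[of p j] by auto
  then show ?thesis using p
    by (subst mult_unit_vec[of _ "2*l" "2*l"]) (auto intro!: eq_vecI simp: std_nilpotent_index unit_vec_def)
qed

text \<open>Splitting off hyperbolic \<open>x\<close>-stable subspaces as long as possible leaves a complement on
  which \<open>x\<close> vanishes.\<close>

lemma self_adjoint_sq0_conj_std:
  assumes x: "self_adjoint_sq0 l x"
  shows "\<exists>j k. 2*j \<le> l \<and> k \<in> K l \<and> x = k * std_nilpotent l j * minv k"
proof -
  let ?C = "carrier_vec (2*l) :: complex vec set"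
  note X = self_adjoint_sq0_apply[OF x]
  have xc: "x \<in> carrier_mat (2*l) (2*l)" using x by (simp add: self_adjoint_sq0_def)
  have "\<exists>u. frame l x 0 u" by (auto simp: frame_def hyperbolic_def)
  moreover have bound: "2 * j \<le> l" if "\<exists>u. frame l x j u" for j
    using that hyperbolic_bound unfolding frame_def by blast
  moreover from this have "\<forall>j. (\<exists>u. frame l x j u) \<longrightarrow> j \<le> l" by force
  \<comment> \<open>A frame of length \<open>j\<close> contains \<open>2*j\<close> hyperbolic pairs,
    so lengths are bounded and a longest frame exists.\<close>
  ultimately obtain j where "\<exists>u. frame l x j u" and max: "\<And>i. (\<exists>u. frame l x i u) \<Longrightarrow> i \<le> j"
    using GreatestI_nat[of "\<lambda>j. \<exists>u. frame l x j u" 0 l] Greatest_le_nat[of "\<lambda>j. \<exists>u. frame l x j u" _ l] by blast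
  then obtain u where u: "frame l x j u" by blast
  have jl: "2*j \<le> l" using bound u by blast
  obtain k where k: "k \<in> K l" 
    and ku: "\<And>a. a < 2*j \<Longrightarrow> k *\<^sub>v unit_vec (2*l) a = u a"
    and kw: "\<And>a. a < 2*j \<Longrightarrow> k *\<^sub>v unit_vec (2*l) (2*l - 1 - a) = x *\<^sub>v u (flip a)"
    using witt_extension[OF jl u[unfolded frame_def]] by blast
  define c where "c = (\<lambda>i. k *\<^sub>v unit_vec (2*l) i)"
  have cC: "c i \<in> ?C" for i using K_apply_carrier[OF k] by (simp add: c_def)
  have cc: "sympl l (c i) (c i') = J l $$ (i,i')" if "i < 2*l" "i' < 2*l" for i i'
    using that by (simp add: c_def K_symp[OF k] sympl_unit)
  have uC: "u a \<in> ?C" if "a < 2*j" for a using that u by (auto simp: frame_def hyperbolic_def)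
  have uc: "u a = c a" "x *\<^sub>v u a = c (2*l - 1 - flip a)" if "a < 2*j" for a
    using that ku kw[of "flip a"] by (auto simp: c_def flip_less)
  have skew: "sympl l (x *\<^sub>v a) b = sympl l a (x *\<^sub>v b)" if "a \<in> ?C" "b \<in> ?C" for a b
    using that X(1) by blast
  \<comment> \<open>The vector \<open>x c_i\<close> is orthogonal to the whole basis
    \<open>c\<close>. Against the frame vectors this is self-adjointness and orthogonality of
    \<open>c_i\<close> to their images; against another middle vector, a nonzero pairing would
    extend the longest frame; the last \<open>2*j\<close> basis vectors lie in the image of
    \<open>x\<close>, and moving \<open>x\<close> across gives \<open>x (x c_i) = 0\<close>.\<close>
  have mid: "x *\<^sub>v c i = 0\<^sub>v (2*l)" if i: "2*j \<le> i" "i < 2*l - 2*j" for i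
  proof -
    have o1: "sympl l (u a) (c i) = 0" if "a < 2*j" for a 
      using that i jl by (simp add: uc cc index_J)
    have o2: "sympl l (u a) (x *\<^sub>v c i) = 0" if "a < 2*j" for a
    proof -
      have "flip a < 2*j" using that by (simp add: flip_less)
      then have "sympl l (c (2*l - 1 - flip a)) (c i) = 0" using i jl by (simp add: cc index_J)
      then show ?thesis using skew[OF uC[OF that] cC] uc(2)[OF that] by simp
    qed
    have o3: "sympl l (c i') (x *\<^sub>v c i) = 0" if i': "2*j \<le> i'" "i' < 2*l - 2*j" for i'
    proof (rule ccontr)
      assume ne: "sympl l (c i') (x *\<^sub>v c i) \<noteq> 0"
      have o4: "sympl l (u a) (c i') = 0" if "a < 2*j" for a 
        using that i' jl by (simp add: uc cc index_J)
      have o5: "sympl l (u a) (x *\<^sub>v c i') = 0" if "a < 2*j" for a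
      proof -
        have "flip a < 2*j" using that by (simp add: flip_less)
        then have "sympl l (c (2*l - 1 - flip a)) (c i') = 0" using i' jl by (simp add: cc index_J)
        then show ?thesis using skew[OF uC[OF that] cC] uc(2)[OF that] by simp
      qed
      have "\<exists>u. frame l x (Suc j) u"
        using frame_extend[OF x u cC cC ne] o1 o2 o4 o5 by blast
      then show False using max by fastforce
    qed
    have all: "sympl l (c i') (x *\<^sub>v c i) = 0" if i': "i' < 2*l" for i'
    proof -
      consider "i' < 2*j" | "2*j \<le> i'" "i' < 2*l - 2*j" | "2*l - 2*j \<le> i'" by linarith
      then show ?thesis
      proof cases
        case 3
        then have a: "2*l - 1 - i' < 2*j" "2*l - 1 - (2*l - 1 - i') = i'" using i' by auto
        then have "c i' = x *\<^sub>v u (flip (2*l - 1 - i'))" using kw[OF a(1)] by (simp add: c_def)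
        moreover have fa: "flip (2*l - 1 - i') < 2*j" using a by (simp only: flip_less)
        ultimately show ?thesis
          using skew[OF uC[OF fa], of "x *\<^sub>v c i"] X(2,3)[OF cC cC] sympl_zero[OF uC[OF fa]] by simp
      qed (use o2 o3 uc in auto)
    qed
    let ?w = "minv k *\<^sub>v (x *\<^sub>v c i)"
    have xci: "x *\<^sub>v c i \<in> ?C" using X(3)[OF cC cC] .
    have w: "?w \<in> ?C" using K_apply_carrier[OF K_inverse(1)[OF k] xci] .
    have "?w = 0\<^sub>v (2*l)"
    proof (rule sympl_nondeg[OF w])
      fix i' assume "i' < 2*l"
      then show "sympl l (unit_vec (2*l) i') ?w = 0"
        using K_symp[OF k, of "unit_vec (2*l) i'" ?w] w all[of i'] K_inverse_apply(1)[OF k xci] by (simp add: c_def)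
    qed
    then have "x *\<^sub>v c i = k *\<^sub>v 0\<^sub>v (2*l)" using K_inverse_apply(1)[OF k xci] by simp
    also have "\<dots> = 0\<^sub>v (2*l)" using K_carrier[OF k] by (auto intro!: eq_vecI simp: scalar_prod_def)
    finally show ?thesis .
  qed
  have kc: "k \<in> carrier_mat (2*l) (2*l)" by (rule K_carrier[OF k])
  have k0: "k *\<^sub>v 0\<^sub>v (2*l) = 0\<^sub>v (2*l)" using kc by (auto intro!: eq_vecI simp: scalar_prod_def)
  \<comment> \<open>The first \<open>2*j\<close> basis vectors form the frame, the middle ones are
    killed by \<open>mid\<close>, and the last \<open>2*j\<close> are images under \<open>x\<close>,
    hence killed because \<open>x\<close> has square zero.\<close>
  have "x * k = k * std_nilpotent l j"
  proof (rule eq_mat_on_vecI[of _ "2*l" "2*l"])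
    fix p assume p: "p < 2*l"
    have "x *\<^sub>v c p = k *\<^sub>v (std_nilpotent l j *\<^sub>v unit_vec (2*l) p)"
    proof -
      consider "p < 2*j" | "2*j \<le> p" "p < 2*l - 2*j" | "2*l - 2*j \<le> p" by linarith
      then show ?thesis
      proof cases
        case 1
        have "x *\<^sub>v c p = c (2*l - 1 - flip p)" using uc[OF 1] by simp
        then show ?thesis using 1 unfolding std_nilpotent_unit[OF jl p] by (simp only: c_def if_True)
      next
        case 2
        have "\<not> p < 2*j" using 2(1) by simp
        then show ?thesis unfolding std_nilpotent_unit[OF jl p] mid[OF 2] by (simp only: k0 if_False)
      next
        case 3
        have a: "2*l - 1 - p < 2*j" "2*l - 1 - (2*l - 1 - p) = p" "\<not> p < 2*j" using 3 p jl by auto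
        have fa: "flip (2*l - 1 - p) < 2*j" unfolding flip_less by (rule a(1))
        have "c p = x *\<^sub>v u (flip (2*l - 1 - p))" using kw[OF a(1)] unfolding a(2) c_def .
        then have "x *\<^sub>v c p = 0\<^sub>v (2*l)" using X(2)[OF uC[OF fa] uC[OF fa]] by (simp only:)
        then show ?thesis unfolding std_nilpotent_unit[OF jl p] using a(3) by (simp only: k0 if_False)
      qed
    qed
    then show "x * k *\<^sub>v unit_vec (2*l) p = k * std_nilpotent l j *\<^sub>v unit_vec (2*l) p"
      using xc kc by (simp add: c_def assoc_mult_mat_vec[of _ "2*l" "2*l" _ "2*l"])
  qed (use xc kc in \<open>auto intro!: mult_carrier_mat\<close>)
  then have "x * k * minv k = k * std_nilpotent l j * minv k" by simp
  moreover have "x * k * minv k = x"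
    using xc kc K_inverse(2)[OF k] K_carrier[OF K_inverse(1)[OF k]]
    by (simp add: assoc_mult_mat[of _ "2*l" "2*l" _ "2*l" _ "2*l"])
  ultimately show ?thesis using jl k by metis
qed

section \<open>The normal form and the cone of square-zero elements\<close>

lemma mat_trace_comm:
  fixes A B :: "'a::comm_semiring_0 mat"
  assumes "A \<in> carrier_mat n n" "B \<in> carrier_mat n n"
  shows "(\<Sum>i<n. (A * B) $$ (i,i)) = (\<Sum>i<n. (B * A) $$ (i,i))"
proof -
  have "(\<Sum>i<n. (A * B) $$ (i,i)) = (\<Sum>i<n. \<Sum>k<n. A $$ (i,k) * B $$ (k,i))"
    using assms by (intro sum.cong) (auto simp: scalar_prod_def atLeast0LessThan)
  also have "\<dots> = (\<Sum>k<n. \<Sum>i<n. B $$ (k,i) * A $$ (i,k))"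
    by (subst sum.swap) (simp add: mult.commute)
  also have "\<dots> = (\<Sum>k<n. (B * A) $$ (k,k))"
    using assms by (intro sum.cong) (auto simp: scalar_prod_def atLeast0LessThan)
  finally show ?thesis .
qed

text \<open>The image is spanned by the last \<open>2*j\<close> unit vectors, and only the first
  \<open>2*j\<close> are not killed; for \<open>2*j \<le> l\<close> these two ranges of indices are
  disjoint.\<close>

lemma std_nilpotent_sq: 
  assumes "2*j \<le> l" 
  shows "std_nilpotent l j * std_nilpotent l j = (0\<^sub>m (2*l) (2*l) :: 'a::comm_semiring_1 mat)"
proof (rule eq_mat_on_vecI[of _ "2*l" "2*l"])
  fix p assume p: "p < 2*l"
  let ?S = "std_nilpotent l j :: 'a mat"
  have "?S *\<^sub>v 0\<^sub>v (2*l) = 0\<^sub>v (2*l)" by (auto intro!: eq_vecI simp: scalar_prod_def)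
  moreover have "?S *\<^sub>v unit_vec (2*l) (2*l - 1 - flip p) = 0\<^sub>v (2*l)" if "p < 2*j"
  proof -
    have "flip p < 2*j" using that by (simp add: flip_less)
    then show ?thesis using assms by (subst std_nilpotent_unit) auto
  qed
  ultimately have "?S *\<^sub>v (?S *\<^sub>v unit_vec (2*l) p) = 0\<^sub>v (2*l)"
    by (simp add: std_nilpotent_unit[OF assms p])
  then show "?S * ?S *\<^sub>v unit_vec (2*l) p = 0\<^sub>m (2*l) (2*l) *\<^sub>v unit_vec (2*l) p"
    using p by (simp add: assoc_mult_mat_vec[of _ "2*l" "2*l" _ "2*l"]) (auto intro!: eq_vecI)
qed auto

text \<open>The nonzero entries of both sides sit in the same places because \<open>flip\<close> is
  an involution. The signs agree because both \<open>flip\<close> and the reversal of indices change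
  parity.\<close>

lemma std_nilpotent_self_adjoint:
  assumes j: "2*j \<le> l" 
  shows "std_nilpotent l j * J l = J l * transpose_mat (std_nilpotent l j :: 'a::field mat)"
proof (rule eq_matI)
  let ?S = "std_nilpotent l j :: 'a mat"
  fix q i assume "q < dim_row (J l * transpose_mat ?S)" "i < dim_col (J l * transpose_mat ?S)"
  then have qi: "q < 2*l" "i < 2*l" by auto
  define q' i' where "q' = 2*l - 1 - q" and "i' = 2*l - 1 - i"
  have q'i': "q' < 2*l" "i' < 2*l" "q = 2*l - 1 - q'" "i = 2*l - 1 - i'" using qi by (auto simp: q'_def i'_def)
  have "(?S * J l) $$ (q,i) = (\<Sum>k<2*l. ?S $$ (q,k) * J l $$ (k,i))"
    using qi by (simp add: scalar_prod_def atLeast0LessThan)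
  also have "\<dots> = (\<Sum>k<2*l. if i + k = 2*l - 1 then ?S $$ (q,k) * (-1)^k else 0)"
    using qi by (intro sum.cong) (auto simp: index_J add.commute)
  also have "\<dots> = ?S $$ (q,i') * (-1)^i'" using qi by (simp only: sum_flip i'_def)
  finally have 1: "(?S * J l) $$ (q,i) = ?S $$ (q,i') * (-1)^i'" .
  have "(J l * transpose_mat ?S) $$ (q,i) = (\<Sum>k<2*l. J l $$ (q,k) * ?S $$ (i,k))"
    using qi by (simp add: scalar_prod_def atLeast0LessThan)
  also have "\<dots> = (\<Sum>k<2*l. if q + k = 2*l - 1 then (-1)^q * ?S $$ (i,k) else 0)"
    using qi by (intro sum.cong) (auto simp: index_J)
  also have "\<dots> = (-1)^q * ?S $$ (i,q')" using qi by (simp only: sum_flip q'_def)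
  finally have 2: "(J l * transpose_mat ?S) $$ (q,i) = (-1)^q * ?S $$ (i,q')" .
  have c: "(i' < 2*j \<and> q + flip i' + 1 = 2*l) \<longleftrightarrow> (q' < 2*j \<and> i' = flip q')"
  proof -
    have "q + flip i' + 1 = 2*l \<longleftrightarrow> flip i' = q'" using q'i' by linarith
    then show ?thesis using flip_less[of i' j] flip_less[of q' j] by (auto simp: flip_eq_iff)
  qed
  have c': "(q' < 2*j \<and> i + flip q' + 1 = 2*l) \<longleftrightarrow> (q' < 2*j \<and> i' = flip q')"
    using q'i' j flip_less[of q' j] by auto
  have "(-1::'a)^i' = (-1)^q" if "i' = flip q'"
  proof -
    have "even q' \<longleftrightarrow> odd q" unfolding q'_def using qi(1) by presburger
    then have "even i' \<longleftrightarrow> even q" using that by simp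
    then show ?thesis by (simp add: minus_one_power_iff)
  qed
  then have "?S $$ (q,i') * (-1)^i' = (-1)^q * ?S $$ (i,q')"
    using qi q'i'(1,2) c c' by (auto simp: std_nilpotent_index)
  then show "(?S * J l) $$ (q,i) = (J l * transpose_mat ?S) $$ (q,i)" by (simp only: 1 2)
qed auto

lemma self_adjoint_sq0_std: "2*j \<le> l \<Longrightarrow> self_adjoint_sq0 l (std_nilpotent l j)"
  by (auto simp: self_adjoint_sq0_def std_nilpotent_sq std_nilpotent_self_adjoint)

lemma K_J: 
  assumes k: "k \<in> K l" 
  shows "minv k * J l = J l * transpose_mat k" "k * J l = J l * transpose_mat (minv k)"
proof -
  have *: "minv k * J l = J l * transpose_mat k" if k: "k \<in> K l" for k
  proof -
    note c = K_carrier[OF k] K_carrier[OF K_inverse(1)[OF k]]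
    have "minv k * (k * J l * transpose_mat k) = (minv k * k) * (J l * transpose_mat k)"
      using c by (simp add: assoc_mult_mat[of _ "2*l" "2*l" _ "2*l" _ "2*l"] mult_carrier_mat[of _ "2*l" "2*l" _ "2*l"])
    moreover have "k * J l * transpose_mat k = J l" using k by (simp add: K_iff)
    ultimately show ?thesis 
      unfolding K_inverse(3)[OF k] using c by (simp add: left_mult_one_mat[of _ "2*l" "2*l"] mult_carrier_mat[of _ "2*l" "2*l" _ "2*l"])
  qed
  show "minv k * J l = J l * transpose_mat k" by (rule *[OF k])
  have "minv (minv k) = k"
    using K_inverse[OF k] K_carrier k by (intro minv_eqI[of _ "2*l"]) auto
  then show "k * J l = J l * transpose_mat (minv k)" using *[OF K_inverse(1)[OF k]] by simp
qed

lemma self_adjoint_sq0_conj: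
  assumes x: "self_adjoint_sq0 l x" and k: "k \<in> K l"
  shows "self_adjoint_sq0 l (k * x * minv k)"
proof -
  let ?n = "2*l"
  have c: "k \<in> carrier_mat ?n ?n" "minv k \<in> carrier_mat ?n ?n" "x \<in> carrier_mat ?n ?n"
    using x K_carrier[OF k] K_carrier[OF K_inverse(1)[OF k]] by (auto simp: self_adjoint_sq0_def)
  note assoc = assoc_mult_mat[of _ ?n ?n _ ?n _ ?n] mult_carrier_mat[of _ ?n ?n _ ?n]
  have "k * x * minv k * J l = k * (x * J l) * transpose_mat k"
    using c K_J(1)[OF k] by (simp add: assoc)
  also have "\<dots> = (k * J l) * transpose_mat x * transpose_mat k"
    using c x by (simp add: assoc self_adjoint_sq0_def)
  also have "\<dots> = J l * transpose_mat (k * x * minv k)"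
    using c by (simp add: assoc K_J(2)[OF k] transpose_mult[of _ ?n ?n _ ?n])
  finally have 1: "k * x * minv k * J l = J l * transpose_mat (k * x * minv k)" .
  have "(k * x * minv k) * (k * x * minv k) = k * x * (minv k * k) * x * minv k"
    using c by (simp add: assoc)
  also have "\<dots> = k * (x * x) * minv k"
    unfolding K_inverse(3)[OF k] using c by (simp add: assoc left_mult_one_mat[of _ ?n ?n])
  also have "\<dots> = 0\<^sub>m ?n ?n" using x c by (simp add: self_adjoint_sq0_def)
  finally show ?thesis using 1 c by (auto simp: self_adjoint_sq0_def intro!: mult_carrier_mat)
qed

text \<open>Trace 0 is the part of \<open>N\<pp>2\<close> that has to be earned: \<open>x\<close> is
  conjugate to a \<open>std_nilpotent\<close>, whose diagonal vanishes.\<close>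

lemma N\<pp>2_iff: "x \<in> N\<pp>2 l \<longleftrightarrow> self_adjoint_sq0 l x"
proof -
  let ?n = "2*l"
  note assoc = assoc_mult_mat[of _ ?n ?n _ ?n _ ?n] mult_carrier_mat[of _ ?n ?n _ ?n]
  have sa: "x = J l * transpose_mat x * minv (J l) \<longleftrightarrow> x * J l = J l * transpose_mat x" 
    if x: "x \<in> carrier_mat ?n ?n" for x :: "complex mat"
  proof
    assume "x = J l * transpose_mat x * minv (J l)"
    then have "x * J l = J l * transpose_mat x * minv (J l) * J l" by simp
    also have "\<dots> = J l * transpose_mat x * ((- J l) * J l)" using x by (simp add: assoc minv_J)
    finally show "x * J l = J l * transpose_mat x" 
      unfolding J_mult_uminus using x by (simp add: right_mult_one_mat[of _ ?n ?n] assoc(2))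
  next
    assume "x * J l = J l * transpose_mat x"
    then have "J l * transpose_mat x * minv (J l) = x * J l * (- J l)" unfolding minv_J by (simp only:)
    also have "\<dots> = x * (J l * (- J l))" by (rule assoc_mult_mat[OF x J_carrier]) auto
    finally show "x = J l * transpose_mat x * minv (J l)" unfolding J_mult_uminus using x by simp
  qed
  have sq: "x ^\<^sub>m 2 = x * x" if "x \<in> carrier_mat ?n ?n" for x :: "complex mat"
    using that by (simp add: numeral_2_eq_2)
  have "(\<Sum>i<?n. x $$ (i,i)) = 0" if x: "self_adjoint_sq0 l x"
  proof -
    obtain j k where j: "2*j \<le> l" and k: "k \<in> K l" and eq: "x = k * std_nilpotent l j * minv k" 
      using self_adjoint_sq0_conj_std[OF x] by blast
    have c: "k \<in> carrier_mat ?n ?n" "minv k \<in> carrier_mat ?n ?n"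
      using K_carrier[OF k] K_carrier[OF K_inverse(1)[OF k]] by auto
    let ?S = "std_nilpotent l j :: complex mat"
    have Sk: "?S * minv k \<in> carrier_mat ?n ?n" using mult_carrier_mat[OF std_nilpotent_carrier c(2)] .
    have eq': "x = k * (?S * minv k)" unfolding eq by (rule assoc_mult_mat[OF c(1) std_nilpotent_carrier c(2)])
    have "(\<Sum>i<?n. x $$ (i,i)) = (\<Sum>i<?n. (?S * minv k * k) $$ (i,i))"
      unfolding eq' by (rule mat_trace_comm[OF c(1) Sk])
    also have "?S * minv k * k = ?S * (minv k * k)"
      by (rule assoc_mult_mat[OF std_nilpotent_carrier c(2) c(1)])
    also have "\<dots> = ?S" unfolding K_inverse(3)[OF k] by (rule right_mult_one_mat[OF std_nilpotent_carrier])
    also have "(\<Sum>i<?n. (std_nilpotent l j :: complex mat) $$ (i,i)) = 0"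
    proof (intro sum.neutral ballI)
      fix i assume "i \<in> {..<?n}"
      moreover have "\<not> (i < 2*j \<and> i + flip i + 1 = 2*l)" using j unfolding flip_def by presburger
      ultimately show "(std_nilpotent l j :: complex mat) $$ (i,i) = 0" by (auto simp: std_nilpotent_index)
    qed
    finally show ?thesis .
  qed
  moreover have "x \<in> \<pp> l \<longleftrightarrow> x \<in> carrier_mat ?n ?n \<and> (\<Sum>i<?n. x $$ (i,i)) = 0 \<and> x * J l = J l * transpose_mat x"
    using sa[of x] unfolding \<pp>_def mem_Collect_eq by blast
  moreover have "x \<in> N\<pp>2 l \<longleftrightarrow> x \<in> \<pp> l \<and> x ^\<^sub>m 2 = 0\<^sub>m ?n ?n"
    unfolding N\<pp>2_def N\<pp>_def mem_Collect_eq by blast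
  ultimately show ?thesis
    using sq[of x] unfolding self_adjoint_sq0_def by fastforce
qed

section \<open>Rank bounds and the orbits of the normal forms\<close>

text \<open>The rank bounds are phrased so that \<open>rank_ge\<close> is visibly a Zariski open condition: it is the
  nonvanishing of some \<open>det (x + C)\<close>.\<close>

definition rank_le :: "nat \<Rightarrow> nat \<Rightarrow> 'a::field mat \<Rightarrow> bool" where
  "rank_le n r x \<longleftrightarrow> (\<exists>f g. \<forall>i<n. \<forall>j<n. x $$ (i,j) = (\<Sum>a<r. f i a * g a j))"

definition rank_ge :: "nat \<Rightarrow> nat \<Rightarrow> 'a::field mat \<Rightarrow> bool" where
  "rank_ge n r x \<longleftrightarrow> (\<exists>C\<in>carrier_mat n n. rank_le n (n - r) C \<and> det (x + C) \<noteq> 0)"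

lemma rank_leI: "(\<And>i j. i < n \<Longrightarrow> j < n \<Longrightarrow> x $$ (i,j) = (\<Sum>a<r. f i a * g a j)) \<Longrightarrow> rank_le n r x"
  unfolding rank_le_def by blast

lemma rank_le_mono: 
  assumes "rank_le n r x" "r \<le> s" shows "rank_le n s x"
proof -
  obtain f g where fg: "\<And>i j. i < n \<Longrightarrow> j < n \<Longrightarrow> x $$ (i,j) = (\<Sum>a<r. f i a * g a j)"
    using assms(1) unfolding rank_le_def by blast
  show ?thesis
  proof (rule rank_leI[where f = "\<lambda>i a. if a < r then f i a else 0" and g = g])
    fix i j assume "i < n" "j < n"
    then have "x $$ (i,j) = (\<Sum>a<r. f i a * g a j)" by (rule fg)
    also have "\<dots> = (\<Sum>a<s. (if a < r then f i a else 0) * g a j)"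
      using assms(2) by (intro sum.mono_neutral_cong_left) auto
    finally show "x $$ (i,j) = \<dots>" .
  qed
qed

lemma rank_le_add:
  assumes "rank_le n r x" "rank_le n s y" "x \<in> carrier_mat n n" "y \<in> carrier_mat n n" 
  shows "rank_le n (r + s) (x + y)"
proof -
  obtain f g where fg: "\<And>i j. i < n \<Longrightarrow> j < n \<Longrightarrow> x $$ (i,j) = (\<Sum>a<r. f i a * g a j)"
    using assms(1) unfolding rank_le_def by blast
  obtain f' g' where fg': "\<And>i j. i < n \<Longrightarrow> j < n \<Longrightarrow> y $$ (i,j) = (\<Sum>a<s. f' i a * g' a j)"
    using assms(2) unfolding rank_le_def by blast
  show ?thesis
  proof (rule rank_leI[where f = "\<lambda>i a. if a < r then f i a else f' i (a - r)" 
        and g = "\<lambda>a. if a < r then g a else g' (a - r)"])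
    fix i j assume ij: "i < n" "j < n"
    let ?h = "\<lambda>a. (if a < r then f i a else f' i (a - r)) * (if a < r then g a else g' (a - r)) j"
    have "(\<Sum>a<r+s. ?h a) = (\<Sum>a<r. ?h a) + (\<Sum>a=r..<r+s. ?h a)"
      by (simp add: sum.atLeastLessThan_concat[of 0 r "r+s", symmetric] flip: atLeast0LessThan)
    also have "(\<Sum>a=r..<r+s. ?h a) = (\<Sum>a<s. f' i a * g' a j)"
      using sum.shift_bounds_nat_ivl[of ?h 0 r s] by (simp add: add.commute atLeast0LessThan)
    finally show "(x + y) $$ (i,j) = (\<Sum>a<r+s. ?h a)" 
      using ij assms fg[OF ij] fg'[OF ij] by simp
  qed
qed

lemma rank_le_mult:
  assumes P: "P \<in> carrier_mat n n" and x: "x \<in> carrier_mat n n" and Q: "Q \<in> carrier_mat n n" 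
    and r: "rank_le n r x"
  shows "rank_le n r (P * x * Q)"
proof -
  obtain f g where fg: "\<And>i j. i < n \<Longrightarrow> j < n \<Longrightarrow> x $$ (i,j) = (\<Sum>a<r. f i a * g a j)"
    using r unfolding rank_le_def by blast
  show ?thesis
  proof (rule rank_leI[where f = "\<lambda>i a. \<Sum>k<n. P $$ (i,k) * f k a" and g = "\<lambda>a j. \<Sum>m<n. g a m * Q $$ (m,j)"])
    fix i j assume ij: "i < n" "j < n"
    have "(P * x * Q) $$ (i,j) = (\<Sum>m<n. (\<Sum>k<n. P $$ (i,k) * x $$ (k,m)) * Q $$ (m,j))"
    proof -
      have "(P * x * Q) $$ (i,j) = (\<Sum>m<n. (P * x) $$ (i,m) * Q $$ (m,j))"
        using assms ij by (simp add: scalar_prod_def atLeast0LessThan del: assoc_mult_mat)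
      also have "\<dots> = (\<Sum>m<n. (\<Sum>k<n. P $$ (i,k) * x $$ (k,m)) * Q $$ (m,j))"
        using assms ij by (intro sum.cong) (auto simp: scalar_prod_def atLeast0LessThan)
      finally show ?thesis .
    qed
    also have "\<dots> = (\<Sum>m<n. \<Sum>k<n. \<Sum>a<r. (P $$ (i,k) * f k a) * (g a m * Q $$ (m,j)))"
      by (intro sum.cong refl) (auto simp: fg sum_distrib_left sum_distrib_right mult.assoc intro!: sum.cong)
    also have "\<dots> = (\<Sum>m<n. \<Sum>a<r. (\<Sum>k<n. P $$ (i,k) * f k a) * (g a m * Q $$ (m,j)))"
      by (subst sum.swap) (simp add: sum_distrib_right)
    also have "\<dots> = (\<Sum>a<r. \<Sum>m<n. (\<Sum>k<n. P $$ (i,k) * f k a) * (g a m * Q $$ (m,j)))"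
      by (rule sum.swap)
    finally show "(P * x * Q) $$ (i,j) = (\<Sum>a<r. (\<Sum>k<n. P $$ (i,k) * f k a) * (\<Sum>m<n. g a m * Q $$ (m,j)))"
      by (simp add: sum_distrib_left)
  qed
qed

text \<open>Padded with zeros to square matrices, the factorization has a left factor whose column
  \<open>r\<close> vanishes.\<close>

lemma rank_le_det_0:
  assumes x: "x \<in> carrier_mat n n" and r: "rank_le n r x" "r < n"
  shows "det x = 0"
proof -
  obtain f g where fg: "\<And>i j. i < n \<Longrightarrow> j < n \<Longrightarrow> x $$ (i,j) = (\<Sum>a<r. f i a * g a j)"
    using r unfolding rank_le_def by blast
  define F where "F = mat n n (\<lambda>(i,a). if a < r then f i a else 0)"
  define G where "G = mat n n (\<lambda>(a,j). g a j)"
  have c: "F \<in> carrier_mat n n" "G \<in> carrier_mat n n" by (auto simp: F_def G_def)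
  have "x = F * G"
  proof (rule eq_matI)
    fix i j assume "i < dim_row (F * G)" "j < dim_col (F * G)"
    then have ij: "i < n" "j < n" by (auto simp: F_def G_def)
    have "(F * G) $$ (i,j) = (\<Sum>a<n. (if a < r then f i a else 0) * g a j)"
      using ij by (simp add: F_def G_def scalar_prod_def atLeast0LessThan)
    also have "\<dots> = (\<Sum>a<r. f i a * g a j)"
      using r by (intro sum.mono_neutral_cong_right) auto
    finally show "x $$ (i,j) = (F * G) $$ (i,j)" using fg[OF ij] by simp
  qed (use x c in auto)
  moreover have "det F = 0"
  proof -
    have "F *\<^sub>v unit_vec n r = 0\<^sub>v n"
      using r(2) c by (subst mult_unit_vec[OF c(1)]) (auto intro!: eq_vecI simp: F_def)
    then show ?thesis
      using r(2) c det_0_iff_vec_prod_zero_field[OF c(1)] unit_vec_nonzero[OF r(2)] unit_vec_carrier[of n r] by blast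
  qed
  ultimately show ?thesis using det_mult[OF c] by simp
qed

text \<open>If \<open>r < s\<close>, then \<open>x + C\<close> has rank at most
  \<open>r + (n - s) < n\<close> for every admissible complement \<open>C\<close>, so its
  determinant vanishes.\<close>

lemma rank_ge_le_trans:
  assumes "x \<in> carrier_mat n n" "rank_le n r x" "rank_ge n s x" "s \<le> n"
  shows "s \<le> r"
proof (rule ccontr)
  assume "\<not> s \<le> r"
  then have "r + (n - s) < n" using assms(4) by auto
  moreover obtain C where "C \<in> carrier_mat n n" "rank_le n (n - s) C" "det (x + C) \<noteq> 0"
    using assms(3) by (auto simp: rank_ge_def)
  ultimately show False
    using rank_le_det_0[OF _ rank_le_add[OF assms(2) _ assms(1), of "n - s" C]] assms(1) by auto
qed

lemma rank_ge_mult: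
  assumes P: "P \<in> carrier_mat n n" and x: "x \<in> carrier_mat n n" and Q: "Q \<in> carrier_mat n n" 
    and d: "det P \<noteq> 0" "det Q \<noteq> 0" and r: "rank_ge n r x"
  shows "rank_ge n r (P * x * Q)"
proof -
  obtain C where C: "C \<in> carrier_mat n n" "rank_le n (n - r) C" "det (x + C) \<noteq> 0"
    using r by (auto simp: rank_ge_def)
  have "P * x * Q + P * C * Q = P * (x + C) * Q"
    using P x Q C by (simp add: add_mult_distrib_mat[of _ n n] mult_add_distrib_mat[of _ n n] mult_carrier_mat[of _ n n _ n])
  moreover have "det (P * (x + C) * Q) = det P * det (x + C) * det Q"
    using P x Q C by (simp add: det_mult[of _ n] mult_carrier_mat[of _ n n _ n])
  ultimately have "det (P * x * Q + P * C * Q) \<noteq> 0" using d C by simp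
  then show ?thesis
    using rank_le_mult[OF P C(1) Q C(2)] P C Q unfolding rank_ge_def by (auto intro!: mult_carrier_mat)
qed

definition index_map_mat :: "nat \<Rightarrow> (nat \<Rightarrow> nat) \<Rightarrow> 'a::field mat" where
  "index_map_mat n p = mat n n (\<lambda>(i,j). if i = p j then 1 else 0)"

lemma index_map_mat_carrier [simp, intro]: "index_map_mat n p \<in> carrier_mat n n"
  by (simp add: index_map_mat_def)

lemma index_map_mat_unit:
  "p j < n \<Longrightarrow> j < n \<Longrightarrow> index_map_mat n p *\<^sub>v unit_vec n j = (unit_vec n (p j) :: 'a::field vec)"
  by (subst mult_unit_vec[of _ n n]) (auto intro!: eq_vecI simp: index_map_mat_def)

lemma index_map_mat_inverse:
  assumes p: "p ` {..<n} \<subseteq> {..<n}" and inj: "inj_on p {..<n}"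
  shows "transpose_mat (index_map_mat n p) * index_map_mat n p = (1\<^sub>m n :: 'a::field mat)"
proof (rule eq_matI)
  fix i j assume "i < dim_row (1\<^sub>m n :: 'a mat)" "j < dim_col (1\<^sub>m n :: 'a mat)"
  then have ij: "i < n" "j < n" by auto
  have "(transpose_mat (index_map_mat n p) * index_map_mat n p :: 'a mat) $$ (i,j)
      = (\<Sum>k<n. (if k = p i then 1 else 0) * (if k = p j then 1 else 0))"
    using ij by (simp add: index_map_mat_def scalar_prod_def atLeast0LessThan)
  also have "\<dots> = (\<Sum>k<n. if k = p i then (if p i = p j then 1 else 0) else 0)"
    by (intro sum.cong) auto
  also have "\<dots> = (if p i = p j then 1 else 0)" using ij p by auto
  also have "\<dots> = (1\<^sub>m n :: 'a mat) $$ (i,j)" using ij inj by (auto simp: inj_on_def)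
  finally show "(transpose_mat (index_map_mat n p) * index_map_mat n p :: 'a mat) $$ (i,j) = (1\<^sub>m n) $$ (i,j)" .
qed (auto simp: index_map_mat_def)

lemma det_nonzero_if_left_inverse:
  fixes A :: "'a::field mat"
  assumes "A \<in> carrier_mat n n" "B \<in> carrier_mat n n" "B * A = 1\<^sub>m n"
  shows "det A \<noteq> 0"
  using det_mult[OF assms(2,1)] assms(3) by auto

lemma std_nilpotent_rank:
  assumes j: "2*j \<le> l"
  shows "rank_le (2*l) (2*j) (std_nilpotent l j :: 'a::field mat)" 
    and "rank_ge (2*l) (2*j) (std_nilpotent l j :: 'a::field mat)"
proof -
  let ?n = "2*l" let ?S = "std_nilpotent l j :: 'a mat"
  show "rank_le ?n (2*j) ?S"
  proof (rule rank_leI[where f = "\<lambda>q a. if q + flip a + 1 = ?n then 1 else 0" and g = "\<lambda>a p. if a = p then 1 else 0"])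
    fix q p assume "q < ?n" "p < ?n"
    moreover have "(\<Sum>a<2*j. (if q + flip a + 1 = ?n then 1 else 0) * (if a = p then 1 else 0)) =
       (\<Sum>a<2*j. if a = p then (if q + flip p + 1 = ?n then 1 else 0 :: 'a) else 0)"
      by (intro sum.cong) auto
    ultimately show "?S $$ (q,p) = (\<Sum>a<2*j. (if q + flip a + 1 = ?n then 1 else 0) * (if a = p then 1 else 0))"
      by (simp add: std_nilpotent_index)
  qed
  \<comment> \<open>\<open>C\<close> sends the unit vector with index \<open>c \<ge> 2*j\<close> to
    the one with index \<open>c - 2*j\<close>. It fills exactly the rows and columns in which the
    normal form is zero, so the sum is a permutation matrix.\<close>
  define C :: "'a mat" where "C = mat ?n ?n (\<lambda>(q,p). if p = q + 2*j then 1 else 0)"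
  have Cc: "C \<in> carrier_mat ?n ?n" by (simp add: C_def)
  have rC: "rank_le ?n (?n - 2*j) C"
  proof (rule rank_leI[where f = "\<lambda>q a. if q = a then 1 else 0" and g = "\<lambda>a p. if p = a + 2*j then 1 else 0"])
    fix q p assume "q < ?n" "p < ?n"
    moreover have "(\<Sum>a<?n-2*j. (if q = a then 1 else 0) * (if p = a + 2*j then 1 else 0)) =
       (\<Sum>a<?n-2*j. if a = q then (if p = q + 2*j then 1 else 0 :: 'a) else 0)"
      by (intro sum.cong) auto
    ultimately show "C $$ (q,p) = (\<Sum>a<?n-2*j. (if q = a then 1 else 0) * (if p = a + 2*j then 1 else 0))"
      by (auto simp: C_def)
  qed
  define p where "p = (\<lambda>c. if c < 2*j then ?n - 1 - flip c else c - 2*j)"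
  have fl: "flip c < 2*j" if "c < 2*j" for c using that by (simp add: flip_less)
  have eq: "?S + C = index_map_mat ?n p"
  proof (rule eq_matI)
    fix q c assume "q < dim_row (index_map_mat ?n p :: 'a mat)" "c < dim_col (index_map_mat ?n p :: 'a mat)"
    then have qc: "q < ?n" "c < ?n" by (auto simp: index_map_mat_def)
    show "(?S + C) $$ (q,c) = index_map_mat ?n p $$ (q,c)"
    proof (cases "c < 2*j")
      case True
      have "q + flip c + 1 = ?n \<longleftrightarrow> q = ?n - 1 - flip c" using fl[OF True] j by auto
      then show ?thesis using qc True by (auto simp: std_nilpotent_index C_def index_map_mat_def p_def)
    qed (use qc in \<open>auto simp: std_nilpotent_index C_def index_map_mat_def p_def\<close>)
  qed (auto simp: index_map_mat_def C_def)
  have "p ` {..<?n} \<subseteq> {..<?n}" using j by (auto simp: p_def)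
  moreover have "inj_on p {..<?n}"
  proof (rule inj_onI)
    fix a b assume ab: "a \<in> {..<?n}" "b \<in> {..<?n}" "p a = p b"
    have lo: "p c \<ge> ?n - 2*j \<longleftrightarrow> c < 2*j" if "c < ?n" for c
      using that fl[of c] j by (auto simp: p_def)
    show "a = b"
    proof (cases "a < 2*j")
      case True
      with ab lo[of a] lo[of b] have "b < 2*j" by simp
      with True ab fl[of a] fl[of b] j have "flip a = flip b" by (simp add: p_def)
      then show ?thesis by (metis flip_flip)
    next
      case False
      with ab lo[of a] lo[of b] have "\<not> b < 2*j" by simp
      with False ab show ?thesis by (simp add: p_def)
    qed
  qed
  ultimately have "det (index_map_mat ?n p :: 'a mat) \<noteq> 0"
    by (intro det_nonzero_if_left_inverse[OF _ _ index_map_mat_inverse]) auto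
  then show "rank_ge ?n (2*j) ?S" using Cc rC eq unfolding rank_ge_def by metis
qed

definition std_orbit :: "nat \<Rightarrow> nat \<Rightarrow> complex mat set" where
  "std_orbit l j = {k * std_nilpotent l j * minv k | k. k \<in> K l}"

text \<open>Every self-adjoint \<open>x\<close> of square zero is conjugate under \<open>K\<close>
  to some \<open>std_nilpotent l i\<close>. Both rank bounds survive conjugation, and comparing them
  in both directions forces \<open>i = j\<close>.\<close>

lemma std_orbit_iff:
  assumes j: "2*j \<le> l"
  shows "x \<in> std_orbit l j \<longleftrightarrow> self_adjoint_sq0 l x \<and> rank_le (2*l) (2*j) x \<and> rank_ge (2*l) (2*j) x"
proof -
  have ranks: "rank_le (2*l) (2*i) (k * std_nilpotent l i * minv k)" 
    "rank_ge (2*l) (2*i) (k * std_nilpotent l i * minv k)" if "2*i \<le> l" "k \<in> K l" for i k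
  proof -
    have c: "k \<in> carrier_mat (2*l) (2*l)" "minv k \<in> carrier_mat (2*l) (2*l)" "det k \<noteq> 0" "det (minv k) \<noteq> 0"
      using that(2) K_inverse(1)[OF that(2)] by (auto simp: K_iff)
    show "rank_le (2*l) (2*i) (k * std_nilpotent l i * minv k)" 
      "rank_ge (2*l) (2*i) (k * std_nilpotent l i * minv k)" 
      using rank_le_mult[OF c(1) _ c(2) std_nilpotent_rank(1)[OF that(1)]] 
        rank_ge_mult[OF c(1) _ c(2) c(3,4) std_nilpotent_rank(2)[OF that(1)]] by auto
  qed
  show ?thesis
  proof
    assume "x \<in> std_orbit l j"
    then show "self_adjoint_sq0 l x \<and> rank_le (2*l) (2*j) x \<and> rank_ge (2*l) (2*j) x"
      using ranks[OF j] self_adjoint_sq0_conj self_adjoint_sq0_std[OF j] by (auto simp: std_orbit_def)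
  next
    assume *: "self_adjoint_sq0 l x \<and> rank_le (2*l) (2*j) x \<and> rank_ge (2*l) (2*j) x"
    then obtain i k where i: "2*i \<le> l" and k: "k \<in> K l" and x: "x = k * std_nilpotent l i * minv k"
      using self_adjoint_sq0_conj_std by blast
    have c: "x \<in> carrier_mat (2*l) (2*l)" using * by (simp add: self_adjoint_sq0_def)
    have "2*i \<le> 2*j" using rank_ge_le_trans[OF c, of "2*j" "2*i"] * ranks[OF i k] i by (auto simp: x)
    moreover have "2*j \<le> 2*i" using rank_ge_le_trans[OF c, of "2*i" "2*j"] * ranks[OF i k] j by (auto simp: x)
    ultimately have "i = j" by simp
    then show "x \<in> std_orbit l j" using k x by (auto simp: std_orbit_def)
  qed
qed

lemma self_adjoint_sq0_in_std_orbit: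
  "self_adjoint_sq0 l x \<Longrightarrow> \<exists>j. 2*j \<le> l \<and> x \<in> std_orbit l j"
  using self_adjoint_sq0_conj_std unfolding std_orbit_def by blast

section \<open>Jordan types\<close>

lemma jordan_matrix_two_one:
  assumes "i < 2*a + b" "k < 2*a + b"
  shows "(jordan_matrix (replicate a (2,0) @ replicate b (1,0)) :: 'a::field mat) $$ (i,k) = 
    (if odd k \<and> k < 2*a \<and> i + 1 = k then 1 else 0)"
  using assms
proof (induction a arbitrary: i k)
  case 0
  then show ?case
  proof (induction b arbitrary: i k)
    case (Suc b)
    have "dim_row (jordan_matrix (replicate b (1,0)) :: 'a mat) = b" "dim_col (jordan_matrix (replicate b (1,0)) :: 'a mat) = b" 
      by (simp_all add: sum_list_replicate)
    then show ?case
      using Suc.prems Suc.IH[of "i - 1" "k - 1"] by (auto simp: jordan_matrix_def Let_def jordan_block_def)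
  qed simp
next
  case (Suc a)
  let ?L = "replicate a (2,0) @ replicate b (1,0) :: (nat \<times> 'a) list"
  have d: "dim_row (jordan_matrix ?L) = 2*a+b" "dim_col (jordan_matrix ?L) = 2*a+b" 
    by (simp_all add: sum_list_replicate)
  have "jordan_matrix (replicate (Suc a) (2,0) @ replicate b (1,0)) = four_block_mat (jordan_block 2 (0::'a))
      (0\<^sub>m 2 (2*a+b)) (0\<^sub>m (2*a+b) 2) (jordan_matrix ?L)"
    using d by (simp add: jordan_matrix_def Let_def)
  moreover have "(four_block_mat (jordan_block 2 (0::'a)) (0\<^sub>m 2 (2*a+b)) (0\<^sub>m (2*a+b) 2) (jordan_matrix ?L)) $$ (i,k) =
      (if odd k \<and> k < 2 * Suc a \<and> i + 1 = k then 1 else 0)"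
  proof (cases "2 \<le> i \<and> 2 \<le> k")
    case True
    then obtain i' k' where ik: "i = i' + 2" "k = k' + 2" by (metis le_add_diff_inverse2)
    then have "i' < 2*a + b" "k' < 2*a + b" using Suc.prems by auto
    note IH = Suc.IH[OF this]
    show ?thesis using Suc.prems IH d unfolding ik by simp
  next
    case False
    then have "i = 0 \<or> i = 1 \<or> k = 0 \<or> k = 1" by auto
    moreover have "k < 2 \<longleftrightarrow> k = 0 \<or> k = 1" "i < 2 \<longleftrightarrow> i = 0 \<or> i = 1" by auto
    ultimately show ?thesis using Suc.prems d by (auto simp: jordan_block_def)
  qed
  ultimately show ?case by simp
qed

lemma std_nilpotent_jordan_nf:
  assumes j: "2*j \<le> l"
  shows "jordan_nf (std_nilpotent l j :: complex mat) (replicate (2*j) (2,0) @ replicate (2*l - 4*j) (1,0))"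
proof -
  let ?n = "2*l" let ?S = "std_nilpotent l j :: complex mat"
  define Jm :: "complex mat" where "Jm = jordan_matrix (replicate (2*j) (2,0) @ replicate (2*l - 4*j) (1,0))"
  have n: "2*(2*j) + (2*l - 4*j) = ?n" using j by auto
  have Jc: "Jm \<in> carrier_mat ?n ?n"
    using jordan_matrix_carrier[of "replicate (2*j) (2,0::complex) @ replicate (2*l - 4*j) (1,0)"] n
    unfolding Jm_def by (simp add: sum_list_replicate)
  have Ji: "Jm $$ (i,c) = (if odd c \<and> c < 4*j \<and> i + 1 = c then 1 else 0)" if "i < ?n" "c < ?n" for i c
    using jordan_matrix_two_one[of i "2*j" "2*l-4*j" c, where 'a=complex] that n unfolding Jm_def by simp
  have Ju: "Jm *\<^sub>v unit_vec ?n c = (if odd c \<and> c < 4*j then unit_vec ?n (c - 1) else 0\<^sub>v ?n)" if "c < ?n" for c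
    using that Jc Ji[OF _ that]
    by (subst mult_unit_vec[OF Jc that]) (auto intro!: eq_vecI simp: unit_vec_def elim!: oddE)
  \<comment> \<open>The basis in Jordan order: column \<open>2*a + 1 < 4*j\<close> holds the unit
    vector with index \<open>a\<close>, and column \<open>2*a\<close> before it holds its image,
    with index \<open>2*l - 1 - flip a\<close>. The columns from \<open>4*j\<close> on list the
    middle unit vectors, starting at index \<open>2*j\<close>.\<close>
  define p where "p = (\<lambda>c. if c < 4*j then (if even c then ?n - 1 - flip (c div 2) else c div 2) else c - 2*j)"
  let ?P = "index_map_mat ?n p :: complex mat"
  have fl: "flip (c div 2) < 2*j" if "c < 4*j" for c using that by (subst flip_less) auto
  have pr: "p c < ?n" if "c < ?n" for c using that j by (auto simp: p_def)
  have inj: "inj_on p {..<?n}"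
  proof (rule inj_onI)
    fix a b assume ab: "a \<in> {..<?n}" "b \<in> {..<?n}" "p a = p b"
    have hi: "p c \<ge> ?n - 2*j \<longleftrightarrow> c < 4*j \<and> even c" and lo: "p c < 2*j \<longleftrightarrow> c < 4*j \<and> odd c" if "c < ?n" for c
      using that fl[of c] j by (auto simp: p_def)
    consider "a < 4*j" "even a" | "a < 4*j" "odd a" | "\<not> a < 4*j" by blast
    then show "a = b"
    proof cases
      case 1
      with ab hi[of a] hi[of b] have b: "b < 4*j" "even b" by simp_all
      with 1 ab fl[of a] fl[of b] j have "flip (a div 2) = flip (b div 2)" by (simp add: p_def)
      then have "a div 2 = b div 2" by (metis flip_flip)
      then show ?thesis using 1 b by (metis even_two_times_div_two)
    next
      case 2
      with ab lo[of a] lo[of b] have b: "b < 4*j" "odd b" by simp_all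
      with 2 ab have "a div 2 = b div 2" by (simp add: p_def)
      then show ?thesis using 2 b by (metis odd_two_times_div_two_succ)
    next
      case 3
      with ab hi[of a] hi[of b] lo[of a] lo[of b] have "\<not> b < 4*j" by auto
      with 3 ab show ?thesis by (simp add: p_def)
    qed
  qed
  have inv: "transpose_mat ?P * ?P = 1\<^sub>m ?n" using pr inj by (intro index_map_mat_inverse) auto
  have P0: "?P *\<^sub>v 0\<^sub>v ?n = 0\<^sub>v ?n" by (auto intro!: eq_vecI simp: scalar_prod_def index_map_mat_def)
  have SP: "?S * ?P = ?P * Jm"
  proof (rule eq_mat_on_vecI[of _ ?n ?n])
    fix c assume c: "c < ?n"
    have "?S *\<^sub>v unit_vec ?n (p c) = ?P *\<^sub>v (if odd c \<and> c < 4*j then unit_vec ?n (c - 1) else 0\<^sub>v ?n)"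
    proof (cases "odd c \<and> c < 4*j")
      case True
      then have "p c < 2*j" "p (c - 1) = ?n - 1 - flip (p c)" "c - 1 < ?n" using c by (auto simp: p_def elim!: oddE)
      then show ?thesis using True pr[of "c-1"] by (simp add: std_nilpotent_unit[OF j pr[OF c]] index_map_mat_unit)
    next
      case False
      then have "\<not> p c < 2*j" using j fl[of c] c by (auto simp: p_def)
      then show ?thesis using False P0 by (auto simp: std_nilpotent_unit[OF j pr[OF c]])
    qed
    then show "?S * ?P *\<^sub>v unit_vec ?n c = ?P * Jm *\<^sub>v unit_vec ?n c"
      using Jc Ju[OF c] index_map_mat_unit[of p c ?n, where 'a=complex] pr[OF c] c
      by (simp add: assoc_mult_mat_vec[of _ ?n ?n _ ?n])
  qed (use Jc in \<open>auto intro!: mult_carrier_mat\<close>)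
  have inv': "?P * transpose_mat ?P = 1\<^sub>m ?n"
    using mat_mult_left_right_inverse[OF _ _ inv] by simp
  have eq: "?S = ?P * Jm * transpose_mat ?P"
    unfolding SP[symmetric] using inv' by (simp add: assoc_mult_mat[of _ ?n ?n _ ?n _ ?n])
  have "similar_mat ?S Jm"
    using Jc by (intro similar_matI[OF _ inv' inv eq]) simp
  then show ?thesis by (auto simp: jordan_nf_def Jm_def)
qed

text \<open>The Jordan type provides a conjugation to the normal form by an arbitrary invertible
  matrix. Square zero and both rank bounds are insensitive to that, and \<open>std_orbit_iff\<close>
  replaces it by a conjugation in \<open>K\<close>.\<close>

lemma jordan_orbit_eq_std_orbit:
  assumes j: "2*j \<le> l"
  shows "jordan_orbit l j = std_orbit l j"
proof (intro equalityI subsetI)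
  fix x assume "x \<in> std_orbit l j"
  then obtain k where k: "k \<in> K l" and x: "x = k * std_nilpotent l j * minv k" by (auto simp: std_orbit_def)
  have "x \<in> N\<pp>2 l" using \<open>x \<in> std_orbit l j\<close> std_orbit_iff[OF j] by (simp add: N\<pp>2_iff)
  moreover have "similar_mat x (std_nilpotent l j)"
    using K_inverse[OF k] K_carrier k x
    by (intro similar_matI[of _ _ k "minv k" "2*l"]) (auto intro!: mult_carrier_mat)
  ultimately show "x \<in> jordan_orbit l j"
    using std_nilpotent_jordan_nf[OF j] by (auto simp: jordan_orbit_def N\<pp>2_def jordan_nf_def intro: similar_mat_trans)
next
  fix x assume x: "x \<in> jordan_orbit l j"
  then have xc: "x \<in> carrier_mat (2*l) (2*l)" and xp: "x \<in> N\<pp> l" by (auto simp: jordan_orbit_def N\<pp>_def \<pp>_def)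
  have "similar_mat x (std_nilpotent l j)"
    using x std_nilpotent_jordan_nf[OF j] similar_mat_trans similar_mat_sym
    unfolding jordan_orbit_def jordan_nf_def by blast
  then obtain n P Q where PQ: "{x, std_nilpotent l j, P, Q} \<subseteq> carrier_mat n n" "P * Q = 1\<^sub>m n" "Q * P = 1\<^sub>m n"
    "x = P * std_nilpotent l j * Q"
    using similar_matD by blast
  have [simp]: "n = 2*l" using PQ(1) xc by auto
  have c: "P \<in> carrier_mat (2*l) (2*l)" "Q \<in> carrier_mat (2*l) (2*l)" using PQ by auto
  have d: "det P \<noteq> 0" "det Q \<noteq> 0" 
    using det_nonzero_if_left_inverse[OF c(1,2)] det_nonzero_if_left_inverse[OF c(2,1)] PQ(2,3) by simp_all
  have "x * x = P * std_nilpotent l j * (Q * P) * std_nilpotent l j * Q"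
    unfolding PQ(4) using c by (simp add: assoc_mult_mat[of _ "2*l" "2*l" _ "2*l" _ "2*l"] mult_carrier_mat[of _ "2*l" "2*l" _ "2*l"])
  also have "\<dots> = P * (std_nilpotent l j * std_nilpotent l j) * Q"
    unfolding PQ(3) using c by (simp add: assoc_mult_mat[of _ "2*l" "2*l" _ "2*l" _ "2*l"] mult_carrier_mat[of _ "2*l" "2*l" _ "2*l"]
        right_mult_one_mat[of _ "2*l" "2*l"] left_mult_one_mat[of _ "2*l" "2*l"])
  also have "\<dots> = 0\<^sub>m (2*l) (2*l)" using c j by (simp add: std_nilpotent_sq)
  finally have xx: "x * x = 0\<^sub>m (2*l) (2*l)" .
  have "x ^\<^sub>m 2 = x * x" using xc by (simp add: numeral_2_eq_2)
  then have "x \<in> N\<pp>2 l" using xp xx by (simp add: N\<pp>2_def)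
  moreover have "rank_le (2*l) (2*j) x" "rank_ge (2*l) (2*j) x"
    unfolding PQ(4) using rank_le_mult[OF c(1) _ c(2) std_nilpotent_rank(1)[OF j]]
      rank_ge_mult[OF c(1) _ c(2) d std_nilpotent_rank(2)[OF j]] by (simp_all del: assoc_mult_mat)
  ultimately show "x \<in> std_orbit l j" by (simp add: std_orbit_iff[OF j] N\<pp>2_iff)
qed

section \<open>Varieties of matrices\<close>

lemma polyfun_sum: "(\<And>i. i \<in> A \<Longrightarrow> f i \<in> polyfun) \<Longrightarrow> (\<lambda>v. \<Sum>i\<in>A. f i v) \<in> polyfun"
  by (induction A rule: infinite_finite_induct) (auto intro: polyfun.const polyfun.add)

lemma polyfun_prod: "(\<And>i. i \<in> A \<Longrightarrow> f i \<in> polyfun) \<Longrightarrow> (\<lambda>v. \<Prod>i\<in>A. f i v) \<in> polyfun"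
  by (induction A rule: infinite_finite_induct) (auto intro: polyfun.const polyfun.mult)

lemma polyfun_diff:
  assumes "f \<in> polyfun" "g \<in> polyfun" shows "(\<lambda>v. f v - g v) \<in> polyfun"
  using polyfun.add[OF assms(1) polyfun.mult[OF polyfun.const[of "-1"] assms(2)]] by simp

lemma polyfun_comp:
  assumes "p \<in> polyfun" "\<And>i. (\<lambda>v. F v i) \<in> polyfun"
  shows "(\<lambda>v. p (F v)) \<in> polyfun"
  using assms(1) by induction (auto intro: polyfun.intros assms(2))

lemma polyfun_det:
  assumes "\<And>v. A v \<in> carrier_mat n n" "\<And>i j. i < n \<Longrightarrow> j < n \<Longrightarrow> (\<lambda>v. A v $$ (i,j)) \<in> polyfun"
  shows "(\<lambda>v. det (A v)) \<in> polyfun"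
proof -
  have "(\<lambda>v. det (A v)) = (\<lambda>v. \<Sum>p | p permutes {0..<n}. signof p * (\<Prod>i = 0..<n. A v $$ (i, p i)))"
    using det_def'[OF assms(1)] by auto
  also have "\<dots> \<in> polyfun"
    by (intro polyfun_sum polyfun.mult polyfun.const polyfun_prod assms(2))
      (auto simp: permutes_in_image)
  finally show ?thesis .
qed

lemma regular_on_polyfun:
  assumes "p \<in> polyfun" "\<And>v. v \<in> V \<Longrightarrow> f v = p v"
  shows "regular_on V f"
  unfolding regular_on_def
proof
  fix v assume "v \<in> V"
  show "\<exists>p\<in>polyfun. \<exists>q\<in>polyfun. q v \<noteq> 0 \<and> (\<forall>w\<in>V. q w \<noteq> 0 \<longrightarrow> f w = p w / q w)"
    using assms polyfun.const[of 1] by (intro bexI[of _ p] bexI[of _ "\<lambda>_. 1"]) auto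
qed

lemma mat_coord_mat: "mat_coord (mat n n v) = v \<longleftrightarrow> (\<forall>i. i \<notin> {..<n} \<times> {..<n} \<longrightarrow> v i = 0)"
  unfolding mat_coord_def fun_eq_iff by force

lemma mat_mat_coord: "A \<in> carrier_mat n n \<Longrightarrow> mat n n (mat_coord A) = A"
  by (intro eq_matI) (auto simp: mat_coord_def)

lemma mat_coord_outside: "A \<in> carrier_mat n n \<Longrightarrow> i \<notin> {..<n} \<times> {..<n} \<Longrightarrow> mat_coord A i = 0"
  by (auto simp: mat_coord_def split: prod.splits)

lemma quasi_affine_mat_coord:
  assumes poly: "\<And>p. p \<in> S \<union> T \<Longrightarrow> (\<lambda>v. p (mat n n v)) \<in> polyfun"
    and Y: "Y = {A \<in> carrier_mat n n. (\<forall>p\<in>S. p A = 0) \<and> (\<exists>q\<in>T. q A \<noteq> 0)}"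
  shows "quasi_affine (mat_coord ` Y)"
  unfolding quasi_affine_def
proof (intro exI conjI)
  let ?I = "{..<n} \<times> {..<n}"
  let ?c = "\<lambda>p v. p (mat n n v)"
  show "finite ?I" by simp
  show "?c ` S \<subseteq> polyfun" "?c ` T \<subseteq> polyfun" using poly by auto
  show "mat_coord ` Y = {v. (\<forall>i. i \<notin> ?I \<longrightarrow> v i = 0) \<and> (\<forall>p\<in>?c ` S. p v = 0) \<and> (\<exists>q\<in>?c ` T. q v \<noteq> 0)}" (is "_ = ?R")
  proof (intro equalityI subsetI)
    fix v assume "v \<in> mat_coord ` Y"
    then obtain A where A: "A \<in> Y" "v = mat_coord A" by auto
    then have "A \<in> carrier_mat n n" by (simp add: Y)
    then have "mat n n v = A" "\<forall>i. i \<notin> ?I \<longrightarrow> v i = 0" using A mat_mat_coord mat_coord_outside by auto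
    then show "v \<in> ?R" using A Y by auto
  next
    fix v assume v: "v \<in> ?R"
    then have "v = mat_coord (mat n n v)" using mat_coord_mat[of n v] by auto
    moreover have "mat n n v \<in> Y" using v by (auto simp: Y)
    ultimately show "v \<in> mat_coord ` Y" by blast
  qed
qed

section \<open>Equations for the cone and its orbits\<close>

definition self_adjoint_sq0_conds :: "nat \<Rightarrow> (complex mat \<Rightarrow> complex) set" where
  "self_adjoint_sq0_conds l = (\<lambda>(i,j) x. (x * J l - J l * transpose_mat x) $$ (i,j)) ` ({..<2*l} \<times> {..<2*l}) \<union>
     (\<lambda>(i,j) x. (x * x) $$ (i,j)) ` ({..<2*l} \<times> {..<2*l})"

lemma self_adjoint_sq0_iff:
  assumes x: "x \<in> carrier_mat (2*l) (2*l)"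
  shows "self_adjoint_sq0 l x \<longleftrightarrow> (\<forall>p\<in>self_adjoint_sq0_conds l. p x = 0)"
proof -
  have entries: "A = B \<longleftrightarrow> (\<forall>i<2*l. \<forall>j<2*l. (A - B) $$ (i,j) = 0)"
    if A: "A \<in> carrier_mat (2*l) (2*l)" and B: "B \<in> carrier_mat (2*l) (2*l)" for A B :: "complex mat"
  proof
    assume "\<forall>i<2*l. \<forall>j<2*l. (A - B) $$ (i,j) = 0"
    then show "A = B" using A B by (intro eq_matI) auto
  qed (use B in auto)
  have c: "x * J l \<in> carrier_mat (2*l) (2*l)" "J l * transpose_mat x \<in> carrier_mat (2*l) (2*l)"
    "x * x \<in> carrier_mat (2*l) (2*l)" using x by (auto intro!: mult_carrier_mat)
  have "x * J l = J l * transpose_mat x \<longleftrightarrow> (\<forall>i<2*l. \<forall>j<2*l. (x * J l - J l * transpose_mat x) $$ (i,j) = 0)"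
    using entries[OF c(1,2)] .
  moreover have "x * x = 0\<^sub>m (2*l) (2*l) \<longleftrightarrow> (\<forall>i<2*l. \<forall>j<2*l. (x * x) $$ (i,j) = 0)"
    using entries[OF c(3) zero_carrier_mat] minus_r_inv_mat c(3) by (simp del: index_mult_mat)
  moreover have "(\<forall>p\<in>self_adjoint_sq0_conds l. p x = 0) \<longleftrightarrow>
      (\<forall>i<2*l. \<forall>j<2*l. (x * J l - J l * transpose_mat x) $$ (i,j) = 0) \<and> (\<forall>i<2*l. \<forall>j<2*l. (x * x) $$ (i,j) = 0)"
    unfolding self_adjoint_sq0_conds_def ball_Un ball_simps(9) split_paired_Ball_Sigma prod.case by (simp only: lessThan_iff Ball_def)
  ultimately show ?thesis unfolding self_adjoint_sq0_def using x by blast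
qed

lemma self_adjoint_sq0_conds_poly: "p \<in> self_adjoint_sq0_conds l \<Longrightarrow> (\<lambda>v. p (mat (2*l) (2*l) v)) \<in> polyfun"
proof -
  let ?X = "\<lambda>v. mat (2*l) (2*l) v :: complex mat"
  have 1: "(\<lambda>v. (?X v * J l - J l * transpose_mat (?X v)) $$ (i,j)) \<in> polyfun" if "i < 2*l" "j < 2*l" for i j
  proof -
    have "(\<lambda>v. (?X v * J l - J l * transpose_mat (?X v)) $$ (i,j)) =
      (\<lambda>v. (\<Sum>k<2*l. v (i,k) * J l $$ (k,j)) - (\<Sum>k<2*l. J l $$ (i,k) * v (j,k)))"
      using that by (auto simp: scalar_prod_def atLeast0LessThan)
    also have "\<dots> \<in> polyfun" by (intro polyfun_diff polyfun_sum polyfun.intros)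
    finally show ?thesis .
  qed
  have 2: "(\<lambda>v. (?X v * ?X v) $$ (i,j)) \<in> polyfun" if "i < 2*l" "j < 2*l" for i j
  proof -
    have "(\<lambda>v. (?X v * ?X v) $$ (i,j)) = (\<lambda>v. \<Sum>k<2*l. v (i,k) * v (k,j))"
      using that by (auto simp: scalar_prod_def atLeast0LessThan)
    also have "\<dots> \<in> polyfun" by (intro polyfun_sum polyfun.intros)
    finally show ?thesis .
  qed
  show "p \<in> self_adjoint_sq0_conds l \<Longrightarrow> (\<lambda>v. p (?X v)) \<in> polyfun"
    unfolding self_adjoint_sq0_conds_def using 1 2 by (elim UnE imageE) (auto simp del: index_mult_mat index_minus_mat)
qed

text \<open>The cone is closed, so the constant 1 serves as the open condition.\<close>

lemma quasi_affine_N\<pp>2: "quasi_affine (mat_coord ` N\<pp>2 l)"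
proof (rule quasi_affine_mat_coord)
  show "(\<lambda>v. p (mat (2*l) (2*l) v)) \<in> polyfun" if "p \<in> self_adjoint_sq0_conds l \<union> {\<lambda>_. 1 :: complex}" for p
    using that self_adjoint_sq0_conds_poly polyfun.const by auto
  show "N\<pp>2 l = {A \<in> carrier_mat (2*l) (2*l). (\<forall>p\<in>self_adjoint_sq0_conds l. p A = 0) \<and> (\<exists>q\<in>{\<lambda>_. 1 :: complex}. q A \<noteq> 0)}"
    using self_adjoint_sq0_iff N\<pp>2_iff self_adjoint_sq0_def by auto
qed

lemma polyfun_det_add:
  assumes "C \<in> carrier_mat n n"
  shows "(\<lambda>v. det (mat n n v + C)) \<in> polyfun"
proof (rule polyfun_det[of _ n])
  fix i j assume "i < n" "j < n"
  then have "(\<lambda>v. (mat n n v + C) $$ (i,j)) = (\<lambda>v. v (i,j) + C $$ (i,j))" using assms by auto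
  also have "\<dots> \<in> polyfun" by (intro polyfun.intros)
  finally show "(\<lambda>v. (mat n n v + C) $$ (i,j)) \<in> polyfun" .
qed (use assms in simp)

text \<open>The bound \<open>rank_ge\<close> at \<open>2*j\<close> is the open condition. The bound
  \<open>rank_le\<close> at \<open>2*j\<close> is made closed by expressing it as the vanishing of
  every \<open>det (x + C)\<close> that could witness rank at least \<open>2*j + 1\<close>.\<close>

lemma quasi_affine_std_orbit:
  assumes j: "2*j \<le> l" and l: "0 < l"
  shows "quasi_affine (mat_coord ` std_orbit l j)"
proof (rule quasi_affine_mat_coord)
  define D where "D = (\<lambda>r. (\<lambda>C x. det (x + C)) ` {C \<in> carrier_mat (2*l) (2*l). rank_le (2*l) (2*l - r) (C :: complex mat)})"
  let ?S = "self_adjoint_sq0_conds l \<union> D (2*j+1)"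
  show "(\<lambda>v. p (mat (2*l) (2*l) v)) \<in> polyfun" if p: "p \<in> ?S \<union> D (2*j)" for p
  proof -
    have "(\<lambda>v. p (mat (2*l) (2*l) v)) \<in> polyfun" if p: "p \<in> D r" for r
    proof -
      obtain C where "C \<in> carrier_mat (2*l) (2*l)" "p = (\<lambda>x. det (x + C))" using p unfolding D_def by blast
      then show ?thesis by (simp only: polyfun_det_add)
    qed
    then show ?thesis using p self_adjoint_sq0_conds_poly by blast
  qed
  have ge: "rank_ge (2*l) r x \<longleftrightarrow> (\<exists>q\<in>D r. q x \<noteq> 0)" for r and x :: "complex mat"
    unfolding rank_ge_def D_def bex_simps(7) by blast
  \<comment> \<open>On the cone the equivalence follows from the classification, since
    \<open>x\<close> has exact rank \<open>2*i\<close> for some \<open>i\<close>. The assumption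
    \<open>0 < l\<close> ensures \<open>2*j + 1 \<le> 2*l\<close>, without which the truncated
    \<open>2*l - (2*j+1)\<close> would not measure a complement.\<close>
  have not_ge: "rank_le (2*l) (2*j) x \<longleftrightarrow> \<not> rank_ge (2*l) (2*j+1) x" 
    if x: "self_adjoint_sq0 l x" for x
  proof -
    have xc: "x \<in> carrier_mat (2*l) (2*l)" using x by (simp add: self_adjoint_sq0_def)
    obtain i where i: "2*i \<le> l" "x \<in> std_orbit l i" using self_adjoint_sq0_in_std_orbit[OF x] by blast
    then have r: "rank_le (2*l) (2*i) x" "rank_ge (2*l) (2*i) x" by (simp_all add: std_orbit_iff)
    show ?thesis
    proof
      assume "rank_le (2*l) (2*j) x"
      then show "\<not> rank_ge (2*l) (2*j+1) x" using rank_ge_le_trans[OF xc, of "2*j" "2*j+1"] j l by auto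
    next
      assume n: "\<not> rank_ge (2*l) (2*j+1) x"
      have "i \<le> j"
      proof (rule ccontr)
        assume "\<not> i \<le> j"
        then have "2*l - 2*i \<le> 2*l - (2*j+1)" by auto
        then have "rank_ge (2*l) (2*j+1) x" using r(2) rank_le_mono unfolding rank_ge_def by blast
        then show False using n by simp
      qed
      then show "rank_le (2*l) (2*j) x" using rank_le_mono[OF r(1)] by simp
    qed
  qed
  have S: "(\<forall>p\<in>?S. p x = 0) \<longleftrightarrow> self_adjoint_sq0 l x \<and> rank_le (2*l) (2*j) x" 
    if "x \<in> carrier_mat (2*l) (2*l)" for x
  proof -
    have "(\<forall>p\<in>D (2*j+1). p x = 0) \<longleftrightarrow> \<not> rank_ge (2*l) (2*j+1) x" unfolding ge by simp
    then show ?thesis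
      unfolding ball_Un self_adjoint_sq0_iff[OF that, symmetric] using not_ge[of x] by argo
  qed
  show "std_orbit l j = {A \<in> carrier_mat (2*l) (2*l). (\<forall>p\<in>?S. p A = 0) \<and> (\<exists>q\<in>D (2*j). q A \<noteq> 0)}"
  proof (rule Set.set_eqI)
    fix x
    show "x \<in> std_orbit l j \<longleftrightarrow> x \<in> {A \<in> carrier_mat (2*l) (2*l). (\<forall>p\<in>?S. p A = 0) \<and> (\<exists>q\<in>D (2*j). q A \<noteq> 0)}"
    proof (cases "x \<in> carrier_mat (2*l) (2*l)")
      case True
      show ?thesis unfolding std_orbit_iff[OF j] mem_Collect_eq S[OF True] ge[symmetric] using True by argo
    next
      case False
      then show ?thesis unfolding std_orbit_iff[OF j] self_adjoint_sq0_def by simp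
    qed
  qed
qed

text \<open>The values of \<open>gr_coord\<close> at the coset of $I + xt^{-1}$.\<close>

definition linear_coord :: "nat \<Rightarrow> complex mat \<Rightarrow> nat \<times> nat \<times> nat \<Rightarrow> complex" where
  "linear_coord n x = (\<lambda>(i,j,k). if i < n \<and> j < n then
     (if k = 0 then (if i = j then 1 else 0) else if k = 1 then x $$ (i,j) else 0) else 0)"

lemma linear_coord_1: "x \<in> carrier_mat n n \<Longrightarrow> linear_coord n x (i,j,1) = mat_coord x (i,j)"
  by (auto simp: linear_coord_def mat_coord_def)

text \<open>Besides the entries of \<open>x\<close>, placed at \<open>k = 1\<close>,
  \<open>linear_coord\<close> contains only constants. Projecting to \<open>k = 1\<close> and
  inserting these constants are therefore mutually inverse polynomial maps.\<close>

lemma iso_via_linear_coord: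
  fixes \<phi> :: "'c \<Rightarrow> nat \<times> nat \<times> nat \<Rightarrow> complex"
  assumes Y: "Y \<subseteq> carrier_mat n n" and qa: "quasi_affine (mat_coord ` Y)" and f: "bij_betw f X Y"
    and \<phi>: "\<And>c. c \<in> X \<Longrightarrow> \<phi> c = linear_coord n (f c)"
  shows "iso_via \<phi> X mat_coord Y f"
proof -
  let ?G = "linear_coord n"
  define F where "F = (\<lambda>v. mat_coord (f (inv_into X \<phi> v)))"
  have proj: "(\<lambda>(i,j). ?G y (i,j,1)) = mat_coord y" if "y \<in> Y" for y
    using that Y linear_coord_1[of y n] by auto
  have injY: "inj_on mat_coord Y"
    using Y mat_mat_coord by (intro inj_on_inverseI[where g = "mat n n"]) auto
  have injG: "inj_on ?G Y"
  proof (rule inj_onI)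
    fix x y assume "x \<in> Y" "y \<in> Y" "?G x = ?G y"
    then show "x = y" using proj[of x] proj[of y] injY by (auto simp: inj_on_def)
  qed
  have fX: "f ` X = Y" "inj_on f X" using f by (auto simp: bij_betw_def)
  have inj\<phi>: "inj_on \<phi> X"
  proof (rule inj_onI)
    fix c d assume "c \<in> X" "d \<in> X" "\<phi> c = \<phi> d"
    moreover from this have "f c \<in> Y" "f d \<in> Y" using fX by auto
    ultimately show "c = d" using \<phi> injG fX(2) by (auto simp: inj_on_def)
  qed
  have im: "\<phi> ` X = ?G ` Y" unfolding fX(1)[symmetric] image_image using \<phi> by auto
  have FG: "F (?G y) = mat_coord y" if y: "y \<in> Y" for y
  proof -
    obtain c where c: "c \<in> X" "y = f c" using y fX(1) by blast
    then show ?thesis using inv_into_f_f[OF inj\<phi> c(1)] \<phi>[OF c(1)] by (simp add: F_def)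
  qed
  have bij: "bij_betw F (?G ` Y) (mat_coord ` Y)"
  proof -
    have "F ` ?G ` Y = mat_coord ` Y" unfolding image_image by (rule image_cong[OF refl FG])
    moreover have "inj_on F (?G ` Y)"
    proof (rule inj_onI)
      fix v w assume "v \<in> ?G ` Y" "w \<in> ?G ` Y" and eq: "F v = F w"
      then obtain x y where "x \<in> Y" "y \<in> Y" "v = ?G x" "w = ?G y" by blast
      moreover from this have "x = y" using eq FG injY unfolding inj_on_def by metis
      ultimately show "v = w" by simp
    qed
    ultimately show ?thesis by (simp add: bij_betw_def)
  qed
  have inv: "inv_into (?G ` Y) F (mat_coord y) = ?G y" if "y \<in> Y" for y
    using inv_into_f_f[OF bij_betw_imp_inj_on[OF bij], of "?G y"] FG[OF that] that by simp
  have qaG: "quasi_affine (?G ` Y)"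
  proof -
    obtain I S T where I: "finite I" and S: "S \<subseteq> polyfun" and T: "T \<subseteq> polyfun"
      and W: "mat_coord ` Y = {v. (\<forall>i. i \<notin> I \<longrightarrow> v i = 0) \<and> (\<forall>p\<in>S. p v = 0) \<and> (\<exists>q\<in>T. q v \<noteq> 0)}"
      using qa unfolding quasi_affine_def by (elim exE conjE) (rule that)
    define pr :: "(nat \<times> nat \<times> nat \<Rightarrow> complex) \<Rightarrow> nat \<times> nat \<Rightarrow> complex" where "pr = (\<lambda>v (i,j). v (i,j,1))"
    have prp: "(\<lambda>v. pr v i) \<in> polyfun" for i by (cases i) (simp add: pr_def polyfun.coord)
    have prc: "(\<lambda>v. p (pr v)) \<in> polyfun" if "p \<in> polyfun" for p using polyfun_comp[where F = pr, OF that prp] .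
    let ?c = "\<lambda>p v. p (pr v)"
    let ?I = "{..<n} \<times> {..<n} \<times> {..1::nat}"
    \<comment> \<open>The equations of the image: those of \<open>Y\<close> at the slice
      \<open>k = 1\<close>, the vanishing of that slice outside \<open>I\<close>, and the identity
      matrix in the slice \<open>k = 0\<close>. The index set \<open>?I\<close> already removes all
      \<open>k > 1\<close>.\<close>
    let ?S = "?c ` S \<union> (\<lambda>i v. pr v i) ` (- I) \<union> (\<lambda>(i,j) v. v (i,j,0) - (if i = j then 1 else 0)) ` ({..<n} \<times> {..<n})"
    show ?thesis
      unfolding quasi_affine_def
    proof (intro exI conjI)
      show "finite ?I" by simp
      have diag: "(\<lambda>v. v (i,j,0) - (if i = j then 1 else 0)) \<in> polyfun" for i j :: nat
        by (intro polyfun_diff polyfun.coord polyfun.const)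
      have "(\<lambda>(i,j) v. v (i,j,0) - (if i = j then 1 else 0)) x \<in> polyfun" for x :: "nat \<times> nat"
        by (cases x) (simp only: prod.case diag)
      moreover have "?c p \<in> polyfun" if "p \<in> S" for p using prc S that by blast
      ultimately show "?S \<subseteq> polyfun" using prp by (intro Un_least image_subsetI)
      show "?c ` T \<subseteq> polyfun" using T prc by auto
      show "?G ` Y = {v. (\<forall>i. i \<notin> ?I \<longrightarrow> v i = 0) \<and> (\<forall>p\<in>?S. p v = 0) \<and> (\<exists>q\<in>?c ` T. q v \<noteq> 0)}" (is "_ = ?R")
      proof (intro equalityI subsetI)
        fix v assume "v \<in> ?G ` Y"
        then obtain y where y: "y \<in> Y" "v = ?G y" by auto
        have pv: "pr v = mat_coord y" using proj[OF y(1)] y(2) by (simp add: pr_def)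
        have "mat_coord y \<in> mat_coord ` Y" using y by blast
        then have "\<forall>i. i \<notin> I \<longrightarrow> pr v i = 0" "\<forall>p\<in>S. p (pr v) = 0" "\<exists>q\<in>T. q (pr v) \<noteq> 0"
          unfolding W pv by auto
        moreover have "v i = 0" if "i \<notin> ?I" for i using that by (auto simp: y(2) linear_coord_def split: prod.splits)
        ultimately show "v \<in> ?R" by (auto simp: y(2) linear_coord_def)
      next
        fix v assume v: "v \<in> ?R"
        then have "\<forall>i. i \<notin> I \<longrightarrow> pr v i = 0" "\<forall>p\<in>S. p (pr v) = 0" "\<exists>q\<in>T. q (pr v) \<noteq> 0" by auto
        then have "pr v \<in> mat_coord ` Y" unfolding W by blast
        then obtain y where y: "y \<in> Y" "pr v = mat_coord y" by auto
        have third: "v (i,j,0) - (if i = j then 1 else 0) = 0" if "i < n" "j < n" for i j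
          using v that unfolding mem_Collect_eq ball_Un ball_simps(9) by auto
        have "v (i,j,k) = ?G y (i,j,k)" for i j k
        proof (cases "i < n \<and> j < n \<and> k \<le> 1")
          case True
          have "v (i,j,0) = (if i = j then 1 else 0)" using third[of i j] True by simp
          moreover have "v (i,j,1) = y $$ (i,j)" 
            using fun_cong[OF y(2), of "(i,j)"] True y(1) Y by (auto simp: pr_def mat_coord_def)
          ultimately show ?thesis using True by (auto simp: linear_coord_def le_Suc_eq)
        next
          case False
          then have "v (i,j,k) = 0" using v by auto
          then show ?thesis using False by (auto simp: linear_coord_def)
        qed
        then have "v = ?G y" by auto
        then show "v \<in> ?G ` Y" using y(1) by blast
      qed
    qed
  qed
  have "morphism (?G ` Y) (mat_coord ` Y) F"
    unfolding morphism_def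
  proof (intro conjI allI)
    show "F ` ?G ` Y \<subseteq> mat_coord ` Y" using FG by auto
    fix i :: "nat \<times> nat"
    obtain a b where i: "i = (a,b)" by (cases i)
    show "regular_on (?G ` Y) (\<lambda>v. F v i)"
    proof (rule regular_on_polyfun[OF polyfun.coord[of "(a,b,1)"]])
      fix v assume "v \<in> ?G ` Y"
      then show "F v i = v (a,b,1)" using FG proj Y by (auto simp: i linear_coord_1 subset_iff simp del: One_nat_def)
    qed
  qed
  moreover have "morphism (mat_coord ` Y) (?G ` Y) (inv_into (?G ` Y) F)"
    unfolding morphism_def
  proof (intro conjI allI)
    show "inv_into (?G ` Y) F ` mat_coord ` Y \<subseteq> ?G ` Y" using inv by auto
    fix i :: "nat \<times> nat \<times> nat"
    obtain a b k where i: "i = (a,b,k)" by (cases i)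
    \<comment> \<open>For \<open>k \<noteq> 1\<close> the coordinate is the same for all matrices,
      so its value may be read off at the identity matrix.\<close>
    let ?p = "\<lambda>w. if k = 1 then w (a,b) else ?G (1\<^sub>m n) i"
    have "?p \<in> polyfun" by (cases "k = 1") (auto intro: polyfun.intros)
    then show "regular_on (mat_coord ` Y) (\<lambda>w. inv_into (?G ` Y) F w i)"
    proof (rule regular_on_polyfun)
      fix w assume "w \<in> mat_coord ` Y"
      then obtain y where y: "y \<in> Y" "w = mat_coord y" by auto
      have "inv_into (?G ` Y) F w i = ?G y i" using inv y by simp
      also have "\<dots> = ?p w" 
        using y Y linear_coord_1[of y n a b] by (auto simp: i linear_coord_def)
      finally show "inv_into (?G ` Y) F w i = ?p w" .
    qed
  qed
  ultimately show ?thesis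
    unfolding iso_via_def variety_iso_def im F_def[symmetric]
    using inj\<phi> injY fX(1) qaG qa bij by auto
qed

section \<open>The twisted loop group\<close>

abbreviation neg_var :: "complex fls \<Rightarrow> complex fls" where
  "neg_var f \<equiv> fls_compose_fps f (- fps_X)"

abbreviation twist :: "complex fls mat \<Rightarrow> complex fls mat" where
  "twist A \<equiv> map_mat neg_var A"

lemma neg_var_nth: "fls_nth (neg_var f) n = fls_nth f n * (-1) powi n"
proof -
  have eq: "- fps_X = fps_const (-1) * (fps_X :: complex fps)" by (simp flip: fps_const_neg)
  show ?thesis unfolding eq by (rule fls_nth_fls_compose_fps_linear) simp
qed

lemma neg_var_hom: "comm_ring_hom neg_var"
  by unfold_locales (simp_all add: fls_compose_fps_add fls_compose_fps_mult)

lemma twist_mult: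
  "A \<in> carrier_mat n m \<Longrightarrow> B \<in> carrier_mat m k \<Longrightarrow> twist (A * B) = twist A * twist B"
proof -
  interpret comm_ring_hom neg_var by (rule neg_var_hom)
  show "A \<in> carrier_mat n m \<Longrightarrow> B \<in> carrier_mat m k \<Longrightarrow> twist (A * B) = twist A * twist B"
    by (rule mat_hom_mult)
qed

lemma twist_one: "twist (1\<^sub>m n) = 1\<^sub>m n"
  by (intro eq_matI) auto

lemma det_twist: "det (twist A) = neg_var (det A)"
proof -
  interpret comm_ring_hom neg_var by (rule neg_var_hom)
  show ?thesis by (rule hom_det)
qed

lemma carrier_GK_iff:
  "A \<in> carrier (GK l) \<longleftrightarrow> A \<in> carrier_mat (2*l) (2*l) \<and> det A = 1 \<and> A * J l * transpose_mat (twist A) = J l"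
proof -
  have "sigma l (twist A) = A \<longleftrightarrow> A * J l * transpose_mat (twist A) = J l"
    if "A \<in> carrier_mat (2*l) (2*l)" "det A = 1"
    using that by (intro sigma_eq_iff) (auto simp: det_twist)
  then show ?thesis by (auto simp: GK_def SL_def loop_sigma_def)
qed

lemma GK_carrier: "A \<in> carrier (GK l) \<Longrightarrow> A \<in> carrier_mat (2*l) (2*l)"
  by (simp add: carrier_GK_iff)

lemma GK_mult:
  assumes A: "A \<in> carrier (GK l)" and B: "B \<in> carrier (GK l)" shows "A * B \<in> carrier (GK l)"
proof -
  let ?n = "2*l"
  note c = GK_carrier[OF A] GK_carrier[OF B]
  note assoc = assoc_mult_mat[of _ ?n ?n _ ?n _ ?n] mult_carrier_mat[of _ ?n ?n _ ?n]
  have "A * B * J l * transpose_mat (twist (A * B)) = A * (B * J l * transpose_mat (twist B)) * transpose_mat (twist A)"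
    using c by (simp add: assoc twist_mult[OF c] transpose_mult[of _ ?n ?n _ ?n])
  also have "\<dots> = J l" using A B by (simp add: carrier_GK_iff)
  finally show ?thesis using c A B det_mult[OF c] by (simp add: carrier_GK_iff mult_carrier_mat[OF c])
qed

text \<open>The twisted equation gives the inverse in closed form, by transposing, twisting and
  multiplying with \<open>J\<close>. Hence inverses stay over any coefficient ring that is stable
  under the twist.\<close>

lemma GK_inverse:
  assumes A: "A \<in> carrier (GK l)"
  shows "minv A \<in> carrier (GK l)" "A * minv A = 1\<^sub>m (2*l)" "minv A * A = 1\<^sub>m (2*l)"
    "minv A = J l * transpose_mat (twist A) * (- J l)"
proof -
  let ?n = "2*l"
  have d: "det A \<noteq> 0" using A by (simp add: carrier_GK_iff)
  note c = GK_carrier[OF A] 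
  note inv = minv_if_det[OF c d]
  note assoc = assoc_mult_mat[of _ ?n ?n _ ?n _ ?n] mult_carrier_mat[of _ ?n ?n _ ?n]
  show "A * minv A = 1\<^sub>m ?n" "minv A * A = 1\<^sub>m ?n" using inv by auto
  have eq: "A * J l * transpose_mat (twist A) = J l" using A by (simp add: carrier_GK_iff)
  have tc: "twist A \<in> carrier_mat ?n ?n" "twist (minv A) \<in> carrier_mat ?n ?n" using c inv(1) by auto
  have t: "transpose_mat (twist A) * transpose_mat (twist (minv A)) = 1\<^sub>m ?n"
    
    unfolding transpose_mult[OF tc(2,1), symmetric] twist_mult[OF inv(1) c, symmetric] inv(3) by (simp add: twist_one)
  have "minv A * J l * transpose_mat (twist (minv A)) = minv A * (A * J l * transpose_mat (twist A)) * transpose_mat (twist (minv A))"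
    by (simp only: eq)
  also have "\<dots> = (minv A * A) * J l * (transpose_mat (twist A) * transpose_mat (twist (minv A)))"
    using c inv(1) tc by (simp add: assoc)
  also have "\<dots> = J l" unfolding t inv(3) by (simp add: left_mult_one_mat[OF J_carrier] right_mult_one_mat[OF J_carrier])
  finally have "minv A * J l * transpose_mat (twist (minv A)) = J l" .
  moreover have "det (minv A) = 1"
    using arg_cong[OF inv(2), of det] det_mult[OF c inv(1)] A by (simp add: carrier_GK_iff)
  ultimately show "minv A \<in> carrier (GK l)" using inv(1) by (simp add: carrier_GK_iff)
  have "A * (J l * transpose_mat (twist A) * (- J l)) = (A * J l * transpose_mat (twist A)) * (- J l)"
    using c tc by (simp add: assoc)
  also have "\<dots> = 1\<^sub>m ?n" unfolding eq by (rule J_mult_uminus)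
  finally show "minv A = J l * transpose_mat (twist A) * (- J l)"
    using c tc by (intro minv_eqI) (auto intro!: mult_carrier_mat)
qed

section \<open>Entries in \<open>\<O>\<close> and \<open>\<O>m\<close> and reduction to the constant
  term\<close>

text \<open>A subring \<open>R\<close> of the Laurent series, stable under \<open>t \<mapsto> -t\<close>, on which the constant
  coefficient is multiplicative: both \<open>\<O>\<close> and \<open>\<O>m\<close> are of this kind.\<close>

definition coeff_ring :: "complex fls set \<Rightarrow> bool" where
  "coeff_ring R \<longleftrightarrow> (\<forall>c. fls_const c \<in> R) \<and> (\<forall>f\<in>R. neg_var f \<in> R) \<and>
     (\<forall>f\<in>R. \<forall>g\<in>R. f + g \<in> R \<and> f * g \<in> R \<and> fls_nth (f * g) 0 = fls_nth f 0 * fls_nth g 0)"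

lemma coeff_ring_\<O>: "coeff_ring \<O>"
proof -
  have iff: "f \<in> \<O> \<longleftrightarrow> (\<exists>g. f = fps_to_fls g)" for f :: "complex fls"
  proof
    assume "f \<in> \<O>"
    then have "f = fps_to_fls (fls_regpart f)" by (intro fls_eqI) (auto simp: \<O>_def)
    then show "\<exists>g. f = fps_to_fls g" by blast
  qed (auto simp: \<O>_def)
  have "f * g \<in> \<O> \<and> fls_nth (f * g) 0 = fls_nth f 0 * fls_nth g 0" if fg: "f \<in> \<O>" "g \<in> \<O>" for f g
  proof -
    obtain F G where eq: "f = fps_to_fls F" "g = fps_to_fls G" using fg iff by blast
    have "f * g = fps_to_fls (F * G)" by (simp add: eq fls_times_fps_to_fls)
    then show ?thesis using iff by (auto simp: eq simp del: fls_times_fps_to_fls)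
  qed
  then show ?thesis by (auto simp: coeff_ring_def \<O>_def neg_var_nth)
qed

lemma coeff_ring_\<O>m: "coeff_ring \<O>m"
proof -
  have pos: "fls_nth (f * g) n = 0" if "n > 0" and f: "f \<in> \<O>m" and g: "g \<in> \<O>m" for f g :: "complex fls" and n
    unfolding fls_times_nth(2)
  proof (rule sum.neutral, rule ballI)
    fix i
    show "fls_nth f i * fls_nth g (n - i) = 0"
    proof (cases "i > 0")
      case False
      then have "n - i > 0" using \<open>n > 0\<close> by simp
      then show ?thesis using g by (simp add: \<O>m_def)
    qed (use f in \<open>simp add: \<O>m_def\<close>)
  qed
  have zero: "fls_nth (f * g) 0 = 0" if f: "f \<in> \<O>m" and g: "g \<in> \<O>m" and "fls_nth f 0 = 0" for f g :: "complex fls"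
    unfolding fls_times_nth(2)
  proof (rule sum.neutral, rule ballI)
    fix i :: int
    consider "i > 0" | "i = 0" | "0 - i > 0" by linarith
    then show "fls_nth f i * fls_nth g (0 - i) = 0"
      using f g that(3) by cases (simp_all add: \<O>m_def)
  qed
  have "fls_nth (f * g) 0 = fls_nth f 0 * fls_nth g 0" if f: "f \<in> \<O>m" and g: "g \<in> \<O>m" for f g
  proof -
    \<comment> \<open>Subtracting the constant coefficient reduces to the case where it is 0, in
      which every summand of the convolution at index 0 vanishes.\<close>
    let ?f = "f - fls_const (fls_nth f 0)"
    have "?f \<in> \<O>m" "fls_nth ?f 0 = 0" using f by (auto simp: \<O>m_def)
    then have "fls_nth (?f * g) 0 = 0" using zero g by blast
    then show ?thesis by (simp add: left_diff_distrib)
  qed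
  then show ?thesis using pos by (auto simp: coeff_ring_def \<O>m_def neg_var_nth)
qed

definition entries_in :: "complex fls set \<Rightarrow> complex fls mat \<Rightarrow> bool" where
  "entries_in R A \<longleftrightarrow> (\<forall>i<dim_row A. \<forall>j<dim_col A. A $$ (i,j) \<in> R)"

lemma elements_mat_subset_iff: "elements_mat A \<subseteq> R \<longleftrightarrow> entries_in R A"
  unfolding entries_in_def using elements_matD[of _ A] elements_matI[of A "dim_row A" "dim_col A"] by blast

lemma GO_iff: "A \<in> GO l \<longleftrightarrow> A \<in> carrier (GK l) \<and> entries_in \<O> A"
  by (auto simp: GO_def GK_def SL_def elements_mat_subset_iff)

lemma GOm_iff: "A \<in> GOm l \<longleftrightarrow> A \<in> carrier (GK l) \<and> entries_in \<O>m A"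
  by (auto simp: GOm_def GK_def SL_def elements_mat_subset_iff)

abbreviation const_coeff :: "complex fls mat \<Rightarrow> complex mat" where
  "const_coeff A \<equiv> map_mat (\<lambda>f. fls_nth f 0) A"

abbreviation const_mat :: "complex mat \<Rightarrow> complex fls mat" where
  "const_mat A \<equiv> map_mat fls_const A"

lemma coeff_ring_sum:
  assumes R: "coeff_ring R" and "\<And>i. i \<in> A \<Longrightarrow> f i \<in> R" 
  shows "(\<Sum>i\<in>A. f i) \<in> R \<and> fls_nth (\<Sum>i\<in>A. f i) 0 = (\<Sum>i\<in>A. fls_nth (f i) 0)"
proof -
  have "fls_const 0 \<in> R" using R unfolding coeff_ring_def by blast
  then show ?thesis using assms(2)
    by (induction A rule: infinite_finite_induct) (use R in \<open>simp_all add: coeff_ring_def\<close>)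
qed

lemma coeff_ring_prod:
  assumes R: "coeff_ring R" and "\<And>i. i \<in> A \<Longrightarrow> f i \<in> R" 
  shows "(\<Prod>i\<in>A. f i) \<in> R \<and> fls_nth (\<Prod>i\<in>A. f i) 0 = (\<Prod>i\<in>A. fls_nth (f i) 0)"
proof -
  have "fls_const 1 \<in> R" using R unfolding coeff_ring_def by blast
  then show ?thesis using assms(2)
    by (induction A rule: infinite_finite_induct) (use R in \<open>simp_all add: coeff_ring_def\<close>)
qed

lemma entries_in_mult:
  assumes R: "coeff_ring R" and A: "A \<in> carrier_mat n m" "entries_in R A" and B: "B \<in> carrier_mat m k" "entries_in R B"
  shows "entries_in R (A * B)" "const_coeff (A * B) = const_coeff A * const_coeff B"
proof -
  have e: "(A * B) $$ (i,j) \<in> R \<and> fls_nth ((A * B) $$ (i,j)) 0 = (\<Sum>a<m. fls_nth (A $$ (i,a)) 0 * fls_nth (B $$ (a,j)) 0)"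
    if ij: "i < n" "j < k" for i j
  proof -
    have eq: "(A * B) $$ (i,j) = (\<Sum>a<m. A $$ (i,a) * B $$ (a,j))"
      using A B ij by (simp add: scalar_prod_def atLeast0LessThan)
    have ent: "A $$ (i,a) \<in> R" "B $$ (a,j) \<in> R" if "a < m" for a 
      using A B ij that by (auto simp: entries_in_def)
    have "A $$ (i,a) * B $$ (a,j) \<in> R \<and> fls_nth (A $$ (i,a) * B $$ (a,j)) 0 = fls_nth (A $$ (i,a)) 0 * fls_nth (B $$ (a,j)) 0" if "a < m" for a
      using R ent[OF that] unfolding coeff_ring_def by blast
    then show ?thesis using coeff_ring_sum[OF R, of "{..<m}" "\<lambda>a. A $$ (i,a) * B $$ (a,j)"] unfolding eq by simp
  qed
  show "entries_in R (A * B)" using e A B by (simp add: entries_in_def del: index_mult_mat(1))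
  show "const_coeff (A * B) = const_coeff A * const_coeff B"
  proof (rule eq_matI)
    fix i j assume "i < dim_row (const_coeff A * const_coeff B)" "j < dim_col (const_coeff A * const_coeff B)"
    then have ij: "i < n" "j < k" using A B by auto
    have "const_coeff (A * B) $$ (i,j) = fls_nth ((A * B) $$ (i,j)) 0" using ij A B by simp
    also have "\<dots> = (const_coeff A * const_coeff B) $$ (i,j)"
      using e[OF ij] ij A B by (simp add: scalar_prod_def atLeast0LessThan)
    finally show "const_coeff (A * B) $$ (i,j) = (const_coeff A * const_coeff B) $$ (i,j)" .
  qed (use A B in auto)
qed

lemma det_const_coeff:
  assumes R: "coeff_ring R" and A: "A \<in> carrier_mat n n" "entries_in R A"
  shows "det (const_coeff A) = fls_nth (det A) 0"
proof -
  have sg: "signof p = (fls_const (signof p) :: complex fls)" for p by (simp add: sign_def)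
  have p: "(\<Prod>i=0..<n. A $$ (i, p i)) \<in> R \<and> fls_nth (\<Prod>i=0..<n. A $$ (i, p i)) 0 = (\<Prod>i=0..<n. fls_nth (A $$ (i, p i)) 0)"
    if "p permutes {0..<n}" for p
    using A that by (intro coeff_ring_prod[OF R]) (auto simp: entries_in_def permutes_in_image)
  have t: "signof p * (\<Prod>i=0..<n. A $$ (i, p i)) \<in> R \<and> 
     fls_nth (signof p * (\<Prod>i=0..<n. A $$ (i, p i))) 0 = signof p * (\<Prod>i=0..<n. fls_nth (A $$ (i, p i)) 0)"
    if "p permutes {0..<n}" for p
  proof -
    have "signof p \<in> R" using R unfolding coeff_ring_def sg by blast
    moreover have "fls_nth (signof p) 0 = (signof p :: complex)" by (simp add: sign_def)
    ultimately show ?thesis using p[OF that] R unfolding coeff_ring_def by simp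
  qed
  have "fls_nth (det A) 0 = (\<Sum>p | p permutes {0..<n}. fls_nth (signof p * (\<Prod>i=0..<n. A $$ (i, p i))) 0)"
    unfolding det_def'[OF A(1)]
    by (rule conjunct2[OF coeff_ring_sum[OF R]]) (use t in simp)
  also have "\<dots> = (\<Sum>p | p permutes {0..<n}. signof p * (\<Prod>i=0..<n. fls_nth (A $$ (i, p i)) 0))"
    using t by (intro sum.cong) auto
  also have "\<dots> = det (const_coeff A)"
    using A(1) by (subst det_def'[of _ n]) (auto intro!: sum.cong prod.cong simp: permutes_in_image)
  finally show ?thesis by simp
qed

lemma fls_const_hom: "comm_ring_hom (fls_const :: complex \<Rightarrow> complex fls)"
  by unfold_locales (simp_all add: fls_plus_const)

lemma const_mat_mult:
  "A \<in> carrier_mat n m \<Longrightarrow> B \<in> carrier_mat m k \<Longrightarrow> const_mat (A * B) = const_mat A * const_mat B"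
proof -
  interpret comm_ring_hom "fls_const :: complex \<Rightarrow> complex fls" by (rule fls_const_hom)
  show "A \<in> carrier_mat n m \<Longrightarrow> B \<in> carrier_mat m k \<Longrightarrow> const_mat (A * B) = const_mat A * const_mat B"
    by (rule mat_hom_mult)
qed

lemma det_const_mat: "det (const_mat A) = fls_const (det A)"
proof -
  interpret comm_ring_hom "fls_const :: complex \<Rightarrow> complex fls" by (rule fls_const_hom)
  show ?thesis by (rule hom_det)
qed

lemma const_mat_one: "const_mat (1\<^sub>m n) = 1\<^sub>m n"
  by (intro eq_matI) auto

lemma fls_const_minus_one_power: "fls_const ((-1) ^ n) = ((-1) ^ n :: complex fls)"
  by (simp add: minus_one_power_iff)

lemma const_mat_J: "const_mat (J l) = J l"
  by (intro eq_matI) (auto simp: index_J fls_const_minus_one_power)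

lemma twist_const_mat: "twist (const_mat A) = const_mat A"
  by (intro eq_matI) auto

lemma const_coeff_const_mat: "const_coeff (const_mat A) = A"
  by (intro eq_matI) auto

lemma entries_in_const_mat: "coeff_ring R \<Longrightarrow> entries_in R (const_mat A)"
  by (simp add: entries_in_def coeff_ring_def)

lemma transpose_const_mat: "transpose_mat (const_mat A) = const_mat (transpose_mat A)"
  by (intro eq_matI) auto

lemma K_const_mat: 
  assumes k: "k \<in> K l" shows "const_mat k \<in> carrier (GK l)"
proof -
  note c = K_carrier[OF k]
  have "const_mat k * J l * transpose_mat (twist (const_mat k)) = const_mat (k * J l * transpose_mat k)"
    using c by (simp add: twist_const_mat transpose_const_mat const_mat_mult[of _ "2*l" "2*l" _ "2*l"] 
        const_mat_J mult_carrier_mat[of _ "2*l" "2*l" _ "2*l"] del: assoc_mult_mat)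
  also have "\<dots> = J l" using k by (simp add: K_iff const_mat_J)
  finally show ?thesis using k by (simp add: carrier_GK_iff K_iff det_const_mat)
qed

lemma K_const_mat_GO: "k \<in> K l \<Longrightarrow> const_mat k \<in> GO l"
  by (simp add: GO_iff K_const_mat entries_in_const_mat coeff_ring_\<O>)

lemma K_const_mat_GOm: "k \<in> K l \<Longrightarrow> const_mat k \<in> GOm l"
  by (simp add: GOm_iff K_const_mat entries_in_const_mat coeff_ring_\<O>m)

lemma entries_in_J: "coeff_ring R \<Longrightarrow> entries_in R (J l)"
  using entries_in_const_mat[of R "J l"] by (simp add: const_mat_J)

lemma entries_in_uminus_J: "coeff_ring R \<Longrightarrow> entries_in R (- J l)"
proof -
  assume R: "coeff_ring R"
  have "const_mat (- J l) = - J l"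
    by (intro eq_matI) (auto simp: index_J fls_const_minus_one_power)
  then show ?thesis using entries_in_const_mat[OF R, of "- J l"] by simp
qed

lemma entries_in_twist_transpose: "coeff_ring R \<Longrightarrow> entries_in R A \<Longrightarrow> entries_in R (transpose_mat (twist A))"
  by (simp add: entries_in_def coeff_ring_def)

lemma entries_in_minv:
  assumes R: "coeff_ring R" and A: "A \<in> carrier (GK l)" "entries_in R A"
  shows "entries_in R (minv A)"
  unfolding GK_inverse(4)[OF A(1)]
proof (rule entries_in_mult(1)[OF R])
  show "entries_in R (J l * transpose_mat (twist A))"
    using entries_in_mult(1)[OF R J_carrier entries_in_J[OF R] _ entries_in_twist_transpose[OF R A(2)]] GK_carrier[OF A(1)] by simp
  show "J l * transpose_mat (twist A) \<in> carrier_mat (2*l) (2*l)" using GK_carrier[OF A(1)] by (auto intro!: mult_carrier_mat)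
  show "- J l \<in> carrier_mat (2*l) (2*l)" by simp
qed (rule entries_in_uminus_J[OF R])

text \<open>Evaluation at \<open>t = 0\<close> for \<open>\<O>\<close>, at infinity for
  \<open>\<O>m\<close>. Both points are fixed by \<open>t \<mapsto> -t\<close>, so the twisted
  equation specializes to the equation of \<open>K\<close>.\<close>

lemma const_coeff_in_K:
  assumes R: "coeff_ring R" and A: "A \<in> carrier (GK l)" "entries_in R A"
  shows "const_coeff A \<in> K l"
proof -
  note c = GK_carrier[OF A(1)]
  have tc: "transpose_mat (twist A) \<in> carrier_mat (2*l) (2*l)" using c by simp
  have AJ: "A * J l \<in> carrier_mat (2*l) (2*l)" "entries_in R (A * J l)" "const_coeff (A * J l) = const_coeff A * J l"
    using entries_in_mult[OF R c A(2) J_carrier entries_in_J[OF R]] c const_coeff_const_mat[of "J l"]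
    by (auto simp: const_mat_J intro!: mult_carrier_mat)
  have "const_coeff (transpose_mat (twist A)) = transpose_mat (const_coeff A)"
    by (intro eq_matI) (auto simp: neg_var_nth)
  then have "const_coeff A * J l * transpose_mat (const_coeff A) = const_coeff (A * J l * transpose_mat (twist A))"
    using entries_in_mult(2)[OF R AJ(1,2) tc entries_in_twist_transpose[OF R A(2)]] AJ(3) by simp
  also have "\<dots> = J l"
    using A(1) const_coeff_const_mat[of "J l"] by (simp add: carrier_GK_iff const_mat_J)
  finally show ?thesis
    using c det_const_coeff[OF R c A(2)] A(1) by (simp add: K_iff carrier_GK_iff)
qed

lemma GO_GK: "A \<in> GO l \<Longrightarrow> A \<in> carrier (GK l)" and GOm_GK: "A \<in> GOm l \<Longrightarrow> A \<in> carrier (GK l)"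
  by (simp_all add: GO_iff GOm_iff)

lemma GO_mult: "A \<in> GO l \<Longrightarrow> B \<in> GO l \<Longrightarrow> A * B \<in> GO l"
  unfolding GO_iff using entries_in_mult(1)[OF coeff_ring_\<O> GK_carrier _ GK_carrier] GK_mult by blast

lemma GOm_mult: "A \<in> GOm l \<Longrightarrow> B \<in> GOm l \<Longrightarrow> A * B \<in> GOm l"
  unfolding GOm_iff using entries_in_mult(1)[OF coeff_ring_\<O>m GK_carrier _ GK_carrier] GK_mult by blast

lemma GO_inverse: "A \<in> GO l \<Longrightarrow> minv A \<in> GO l"
  unfolding GO_iff using entries_in_minv[OF coeff_ring_\<O>] GK_inverse(1) by blast

lemma GOm_inverse: "A \<in> GOm l \<Longrightarrow> minv A \<in> GOm l"
  unfolding GOm_iff using entries_in_minv[OF coeff_ring_\<O>m] GK_inverse(1) by blast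

lemma GO_one: "1\<^sub>m (2*l) \<in> GO l"
  using K_const_mat_GO[OF K_one[of l]] by (simp add: const_mat_one)

lemma GK_assoc: 
  "A \<in> carrier (GK l) \<Longrightarrow> B \<in> carrier (GK l) \<Longrightarrow> C \<in> carrier (GK l) \<Longrightarrow> A * B * C = A * (B * C)"
  using GK_carrier by (simp add: assoc_mult_mat[of _ "2*l" "2*l" _ "2*l" _ "2*l"])

lemma GK_one_mult: "A \<in> carrier (GK l) \<Longrightarrow> 1\<^sub>m (2*l) * A = A" "A \<in> carrier (GK l) \<Longrightarrow> A * 1\<^sub>m (2*l) = A"
  using GK_carrier by (simp_all add: left_mult_one_mat[of _ "2*l" "2*l"] right_mult_one_mat[of _ "2*l" "2*l"])

section \<open>Cosets and their representatives\<close>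

lemma l_coset_GK: "g <#\<^bsub>GK l\<^esub> S = (\<lambda>h. g * h) ` S"
  by (auto simp: l_coset_def GK_def)

lemma coset_mult_GO:
  assumes g: "g \<in> carrier (GK l)" and y: "y \<in> GO l"
  shows "(\<lambda>h. g * y * h) ` GO l = (\<lambda>h. g * h) ` GO l"
proof (intro equalityI image_subsetI)
  fix h assume h: "h \<in> GO l"
  then show "g * y * h \<in> (\<lambda>h. g * h) ` GO l"
    using GK_assoc[OF g GO_GK[OF y] GO_GK[OF h]] GO_mult[OF y h] by auto
  have "g * h = g * ((y * minv y) * h)"
    using GK_inverse(2)[OF GO_GK[OF y]] GK_one_mult(1)[OF GO_GK[OF h]] by simp
  also have "\<dots> = g * y * (minv y * h)"
    using GK_assoc[OF GO_GK[OF y] GO_GK[OF GO_inverse[OF y]] GO_GK[OF h]]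
      GK_assoc[OF g GO_GK[OF y] GO_GK[OF GO_mult[OF GO_inverse[OF y] h]]] by simp
  finally show "g * h \<in> (\<lambda>h. g * y * h) ` GO l" using GO_mult[OF GO_inverse[OF y] h] by blast
qed

text \<open>Two representatives differ by an \<open>h\<close> with entries both in
  \<open>\<O>\<close> and in \<open>\<O>m\<close>. Such an \<open>h\<close> is constant, and
  comparing constant terms shows that it is the identity.\<close>

lemma rep_eqI:
  assumes g: "g \<in> GOm0 l" and c: "c = (\<lambda>h. g * h) ` GO l"
  shows "rep l c = g"
  unfolding rep_def
proof (rule the_equality)
  have gm: "g \<in> GOm l" "const_coeff g = 1\<^sub>m (2*l)" using g by (auto simp: GOm0_def)
  have "g * 1\<^sub>m (2*l) \<in> c" unfolding c using GO_one by (rule imageI)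
  then show "g \<in> c \<and> g \<in> GOm0 l" using g unfolding GK_one_mult(2)[OF GOm_GK[OF gm(1)]] by blast
  fix g' assume "g' \<in> c \<and> g' \<in> GOm0 l"
  then obtain h where h: "h \<in> GO l" "g' = g * h" and g': "g' \<in> GOm l" "const_coeff g' = 1\<^sub>m (2*l)"
    using c by (auto simp: GOm0_def)
  have hc: "h \<in> carrier_mat (2*l) (2*l)" using h GO_GK GK_carrier by blast
  have "minv g * g' = (minv g * g) * h"
    unfolding h(2) by (rule GK_assoc[OF GK_inverse(1)[OF GOm_GK[OF gm(1)]] GOm_GK[OF gm(1)] GO_GK[OF h(1)], symmetric])
  also have "\<dots> = h" using GK_inverse(3)[OF GOm_GK[OF gm(1)]] GK_one_mult(1)[OF GO_GK[OF h(1)]] by simp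
  finally have hm: "h \<in> GOm l" using GOm_mult[OF GOm_inverse[OF gm(1)] g'(1)] by simp
  have hconst: "h = const_mat (const_coeff h)"
  proof (rule eq_matI)
    fix i j assume "i < dim_row (const_mat (const_coeff h))" "j < dim_col (const_mat (const_coeff h))"
    then have ij: "i < dim_row h" "j < dim_col h" by auto
    then have "h $$ (i,j) \<in> \<O>" "h $$ (i,j) \<in> \<O>m" using h(1) hm by (auto simp: GO_iff GOm_iff entries_in_def)
    then have "h $$ (i,j) = fls_const (fls_nth (h $$ (i,j)) 0)"
      unfolding \<O>_def \<O>m_def fls_eq_iff by (metis (mono_tags, lifting) fls_const_nth linorder_neqE_linordered_idom mem_Collect_eq)
    moreover have "const_mat (const_coeff h) $$ (i,j) = fls_const (fls_nth (h $$ (i,j)) 0)" using ij by simp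
    ultimately show "h $$ (i,j) = const_mat (const_coeff h) $$ (i,j)" by simp
  qed auto
  have "const_coeff g' = const_coeff g * const_coeff h"
    using entries_in_mult(2)[OF coeff_ring_\<O>m GK_carrier[OF GOm_GK[OF gm(1)]] _ hc] gm(1) hm h(2) by (simp add: GOm_iff)
  then have h1: "const_coeff h = 1\<^sub>m (2*l)" using gm(2) g'(2) hc by simp
  have "h = 1\<^sub>m (2*l)" using hconst unfolding h1 const_mat_one .
  then show "g' = g" unfolding h(2) by (simp only: GK_one_mult(2)[OF GOm_GK[OF gm(1)]])
qed

text \<open>The value at infinity lies in \<open>K\<close>, and constant matrices from
  \<open>K\<close> lie in \<open>GO\<close> as well as in \<open>GOm\<close>, so its inverse may be
  multiplied from the right without changing the coset.\<close>

lemma GOm0_normalize: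
  assumes g: "g \<in> GOm l"
  shows "\<exists>y\<in>GO l. g * y \<in> GOm0 l"
proof -
  have k: "const_coeff g \<in> K l" using const_coeff_in_K[OF coeff_ring_\<O>m] g by (simp add: GOm_iff)
  let ?y = "const_mat (minv (const_coeff g))"
  note k' = K_inverse[OF k]
  have "const_coeff (g * ?y) = const_coeff g * const_coeff ?y"
    using entries_in_mult(2)[OF coeff_ring_\<O>m GK_carrier[OF GOm_GK[OF g]] _ GK_carrier[OF K_const_mat[OF k'(1)]] entries_in_const_mat[OF coeff_ring_\<O>m]] g
    by (simp add: GOm_iff)
  also have "\<dots> = 1\<^sub>m (2*l)" unfolding const_coeff_const_mat by (rule k'(2))
  finally have "g * ?y \<in> GOm0 l" using GOm_mult[OF g K_const_mat_GOm[OF k'(1)]] by (simp add: GOm0_def)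
  then show ?thesis using K_const_mat_GO[OF k'(1)] by blast
qed

section \<open>The loop group elements \<open>1 + s x\<close>\<close>

text \<open>The parameter \<open>s\<close> is kept free because \<open>t^(-1)\<close>,
  \<open>t\<close> and their negatives all occur: the first represents points, the others enter the
  factorization of the normal form and the inverses.\<close>

definition unip :: "nat \<Rightarrow> complex fls \<Rightarrow> complex mat \<Rightarrow> complex fls mat" where
  "unip l s x = 1\<^sub>m (2*l) + s \<cdot>\<^sub>m const_mat x"

lemma unip_carrier: "x \<in> carrier_mat (2*l) (2*l) \<Longrightarrow> unip l s x \<in> carrier_mat (2*l) (2*l)"
  by (simp add: unip_def)

lemma unip_index:
  "x \<in> carrier_mat (2*l) (2*l) \<Longrightarrow> i < 2*l \<Longrightarrow> j < 2*l \<Longrightarrow>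
   unip l s x $$ (i,j) = (if i = j then 1 else 0) + s * fls_const (x $$ (i,j))"
  by (simp add: unip_def)

lemma unip_uminus_inverse:
  assumes x: "x \<in> carrier_mat (2*l) (2*l)" and xx: "x * x = 0\<^sub>m (2*l) (2*l)"
  shows "unip l s x * unip l (- s) x = 1\<^sub>m (2*l)"
proof -
  let ?n = "2*l" let ?X = "const_mat x"
  have Xc: "?X \<in> carrier_mat ?n ?n" using x by simp
  have XX: "?X * ?X = 0\<^sub>m ?n ?n" unfolding const_mat_mult[OF x x, symmetric] xx by (intro eq_matI) auto
  have "unip l s x * unip l (- s) x = (1\<^sub>m ?n + s \<cdot>\<^sub>m ?X) * 1\<^sub>m ?n + (1\<^sub>m ?n + s \<cdot>\<^sub>m ?X) * ((- s) \<cdot>\<^sub>m ?X)"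
    unfolding unip_def using Xc by (intro mult_add_distrib_mat[of _ ?n ?n _ ?n]) auto
  also have "(1\<^sub>m ?n + s \<cdot>\<^sub>m ?X) * ((- s) \<cdot>\<^sub>m ?X) = 1\<^sub>m ?n * ((- s) \<cdot>\<^sub>m ?X) + (s \<cdot>\<^sub>m ?X) * ((- s) \<cdot>\<^sub>m ?X)"
    using Xc by (intro add_mult_distrib_mat[of _ ?n ?n _ _ ?n]) auto
  also have "(s \<cdot>\<^sub>m ?X) * ((- s) \<cdot>\<^sub>m ?X) = s \<cdot>\<^sub>m ((- s) \<cdot>\<^sub>m (?X * ?X))"
    using mult_smult_assoc_mat[OF Xc smult_carrier_mat[OF Xc], of s "-s"] mult_smult_distrib[OF Xc Xc, of "-s"] by simp
  finally show ?thesis using Xc unfolding XX by (intro eq_matI) auto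
qed

text \<open>Self-adjointness moves \<open>1 + s x\<close> across \<open>J\<close>, turning
  \<open>x\<close> into its transpose. The twist changes \<open>s\<close> to \<open>-s\<close>, so
  the remaining factor is the inverse, because \<open>x\<close> has square zero.\<close>

lemma unip_twisted:
  assumes x: "self_adjoint_sq0 l x" and s: "neg_var s = - s"
  shows "unip l s x * J l * transpose_mat (twist (unip l s x)) = J l"
proof -
  let ?n = "2*l" let ?X = "const_mat x"
  have xc: "x \<in> carrier_mat ?n ?n" and xJ: "x * J l = J l * transpose_mat x" and xx: "x * x = 0\<^sub>m ?n ?n"
    using x by (auto simp: self_adjoint_sq0_def)
  have XJ: "?X * J l = J l * transpose_mat ?X"
    using arg_cong[OF xJ, of const_mat] xc by (simp add: const_mat_mult[of _ ?n ?n _ ?n] const_mat_J transpose_const_mat)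
  have t: "transpose_mat (twist (unip l s x)) = unip l (- s) (transpose_mat x)"
    using xc by (intro eq_matI) (auto simp: unip_def s fls_compose_fps_add fls_compose_fps_mult)
  have "unip l s x * J l = 1\<^sub>m ?n * J l + (s \<cdot>\<^sub>m ?X) * J l"
    unfolding unip_def using xc by (intro add_mult_distrib_mat[of _ ?n ?n _ _ ?n]) auto
  also have "(s \<cdot>\<^sub>m ?X) * J l = s \<cdot>\<^sub>m (J l * transpose_mat ?X)"
    unfolding XJ[symmetric] using xc by (intro mult_smult_assoc_mat[of _ ?n ?n _ ?n]) auto
  also have "\<dots> = J l * (s \<cdot>\<^sub>m transpose_mat ?X)"
    using xc by (intro mult_smult_distrib[symmetric, of _ ?n ?n _ ?n]) auto
  also have "1\<^sub>m ?n * J l + J l * (s \<cdot>\<^sub>m transpose_mat ?X) = J l * unip l s (transpose_mat x)"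
    unfolding unip_def transpose_const_mat using xc by (subst mult_add_distrib_mat[of _ ?n ?n _ ?n]) auto
  finally have 1: "unip l s x * J l = J l * unip l s (transpose_mat x)" .
  have "transpose_mat x * transpose_mat x = 0\<^sub>m ?n ?n"
    using transpose_mult[OF xc xc] xx by simp
  then have "unip l s (transpose_mat x) * unip l (- s) (transpose_mat x) = 1\<^sub>m ?n"
    using xc by (intro unip_uminus_inverse) auto
  then show ?thesis
    unfolding 1 t using xc unip_carrier[of "transpose_mat x" l]
    by (subst assoc_mult_mat[OF J_carrier]) (auto intro: right_mult_one_mat[OF J_carrier])
qed

lemma unip_conj:
  assumes x: "x \<in> carrier_mat (2*l) (2*l)" and k: "k \<in> K l"
  shows "unip l s (k * x * minv k) = const_mat k * unip l s x * const_mat (minv k)"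
proof -
  let ?n = "2*l" let ?X = "const_mat x" let ?k = "const_mat k" let ?k' = "const_mat (minv k)"
  have c: "k \<in> carrier_mat ?n ?n" "minv k \<in> carrier_mat ?n ?n" using K_carrier[OF k] K_carrier[OF K_inverse(1)[OF k]] by auto
  have "?k * unip l s x = ?k * 1\<^sub>m ?n + ?k * (s \<cdot>\<^sub>m ?X)"
    unfolding unip_def using x c by (intro mult_add_distrib_mat[of _ ?n ?n _ ?n]) auto
  then have "?k * unip l s x * ?k' = (?k * 1\<^sub>m ?n + s \<cdot>\<^sub>m (?k * ?X)) * ?k'"
    using x c by (simp add: mult_smult_distrib[of _ ?n ?n _ ?n])
  also have "\<dots> = (?k * 1\<^sub>m ?n) * ?k' + (s \<cdot>\<^sub>m (?k * ?X)) * ?k'"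
    using x c by (intro add_mult_distrib_mat[of _ ?n ?n _ _ ?n]) (auto intro!: mult_carrier_mat)
  also have "(s \<cdot>\<^sub>m (?k * ?X)) * ?k' = s \<cdot>\<^sub>m (?k * ?X * ?k')"
    using x c by (intro mult_smult_assoc_mat[of _ ?n ?n _ ?n]) (auto intro!: mult_carrier_mat)
  also have "?k * ?X * ?k' = const_mat (k * x * minv k)"
    using x c by (simp add: const_mat_mult[of _ ?n ?n _ ?n] mult_carrier_mat[of _ ?n ?n _ ?n] del: assoc_mult_mat)
  also have "(?k * 1\<^sub>m ?n) * ?k' = const_mat (k * minv k)"
    using c by (simp add: const_mat_mult[of _ ?n ?n _ ?n])
  also have "\<dots> = 1\<^sub>m ?n" unfolding K_inverse(2)[OF k] by (rule const_mat_one)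
  finally show ?thesis by (simp add: unip_def)
qed

text \<open>Conjugation reduces to the normal form, which is strictly lower triangular: it sends
  indices below \<open>2*j\<close> to indices at least \<open>2*l - 2*j\<close>.\<close>

lemma det_unip:
  assumes x: "self_adjoint_sq0 l x"
  shows "det (unip l s x) = 1"
proof -
  let ?n = "2*l"
  obtain j k where j: "2*j \<le> l" and k: "k \<in> K l" and eq: "x = k * std_nilpotent l j * minv k"
    using self_adjoint_sq0_conj_std[OF x] by blast
  let ?S = "std_nilpotent l j :: complex mat" let ?U = "unip l s ?S"
  have U: "?U \<in> carrier_mat ?n ?n" by (rule unip_carrier[OF std_nilpotent_carrier])
  note kc = GK_carrier[OF K_const_mat[OF k]] GK_carrier[OF K_const_mat[OF K_inverse(1)[OF k]]]
  have S0: "?S $$ (p,q) = 0" if "p \<le> q" "q < ?n" for p q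
  proof -
    have "\<not> (q < 2*j \<and> p + flip q + 1 = ?n)" using that j flip_less[of q j] by auto
    then show ?thesis using that by (subst std_nilpotent_index) auto
  qed
  have "det ?U = prod_list (diag_mat ?U)"
  proof (rule det_lower_triangular[OF _ U])
    fix p q assume "p < q" "q < ?n"
    then show "?U $$ (p,q) = 0" using S0[of p q] by (subst unip_index[OF std_nilpotent_carrier]) auto
  qed
  also have "\<dots> = (\<Prod>i=0..<?n. ?U $$ (i,i))" using U by (simp add: prod_list_diag_prod)
  also have "\<dots> = 1"
  proof (rule prod.neutral, rule ballI)
    fix i assume "i \<in> {0..<?n}"
    then show "?U $$ (i,i) = 1" using S0[of i i] by (subst unip_index[OF std_nilpotent_carrier]) auto
  qed
  finally have dU: "det ?U = 1" .
  have "det (unip l s x) = det (const_mat k * ?U * const_mat (minv k))"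
    unfolding eq by (simp only: unip_conj[OF std_nilpotent_carrier k])
  also have "\<dots> = det (const_mat k) * det ?U * det (const_mat (minv k))"
    by (simp only: det_mult[OF mult_carrier_mat[OF kc(1) U] kc(2)] det_mult[OF kc(1) U])
  also have "\<dots> = 1" using dU K_const_mat[OF k] K_const_mat[OF K_inverse(1)[OF k]] by (simp add: carrier_GK_iff)
  finally show ?thesis .
qed

lemma unip_GK: "self_adjoint_sq0 l x \<Longrightarrow> neg_var s = - s \<Longrightarrow> unip l s x \<in> carrier (GK l)"
  using unip_carrier[of x l s] unip_twisted[of l x s] det_unip[of l x s] by (simp add: carrier_GK_iff self_adjoint_sq0_def)

lemma neg_var_X: "neg_var fls_X = - fls_X" "neg_var fls_X_inv = - fls_X_inv"
  by (intro fls_eqI, auto simp: neg_var_nth fls_X_nth fls_X_inv_nth)+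

lemma unip_pos_GO: "self_adjoint_sq0 l x \<Longrightarrow> unip l fls_X x \<in> GO l"
proof -
  assume x: "self_adjoint_sq0 l x"
  have xc: "x \<in> carrier_mat (2*l) (2*l)" using x by (simp add: self_adjoint_sq0_def)
  have "entries_in \<O> (unip l fls_X x)"
    using xc unip_carrier[OF xc, of "fls_X"] 
    by (auto simp: entries_in_def unip_index[OF xc] \<O>_def fls_X_times_conv_shift)
  then show ?thesis using unip_GK[OF x neg_var_X(1)] by (simp add: GO_iff)
qed

lemma unip_neg_index:
  assumes "x \<in> carrier_mat (2*l) (2*l)" "i < 2*l" "j < 2*l"
  shows "fls_nth (unip l fls_X_inv x $$ (i,j)) n = 
    (if n = 0 then (if i = j then 1 else 0) else if n = -1 then x $$ (i,j) else 0)"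
  using assms by (auto simp: unip_index fls_X_inv_times_conv_shift)

lemma unip_neg_GOm0: "self_adjoint_sq0 l x \<Longrightarrow> unip l fls_X_inv x \<in> GOm0 l"
proof -
  assume x: "self_adjoint_sq0 l x"
  have xc: "x \<in> carrier_mat (2*l) (2*l)" using x by (simp add: self_adjoint_sq0_def)
  note Uc = unip_carrier[OF xc, of "fls_X_inv"]
  have "entries_in \<O>m (unip l fls_X_inv x)"
    using Uc by (auto simp: entries_in_def \<O>m_def unip_neg_index[OF xc])
  moreover have "const_coeff (unip l fls_X_inv x) = 1\<^sub>m (2*l)"
    using Uc by (intro eq_matI) (auto simp: unip_neg_index[OF xc])
  ultimately show ?thesis using unip_GK[OF x neg_var_X(2)] by (simp add: GOm0_def GOm_iff)
qed

section \<open>The strata\<close>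

lemma mat_diag_index: "i < n \<Longrightarrow> j < n \<Longrightarrow> mat_diag n f $$ (i,j) = (if i = j then f j else 0)"
  by (simp add: mat_diag_def)

lemma dim_mat_diag: "dim_row (mat_diag n f) = n" "dim_col (mat_diag n f) = n"
  by (simp_all add: mat_diag_def)

lemma det_mat_diag: "det (mat_diag n f) = (\<Prod>i<n. f i :: 'a::comm_ring_1)"
proof -
  have "det (mat_diag n f) = prod_list (diag_mat (mat_diag n f))"
    by (rule det_upper_triangular[OF _ mat_diag_dim]) (auto simp: upper_triangular_def mat_diag_index dim_mat_diag)
  also have "\<dots> = (\<Prod>i=0..<n. mat_diag n f $$ (i,i))" by (simp add: prod_list_diag_prod dim_mat_diag)
  also have "\<dots> = (\<Prod>i=0..<n. f i)" by (intro prod.cong) (auto simp: mat_diag_index)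
  finally show ?thesis by (simp add: atLeast0LessThan)
qed

lemma mat_diag_J:
  assumes "\<And>i. i < 2*l \<Longrightarrow> f i * g (2*l - Suc i) = (1 :: 'a::field)"
  shows "mat_diag (2*l) f * J l * transpose_mat (mat_diag (2*l) g) = J l"
proof -
  have t: "transpose_mat (mat_diag (2*l) g) = mat_diag (2*l) g"
    by (intro eq_matI) (auto simp: mat_diag_index dim_mat_diag)
  have fg: "f i * g j = 1" if "i < 2*l" "i + j = 2*l - 1" for i j
  proof -
    have "j = 2*l - Suc i" using that by auto
    then show ?thesis using assms[OF that(1)] by simp
  qed
  show ?thesis unfolding t mat_diag_mult_left[OF J_carrier]
    by (subst mat_diag_mult_right[of _ "2*l"]) (auto intro!: eq_matI fg simp: index_J simp del: One_nat_def)
qed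

lemma twist_mat_diag: "twist (mat_diag n f) = mat_diag n (\<lambda>i. neg_var (f i))"
  by (intro eq_matI) (auto simp: mat_diag_index dim_mat_diag)

lemma neg_var_neg_var: "neg_var (neg_var f) = f"
  by (intro fls_eqI) (simp add: neg_var_nth mult.assoc flip: power_int_mult_distrib)

lemma neg_var_inverse: "neg_var (inverse f) = inverse (neg_var f)"
  by (rule fls_compose_fps_inverse) (simp_all add: fps_neg_nth)

lemma neg_var_nonzero: "f \<noteq> 0 \<Longrightarrow> neg_var f \<noteq> 0"
  using fls_compose_fps_eq_0_iff[of "- fps_X" f] by simp

lemma loop_sigma_mat_diag:
  assumes "\<And>i. i < 2*l \<Longrightarrow> f i \<noteq> 0"
  shows "loop_sigma l (mat_diag (2*l) f) = mat_diag (2*l) (\<lambda>i. inverse (neg_var (f (2*l - Suc i))))"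
  unfolding loop_sigma_def twist_mat_diag
proof (subst sigma_eq_iff[OF mat_diag_dim mat_diag_dim])
  show "det (mat_diag (2*l) (\<lambda>i. neg_var (f i))) \<noteq> 0"
    unfolding det_mat_diag using assms neg_var_nonzero by (simp add: prod_zero_iff)
  show "mat_diag (2*l) (\<lambda>i. inverse (neg_var (f (2*l - Suc i)))) * J l *
      transpose_mat (mat_diag (2*l) (\<lambda>i. neg_var (f i))) = J l"
  proof (rule mat_diag_J)
    fix i assume "i < 2*l"
    then have "2*l - Suc i < 2*l" by simp
    from neg_var_nonzero[OF assms[OF this]]
    show "inverse (neg_var (f (2*l - Suc i))) * neg_var (f (2*l - Suc i)) = 1" by simp
  qed
qed

definition n_entry :: "nat \<Rightarrow> int list \<Rightarrow> nat \<Rightarrow> complex fls" where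
  "n_entry l b i = fls_X_intpow (b ! i) * inverse (neg_var (fls_X_intpow (b ! (2*l - Suc i))))"

lemma n_elt_diag: "n_elt l b = mat_diag (2*l) (n_entry l b)"
  unfolding n_elt_def t_pow_def n_entry_def[abs_def]
  by (subst loop_sigma_mat_diag) auto

text \<open>The exponent depends only on the class of \<open>b\<close> in the coinvariants; the
  choice of the lift shows only in the sign.\<close>

lemma n_entry_monomial:
  "n_entry l b i = fls_const ((-1) powi (b ! (2*l - Suc i))) * fls_X_intpow (b ! i - b ! (2*l - Suc i))"
proof -
  let ?c = "b ! (2*l - Suc i)"
  have nv: "neg_var (fls_X_intpow m) = fls_const ((-1) powi m) * fls_X_intpow m" for m
    by (intro fls_eqI) (auto simp: neg_var_nth)
  have sq: "fls_const ((-1) powi m) * fls_const ((-1) powi m) = (1 :: complex fls)" for m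
    by (simp flip: power_int_mult_distrib)
  have "neg_var (fls_X_intpow ?c) * (fls_const ((-1) powi ?c) * fls_X_intpow (- ?c)) =
      (fls_const ((-1) powi ?c) * fls_const ((-1) powi ?c)) * (fls_X_intpow ?c * fls_X_intpow (- ?c))"
    unfolding nv by (simp only: mult_ac)
  also have "\<dots> = 1" unfolding sq fls_X_intpow_times_fls_X_intpow by simp
  finally have "inverse (neg_var (fls_X_intpow ?c)) = fls_const ((-1) powi ?c) * fls_X_intpow (- ?c)"
    by (rule inverse_unique)
  then have "n_entry l b i = fls_const ((-1) powi ?c) * (fls_X_intpow (b ! i) * fls_X_intpow (- ?c))"
    unfolding n_entry_def by (simp only: mult_ac)
  also have "fls_X_intpow (b ! i) * fls_X_intpow (- ?c) = (fls_X_intpow (b ! i - ?c) :: complex fls)"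
    unfolding fls_X_intpow_times_fls_X_intpow by simp
  finally show ?thesis .
qed

text \<open>The determinant is 1 because the entries of \<open>b\<close> sum to 0. In the twisted
  equation entry \<open>i\<close> meets the twist of the entry at the opposite index, and their
  product cancels because the twist is an involution.\<close>

lemma n_elt_GK:
  assumes b: "b \<in> cocharacters l"
  shows "n_elt l b \<in> carrier (GK l)"
proof -
  let ?u = "\<lambda>i. fls_X_intpow (b ! i) :: complex fls"
  have len: "length b = 2*l" and sb: "sum_list b = 0" using b by (auto simp: cocharacters_def)
  have "(\<Prod>i<m. ?u i) = fls_X_intpow (\<Sum>i<m. b ! i)" for m
    by (induction m) (simp_all only: prod.lessThan_Suc sum.lessThan_Suc fls_X_intpow_times_fls_X_intpow, simp)
  moreover have "(\<Sum>i<2*l. b ! i) = 0" using sb len by (simp add: sum_list_sum_nth atLeast0LessThan)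
  ultimately have P: "(\<Prod>i<2*l. ?u i) = 1" by simp
  have "det (n_elt l b) = (\<Prod>i<2*l. ?u i) * inverse (neg_var (\<Prod>i<2*l. ?u (2*l - Suc i)))"
  proof -
    interpret comm_ring_hom neg_var by (rule neg_var_hom)
    show ?thesis unfolding n_elt_diag det_mat_diag n_entry_def prod.distrib
      by (simp only: hom_prod prod_inversef[symmetric] o_def)
  qed
  also have "(\<Prod>i<2*l. ?u (2*l - Suc i)) = (\<Prod>i<2*l. ?u i)" by (rule prod.nat_diff_reindex)
  finally have d: "det (n_elt l b) = 1" by (simp add: P)
  have "n_elt l b * J l * transpose_mat (twist (n_elt l b)) = J l"
    unfolding n_elt_diag twist_mat_diag
  proof (rule mat_diag_J)
    fix i assume i: "i < 2*l"
    let ?i = "2*l - Suc i"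
    have ii: "2*l - Suc ?i = i" using i by simp
    have "n_entry l b i * neg_var (n_entry l b ?i) = 
        ?u i * inverse (neg_var (?u ?i)) * (neg_var (?u ?i) * inverse (neg_var (neg_var (?u i))))"
      unfolding n_entry_def ii by (simp add: fls_compose_fps_mult neg_var_inverse)
    also have "\<dots> = (?u i * inverse (?u i)) * (neg_var (?u ?i) * inverse (neg_var (?u ?i)))"
      unfolding neg_var_neg_var by (simp only: mult_ac)
    also have "\<dots> = 1" using neg_var_nonzero[of "?u ?i"] by simp
    finally show "n_entry l b i * neg_var (n_entry l b ?i) = 1" .
  qed
  then show ?thesis using d by (simp add: carrier_GK_iff n_elt_diag)
qed

text \<open>\<open>coinv\<close> prescribes the exponents for \<open>i < l\<close>; the others
  follow because exchanging \<open>i\<close> with the opposite index negates the exponent. The sign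
  from the lift is absorbed into \<open>e\<close>.\<close>

lemma n_entry_cases:
  assumes c: "coinv l b = ones_zeros l j" and j: "2*j \<le> l" and i: "i < 2*l"
  shows "\<exists>e. e \<noteq> 0 \<and> n_entry l b i = fls_const e * (if i < 2*j then fls_X else if i < 2*l - 2*j then 1 else fls_X_inv)"
proof -
  have a: "b ! i - b ! (2*l - Suc i) = (if i < 2*j then 1 else 0)" if "i < l" for i
    using arg_cong[OF c, of "\<lambda>xs. xs ! i"] that j by (simp add: coinv_def ones_zeros_def nth_append)
  have "b ! i - b ! (2*l - Suc i) = (if i < 2*j then 1 else if i < 2*l - 2*j then 0 else -1)"
  proof (cases "i < l")
    case True
    then show ?thesis using a[OF True] j by auto
  next
    case False
    then have "2*l - Suc i < l" "2*l - Suc (2*l - Suc i) = i" using i by auto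
    then have "b ! (2*l - Suc i) - b ! i = (if 2*l - Suc i < 2*j then 1 else 0)" using a[of "2*l - Suc i"] by simp
    moreover have "2*l - Suc i < 2*j \<longleftrightarrow> \<not> i < 2*l - 2*j" "\<not> i < 2*j" using False i j by auto
    ultimately show ?thesis by (auto split: if_splits)
  qed
  then have "n_entry l b i = fls_const ((-1) powi (b ! (2*l - Suc i))) * (if i < 2*j then fls_X else if i < 2*l - 2*j then 1 else fls_X_inv)"
    unfolding n_entry_monomial by (simp add: fls_X_conv_shift_1 fls_X_inv_conv_shift_1)
  then show ?thesis by (intro exI[of _ "(-1) powi (b ! (2*l - Suc i))"]) simp
qed

section \<open>Factorization of the normal form\<close>

lemma self_adjoint_sq0_transpose:
  assumes x: "self_adjoint_sq0 l x" shows "self_adjoint_sq0 l (transpose_mat x)"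
proof -
  have xc: "x \<in> carrier_mat (2*l) (2*l)" and xJ: "x * J l = J l * transpose_mat x" and xx: "x * x = 0\<^sub>m (2*l) (2*l)"
    using x by (auto simp: self_adjoint_sq0_def)
  have "transpose_mat x * transpose_mat x = 0\<^sub>m (2*l) (2*l)" unfolding transpose_mult[OF xc xc, symmetric] xx by simp
  then show ?thesis using adjoint_left[OF xc xJ] xc by (simp add: self_adjoint_sq0_def)
qed

lemma fls_X_times_fls_X_inv: "fls_X * fls_X_inv = (1 :: complex fls)" "fls_X_inv * fls_X = (1 :: complex fls)"
  by (simp_all add: fls_X_times_conv_shift)

text \<open>The normal form \<open>S\<close> maps the first \<open>2*j\<close> unit vectors to
  distinct unit vectors and kills the others, so \<open>S^T S\<close> is the projection to the first
  \<open>2*j\<close> coordinates. It is the cross term in the product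
  \<open>(1 - t S^T) (1 + t^(-1) S)\<close>.\<close>

lemma std_nilpotent_gram:
  assumes j: "2*j \<le> l" and pc: "p < 2*l" "c < 2*l"
  shows "(\<Sum>q<2*l. std_nilpotent l j $$ (q,p) * std_nilpotent l j $$ (q,c)) = (if p = c \<and> p < 2*j then 1 else (0::complex))"
proof -
  let ?S = "std_nilpotent l j :: complex mat"
  show ?thesis
  proof (cases "p < 2*j")
    case True
    have fp: "flip p < 2*j" using True by (simp add: flip_less)
    have S: "?S $$ (q,p) = (if q = 2*l - 1 - flip p then 1 else 0)" if "q < 2*l" for q
      using that True pc fp j by (subst std_nilpotent_index) auto
    have "(\<Sum>q<2*l. ?S $$ (q,p) * ?S $$ (q,c)) = (\<Sum>q<2*l. if q = 2*l - 1 - flip p then ?S $$ (q,c) else 0)"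
      by (intro sum.cong) (auto simp: S)
    also have "\<dots> = ?S $$ (2*l - 1 - flip p, c)" using pc by simp
    also have "\<dots> = (if p = c then 1 else 0)"
    proof -
      have "c < 2*j \<and> 2*l - 1 - flip p + flip c + 1 = 2*l \<longleftrightarrow> p = c"
      proof
        assume "c < 2*j \<and> 2*l - 1 - flip p + flip c + 1 = 2*l"
        then have "flip c = flip p" using fp j by linarith
        then show "p = c" by (metis flip_flip)
      qed (use True fp j in auto)
      then show ?thesis using pc by (subst std_nilpotent_index) auto
    qed
    finally show ?thesis using True by simp
  next
    case False
    then show ?thesis using pc by (auto intro!: sum.neutral simp: std_nilpotent_index)
  qed
qed

lemma unip_product_index:
  assumes x: "x \<in> carrier_mat (2*l) (2*l)" and y: "y \<in> carrier_mat (2*l) (2*l)" and pc: "p < 2*l" "c < 2*l"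
  shows "(unip l (- fls_X) y * unip l fls_X_inv x) $$ (p,c) = (if p = c then 1 else 0) + fls_X_inv * fls_const (x $$ (p,c))
    - fls_X * fls_const (y $$ (p,c)) - fls_const (\<Sum>q<2*l. y $$ (p,q) * x $$ (q,c))"
proof -
  let ?\<delta> = "\<lambda>a b. if a = (b::nat) then 1 else (0 :: complex fls)"
  have "(unip l (- fls_X) y * unip l fls_X_inv x) $$ (p,c) =
    (\<Sum>q<2*l. unip l (- fls_X) y $$ (p,q) * unip l fls_X_inv x $$ (q,c))"
    using pc unip_carrier[OF x, of fls_X_inv] unip_carrier[OF y, of "- fls_X"]
    by (simp add: scalar_prod_def atLeast0LessThan)
  also have "\<dots> = (\<Sum>q<2*l. (if q = p then ?\<delta> q c + fls_X_inv * fls_const (x $$ (q,c)) else 0)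
     + (if q = c then - fls_X * fls_const (y $$ (p,q)) else 0) + - fls_const (y $$ (p,q) * x $$ (q,c)))"
  proof (rule sum.cong[OF refl])
    fix q assume "q \<in> {..<2*l}"
    have "fls_X * fls_const (y $$ (p,q)) * (fls_X_inv * fls_const (x $$ (q,c))) =
        (fls_X * fls_X_inv) * (fls_const (y $$ (p,q)) * fls_const (x $$ (q,c)))" by (simp only: mult_ac)
    also have "\<dots> = fls_const (y $$ (p,q) * x $$ (q,c))" unfolding fls_X_times_fls_X_inv by simp
    finally have e: "fls_X * fls_const (y $$ (p,q)) * (fls_X_inv * fls_const (x $$ (q,c))) = fls_const (y $$ (p,q) * x $$ (q,c))" .
    have "unip l (- fls_X) y $$ (p,q) * unip l fls_X_inv x $$ (q,c) =
      (?\<delta> p q - fls_X * fls_const (y $$ (p,q))) * (?\<delta> q c + fls_X_inv * fls_const (x $$ (q,c)))"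
      using \<open>q \<in> {..<2*l}\<close> pc by (simp add: unip_index[OF x] unip_index[OF y])
    also have "\<dots> = ?\<delta> p q * (?\<delta> q c + fls_X_inv * fls_const (x $$ (q,c))) - fls_X * fls_const (y $$ (p,q)) * ?\<delta> q c
        - fls_X * fls_const (y $$ (p,q)) * (fls_X_inv * fls_const (x $$ (q,c)))"
      by (simp only: algebra_simps)
    finally show "unip l (- fls_X) y $$ (p,q) * unip l fls_X_inv x $$ (q,c) =
      (if q = p then ?\<delta> q c + fls_X_inv * fls_const (x $$ (q,c)) else 0)
       + (if q = c then - fls_X * fls_const (y $$ (p,q)) else 0) + - fls_const (y $$ (p,q) * x $$ (q,c))"
      unfolding e by simp
  qed
  also have "\<dots> = ?\<delta> p c + fls_X_inv * fls_const (x $$ (p,c)) + - fls_X * fls_const (y $$ (p,c))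
      + (\<Sum>q<2*l. - fls_const (y $$ (p,q) * x $$ (q,c)))"
    using pc by (simp only: sum.distrib) simp
  also have "(\<Sum>q<2*l. - fls_const (y $$ (p,q) * x $$ (q,c))) = - fls_const (\<Sum>q<2*l. y $$ (p,q) * x $$ (q,c))"
  proof -
    interpret comm_ring_hom "fls_const :: complex \<Rightarrow> complex fls" by (rule fls_const_hom)
    show ?thesis by (simp only: hom_sum sum_negf)
  qed
  finally show ?thesis by simp
qed

text \<open>Blockwise over \<open>SL\<^sub>2\<close>: $1 + t^{-1}e_{21} = (1 + t e_{12}) \, \mathrm{diag}(t, t^{-1})
  \, (-e_{12} + e_{21} + t e_{22})$.\<close>

lemma unip_std_factor:
  assumes b: "b \<in> cocharacters l" and c: "coinv l b = ones_zeros l j" and j: "2*j \<le> l"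
  shows "\<exists>g\<in>GO l. \<exists>h\<in>GO l. unip l fls_X_inv (std_nilpotent l j) = g * n_elt l b * h"
proof -
  let ?n = "2*l" let ?S = "std_nilpotent l j :: complex mat" let ?Y = "transpose_mat ?S"
  let ?L = "unip l fls_X_inv ?S" let ?G = "unip l fls_X ?Y" let ?G' = "unip l (- fls_X) ?Y"
  have sS: "self_adjoint_sq0 l ?S" and sY: "self_adjoint_sq0 l ?Y"
    using self_adjoint_sq0_std[OF j] self_adjoint_sq0_transpose by auto
  have Sc: "?S \<in> carrier_mat ?n ?n" and Yc: "?Y \<in> carrier_mat ?n ?n" by auto
  have YY: "?Y * ?Y = 0\<^sub>m ?n ?n" using sY by (simp add: self_adjoint_sq0_def)
  have G: "?G \<in> GO l" by (rule unip_pos_GO[OF sY])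
  have "neg_var (- fls_X) = - (- fls_X)" by (intro fls_eqI) (auto simp: neg_var_nth)
  then have G': "?G' \<in> carrier (GK l)" by (rule unip_GK[OF sY])
  have L: "?L \<in> carrier (GK l)" by (rule unip_GK[OF sS neg_var_X(2)])
  have GG': "?G * ?G' = 1\<^sub>m ?n" by (rule unip_uminus_inverse[OF Yc YY])
  have n: "n_elt l b \<in> carrier (GK l)" by (rule n_elt_GK[OF b])
  let ?d = "n_entry l b" let ?W = "?G' * ?L"
  have W: "?W \<in> carrier (GK l)" by (rule GK_mult[OF G' L])
  have dnz: "?d i \<noteq> 0" if "i < ?n" for i
    using n_entry_cases[OF c j that] fls_X_times_fls_X_inv by (auto split: if_splits)
  have minv_n: "minv (n_elt l b) = mat_diag ?n (\<lambda>i. inverse (?d i))"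
    unfolding n_elt_diag
  proof (rule minv_eqI[of _ ?n])
    show "mat_diag ?n ?d * mat_diag ?n (\<lambda>i. inverse (?d i)) = 1\<^sub>m ?n"
      unfolding mat_diag_diag by (intro eq_matI) (auto simp: mat_diag_index dim_mat_diag dnz)
  qed auto
  \<comment> \<open>Once the left factor is chosen as \<open>1 + t S^T\<close>, this right factor is
    forced; only the absence of a pole at \<open>t = 0\<close> has to be checked.\<close>
  let ?H = "minv (n_elt l b) * ?W"
  have HGK: "?H \<in> carrier (GK l)" by (rule GK_mult[OF GK_inverse(1)[OF n] W])
  have OX: "fls_X \<in> \<O>" by (simp add: \<O>_def)
  have Oc: "fls_const a \<in> \<O>" for a by (simp add: \<O>_def)
  have O01: "1 \<in> \<O>" "0 \<in> \<O>" by (simp_all add: \<O>_def)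
  have Oadd: "f + g \<in> \<O>" "f * g \<in> \<O>" if "f \<in> \<O>" "g \<in> \<O>" for f g
    using coeff_ring_\<O> that unfolding coeff_ring_def by blast+
  \<comment> \<open>Up to constants, the inverse diagonal scales row \<open>p\<close> by
    \<open>t^(-1)\<close>, 1 or \<open>t\<close>. For \<open>p < 2*j\<close> the row of
    \<open>?W\<close> is divisible by \<open>t\<close>, because the diagonal entry 1 cancels against
    \<open>S^T S\<close>; the middle rows are those of the identity; the last \<open>2*j\<close>
    rows have at most a simple pole.\<close>
  have "inverse (?d p) * ?W $$ (p,q) \<in> \<O>" if pq: "p < ?n" "q < ?n" for p q
  proof -
    obtain e where e: "e \<noteq> 0" and d: "?d p = fls_const e * (if p < 2*j then fls_X else if p < ?n - 2*j then 1 else fls_X_inv)"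
      using n_entry_cases[OF c j pq(1)] by blast
    let ?i = "fls_const (inverse e)"
    have ie: "?i * fls_const e = 1" using e by simp
    have Wpq: "?W $$ (p,q) = (if p = q then 1 else 0) + fls_X_inv * fls_const (?S $$ (p,q))
      - fls_X * fls_const (?S $$ (q,p)) - fls_const (if p = q \<and> p < 2*j then 1 else 0)"
    proof -
      have "(\<Sum>r<2*l. ?Y $$ (p,r) * ?S $$ (r,q)) = (if p = q \<and> p < 2*j then 1 else 0)"
        unfolding std_nilpotent_gram[OF j pq, symmetric] using pq by (intro sum.cong) auto
      then show ?thesis unfolding unip_product_index[OF Sc Yc pq] using pq by simp
    qed
    have fq: "flip q < 2*j" if "q < 2*j" for q using that by (simp add: flip_less)
    consider "p < 2*j" | "2*j \<le> p" "p < ?n - 2*j" | "?n - 2*j \<le> p" by linarith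
    then show ?thesis
    proof cases
      case 1
      have "?S $$ (p,q) = 0" using 1 pq j fq[of q] by (subst std_nilpotent_index) auto
      then have "?W $$ (p,q) = - fls_X * fls_const (?S $$ (q,p))" using 1 unfolding Wpq by simp
      moreover have "inverse (?d p) = ?i * fls_X_inv"
      proof (rule inverse_unique)
        have "?d p * (?i * fls_X_inv) = (?i * fls_const e) * (fls_X * fls_X_inv)" unfolding d using 1 by (simp add: mult_ac del: fls_const_mult_const)
        then show "?d p * (?i * fls_X_inv) = 1" unfolding ie fls_X_times_fls_X_inv by simp
      qed
      ultimately have "inverse (?d p) * ?W $$ (p,q) = (fls_X_inv * fls_X) * (?i * - fls_const (?S $$ (q,p)))"
        by (simp add: mult_ac del: fls_const_mult_const)
      also have "\<dots> = fls_const (inverse e * - ?S $$ (q,p))" unfolding fls_X_times_fls_X_inv by simp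
      finally show ?thesis by (simp only: Oc)
    next
      case 2
      have "?S $$ (p,q) = 0" "?S $$ (q,p) = 0" using 2 pq j fq[of q] by (auto simp: std_nilpotent_index)
      then have "?W $$ (p,q) = (if p = q then 1 else 0)" using 2 unfolding Wpq by simp
      moreover have "inverse (?d p) = ?i"
        by (rule inverse_unique) (use 2 ie in \<open>simp add: d mult.commute del: fls_const_mult_const\<close>)
      ultimately show ?thesis using Oc O01 by simp
    next
      case 3
      have "\<not> p < 2*j" using 3 j by auto
      then have "?S $$ (q,p) = 0" using pq by (auto simp: std_nilpotent_index)
      then have "?W $$ (p,q) = (if p = q then 1 else 0) + fls_X_inv * fls_const (?S $$ (p,q))" 
        using \<open>\<not> p < 2*j\<close> unfolding Wpq by simp
      moreover have "inverse (?d p) = ?i * fls_X"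
      proof (rule inverse_unique)
        have "?d p * (?i * fls_X) = (?i * fls_const e) * (fls_X_inv * fls_X)" 
          unfolding d using 3 \<open>\<not> p < 2*j\<close> by (simp add: mult_ac del: fls_const_mult_const)
        then show "?d p * (?i * fls_X) = 1" unfolding ie fls_X_times_fls_X_inv by simp
      qed
      ultimately have "inverse (?d p) * ?W $$ (p,q) = ?i * fls_X * (if p = q then 1 else 0) + ?i * ((fls_X * fls_X_inv) * fls_const (?S $$ (p,q)))"
        by (simp only: distrib_left mult_ac)
      also have "\<dots> \<in> \<O>" unfolding fls_X_times_fls_X_inv using OX Oc O01 Oadd by (simp del: fls_const_mult_const)
      finally show ?thesis .
    qed
  qed
  then have "entries_in \<O> ?H"
    unfolding minv_n mat_diag_mult_left[OF GK_carrier[OF W]] by (simp add: entries_in_def)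
  then have H: "?H \<in> GO l" using HGK by (simp add: GO_iff)
  have "?G * n_elt l b * ?H = ?G * (n_elt l b * minv (n_elt l b)) * ?W"
    using GK_assoc[OF GO_GK[OF G] n HGK] GK_assoc[OF n GK_inverse(1)[OF n] W] GK_one_mult GO_GK[OF G] W GK_inverse(2)[OF n]
    by simp
  also have "\<dots> = (?G * ?G') * ?L"
    unfolding GK_inverse(2)[OF n] GK_one_mult(2)[OF GO_GK[OF G]] by (rule GK_assoc[OF GO_GK[OF G] G' L, symmetric])
  also have "\<dots> = ?L" unfolding GG' by (rule GK_one_mult(1)[OF L])
  finally show ?thesis using G H by metis
qed

section \<open>Poles on a stratum\<close>

lemma rank_le_mat_diag:
  assumes p: "inj_on p {..<r}" and f: "\<And>i. i < n \<Longrightarrow> f i \<noteq> 0 \<Longrightarrow> \<exists>a<r. p a = i"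
  shows "rank_le n r (mat_diag n f)"
proof (rule rank_leI[where f = "\<lambda>i a. if p a = i then f i else 0" and g = "\<lambda>a j. if p a = j then 1 else 0"])
  fix i j assume ij: "i < n" "j < n"
  show "mat_diag n f $$ (i,j) = (\<Sum>a<r. (if p a = i then f i else 0) * (if p a = j then 1 else 0))"
  proof (cases "i = j \<and> f i \<noteq> 0")
    case True
    then obtain a where a: "a < r" "p a = i" using f ij by blast
    have "(\<Sum>a<r. (if p a = i then f i else 0) * (if p a = j then 1 else 0)) = (\<Sum>a'<r. if a' = a then f i else 0)"
      using a p True by (intro sum.cong) (auto simp: inj_on_def)
    then show ?thesis using a True ij by (simp add: mat_diag_index)
  next
    case False
    then have "(\<Sum>a<r. (if p a = i then f i else 0) * (if p a = j then 1 else 0)) = 0"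
      by (intro sum.neutral) auto
    then show ?thesis using False ij by (auto simp: mat_diag_index)
  qed
qed

text \<open>Multiplying the middle factor by \<open>t\<close> clears its pole, so \<open>h n y\<close> has at most a simple pole,
  with residue of rank \<open>2j\<close>.\<close>

lemma stratum_pole:
  assumes b: "b \<in> cocharacters l" and c: "coinv l b = ones_zeros l j" and j: "2*j \<le> l"
    and h: "h \<in> GO l" and y: "y \<in> GO l"
  defines "A \<equiv> h * n_elt l b * y"
  shows "\<And>p q m. p < 2*l \<Longrightarrow> q < 2*l \<Longrightarrow> m < -1 \<Longrightarrow> fls_nth (A $$ (p,q)) m = 0"
    and "rank_le (2*l) (2*j) (map_mat (\<lambda>f. fls_nth f (-1)) A)"
    and "rank_ge (2*l) (2*j) (map_mat (\<lambda>f. fls_nth f (-1)) A)"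
proof -
  let ?n = "2*l" let ?d = "n_entry l b"
  let ?N = "mat_diag ?n (\<lambda>i. fls_X * ?d i)"
  note hc = GK_carrier[OF GO_GK[OF h]] and yc = GK_carrier[OF GO_GK[OF y]]
  have nc: "n_elt l b \<in> carrier_mat ?n ?n" by (rule GK_carrier[OF n_elt_GK[OF b]])
  have Ac: "A \<in> carrier_mat ?n ?n" unfolding A_def using hc nc yc by (auto intro!: mult_carrier_mat)
  \<comment> \<open>The coefficients of \<open>t^(-1)\<close> in the middle factor, nonzero exactly
    in the last \<open>2*j\<close> positions. The residue of \<open>A\<close> is this diagonal
    matrix between the constant terms of \<open>h\<close> and \<open>y\<close>, which lie in
    \<open>K\<close>.\<close>
  define e where "e = (\<lambda>i. fls_nth (fls_X * ?d i) 0)"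
  have d: "fls_X * ?d i \<in> \<O> \<and> (e i \<noteq> 0 \<longleftrightarrow> ?n - 2*j \<le> i)" if i: "i < ?n" for i
  proof -
    obtain a where a: "a \<noteq> 0" and di: "?d i = fls_const a * (if i < 2*j then fls_X else if i < ?n - 2*j then 1 else fls_X_inv)"
      using n_entry_cases[OF c j i] by blast
    consider "i < 2*j" | "2*j \<le> i" "i < ?n - 2*j" | "?n - 2*j \<le> i" by linarith
    then show ?thesis
    proof cases
      case 3
      then have "\<not> i < 2*j" using j by auto
      then have "fls_X * ?d i = fls_const a * (fls_X * fls_X_inv)" unfolding di using 3 by (simp add: mult_ac)
      then have "fls_X * ?d i = fls_const a" unfolding fls_X_times_fls_X_inv by simp
      then show ?thesis using 3 a by (simp add: e_def \<O>_def)
    qed (use j in \<open>auto simp: di e_def \<O>_def fls_X_times_conv_shift\<close>)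
  qed
  have N: "?N \<in> carrier_mat ?n ?n" by simp
  have NO: "entries_in \<O> ?N" using d by (auto simp: entries_in_def mat_diag_index dim_mat_diag \<O>_def)
  have hO: "entries_in \<O> h" and yO: "entries_in \<O> y" using h y by (simp_all add: GO_iff)
  note hN = entries_in_mult[OF coeff_ring_\<O> hc hO N NO]
  note hNc = mult_carrier_mat[OF hc N]
  note hNy = entries_in_mult[OF coeff_ring_\<O> hNc hN(1) yc yO]
  have "?N = fls_X \<cdot>\<^sub>m n_elt l b" unfolding n_elt_diag by (intro eq_matI) (auto simp: mat_diag_index dim_mat_diag)
  then have XA: "h * ?N * y = fls_X \<cdot>\<^sub>m A"
    unfolding A_def using mult_smult_distrib[OF hc nc, of fls_X] mult_smult_assoc_mat[OF mult_carrier_mat[OF hc nc] yc, of fls_X] by simp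
  have shift: "fls_nth ((fls_X \<cdot>\<^sub>m A) $$ (p,q)) m = fls_nth (A $$ (p,q)) (m - 1)" if "p < ?n" "q < ?n" for p q m
    using that Ac by (simp add: fls_X_times_conv_shift)
  show "fls_nth (A $$ (p,q)) m = 0" if "p < ?n" "q < ?n" "m < -1" for p q m
  proof -
    have "(fls_X \<cdot>\<^sub>m A) $$ (p,q) \<in> \<O>" using hNy(1) that Ac unfolding XA entries_in_def by simp
    then have "fls_nth ((fls_X \<cdot>\<^sub>m A) $$ (p,q)) (m + 1) = 0" using that(3) by (simp add: \<O>_def del: index_smult_mat)
    then show ?thesis using shift[OF that(1,2), of "m+1"] by simp
  qed
  let ?h = "const_coeff h" let ?y = "const_coeff y" let ?E = "mat_diag ?n e"
  have E: "const_coeff ?N = ?E" by (intro eq_matI) (auto simp: mat_diag_index dim_mat_diag e_def)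
  have "map_mat (\<lambda>f. fls_nth f (-1)) A = const_coeff (fls_X \<cdot>\<^sub>m A)"
    using Ac shift by (intro eq_matI) (auto simp del: index_smult_mat(1))
  also have "\<dots> = ?h * ?E * ?y" unfolding XA[symmetric] hNy(2) hN(2) E ..
  finally have lead: "map_mat (\<lambda>f. fls_nth f (-1)) A = ?h * ?E * ?y" .
  have k: "?h \<in> K l" "?y \<in> K l" using const_coeff_in_K[OF coeff_ring_\<O>] h y by (simp_all add: GO_iff)
  have kc: "?h \<in> carrier_mat ?n ?n" "?y \<in> carrier_mat ?n ?n" "det ?h \<noteq> 0" "det ?y \<noteq> 0"
    using k by (simp_all add: K_iff)
  have Ec: "?E \<in> carrier_mat ?n ?n" by simp
  have rE: "rank_le ?n (2*j) ?E"
  proof (rule rank_le_mat_diag[of "\<lambda>a. ?n - 2*j + a"])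
    fix i assume "i < ?n" "e i \<noteq> 0"
    then show "\<exists>a<2*j. ?n - 2*j + a = i" using d j by (intro exI[of _ "i - (?n - 2*j)"]) auto
  qed simp
  have "rank_ge ?n (2*j) ?E"
    unfolding rank_ge_def
  proof (intro bexI conjI)
    let ?f = "\<lambda>i. if ?n - 2*j \<le> i then 0 else 1 :: complex"
    show "rank_le ?n (?n - 2*j) (mat_diag ?n ?f)"
      by (rule rank_le_mat_diag[of "\<lambda>a. a"]) (auto split: if_splits)
    have "?E + mat_diag ?n ?f = mat_diag ?n (\<lambda>i. e i + ?f i)" by (intro eq_matI) (auto simp: mat_diag_index dim_mat_diag)
    moreover have "e i + ?f i \<noteq> 0" if "i < ?n" for i using d[OF that] by auto
    ultimately show "det (?E + mat_diag ?n ?f) \<noteq> 0" by (simp add: det_mat_diag)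
  qed simp
  then show "rank_ge ?n (2*j) (map_mat (\<lambda>f. fls_nth f (-1)) A)"
    unfolding lead using rank_ge_mult[OF kc(1) Ec kc(2,3,4)] by blast
  show "rank_le ?n (2*j) (map_mat (\<lambda>f. fls_nth f (-1)) A)"
    unfolding lead using rank_le_mult[OF kc(1) Ec kc(2) rE] .
qed

text \<open>The converse of \<open>unip_twisted\<close>. The coefficients of \<open>t^(-1)\<close>
  and \<open>t^(-2)\<close> in the twisted equation are \<open>x J - J x^T\<close> and
  \<open>- x J x^T\<close>; by the first, the second becomes \<open>- x^2 J\<close>, and
  \<open>J\<close> is invertible.\<close>

lemma unip_coefficients:
  assumes x: "x \<in> carrier_mat (2*l) (2*l)" and eq: "unip l fls_X_inv x * J l * transpose_mat (twist (unip l fls_X_inv x)) = J l"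
  shows "self_adjoint_sq0 l x"
proof -
  let ?n = "2*l" let ?U = "unip l fls_X_inv x" let ?V = "unip l (- fls_X_inv) (transpose_mat x)"
  let ?A = "x * J l" let ?B = "J l * transpose_mat x" let ?C = "x * J l * transpose_mat x"
  have U: "?U = 1\<^sub>m ?n + fls_X_inv \<cdot>\<^sub>m const_mat x" and V: "?V = 1\<^sub>m ?n + (- fls_X_inv) \<cdot>\<^sub>m const_mat (transpose_mat x)"
    by (simp_all add: unip_def)
  have c: "?A \<in> carrier_mat ?n ?n" "?B \<in> carrier_mat ?n ?n" "?C \<in> carrier_mat ?n ?n"
    using x by (auto intro!: mult_carrier_mat)
  have t: "transpose_mat (twist ?U) = ?V"
    using x by (intro eq_matI) (auto simp: unip_def neg_var_X fls_compose_fps_add fls_compose_fps_mult)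
  have "?U * J l = 1\<^sub>m ?n * J l + (fls_X_inv \<cdot>\<^sub>m const_mat x) * J l"
    unfolding U using x by (intro add_mult_distrib_mat[of _ ?n ?n _ _ ?n]) auto
  also have "\<dots> = J l + fls_X_inv \<cdot>\<^sub>m const_mat ?A"
    using x mult_smult_assoc_mat[of "const_mat x" ?n ?n "J l" ?n fls_X_inv] 
    by (simp add: const_mat_mult[OF x J_carrier] const_mat_J)
  finally have UJ: "?U * J l = J l + fls_X_inv \<cdot>\<^sub>m const_mat ?A" .
  have "?U * J l * ?V = (J l + fls_X_inv \<cdot>\<^sub>m const_mat ?A) * 1\<^sub>m ?n + (J l + fls_X_inv \<cdot>\<^sub>m const_mat ?A) * ((- fls_X_inv) \<cdot>\<^sub>m const_mat (transpose_mat x))"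
    unfolding UJ V using x c by (intro mult_add_distrib_mat[of _ ?n ?n _ ?n]) auto
  also have "(J l + fls_X_inv \<cdot>\<^sub>m const_mat ?A) * ((- fls_X_inv) \<cdot>\<^sub>m const_mat (transpose_mat x))
     = J l * ((- fls_X_inv) \<cdot>\<^sub>m const_mat (transpose_mat x)) + (fls_X_inv \<cdot>\<^sub>m const_mat ?A) * ((- fls_X_inv) \<cdot>\<^sub>m const_mat (transpose_mat x))"
    using x c by (intro add_mult_distrib_mat[of _ ?n ?n _ _ ?n]) auto
  also have "J l * ((- fls_X_inv) \<cdot>\<^sub>m const_mat (transpose_mat x)) = (- fls_X_inv) \<cdot>\<^sub>m const_mat ?B"
  proof -
    have "J l * const_mat (transpose_mat x) = const_mat ?B"
      using const_mat_mult[OF J_carrier[of l], of "transpose_mat x" ?n] x by (simp add: const_mat_J)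
    then show ?thesis using mult_smult_distrib[OF J_carrier[of l], of "const_mat (transpose_mat x)" ?n "- fls_X_inv"] x by simp
  qed
  also have "(fls_X_inv \<cdot>\<^sub>m const_mat ?A) * ((- fls_X_inv) \<cdot>\<^sub>m const_mat (transpose_mat x)) = fls_X_inv \<cdot>\<^sub>m ((- fls_X_inv) \<cdot>\<^sub>m const_mat ?C)"
  proof -
    have "(fls_X_inv \<cdot>\<^sub>m const_mat ?A) * ((- fls_X_inv) \<cdot>\<^sub>m const_mat (transpose_mat x)) = 
      fls_X_inv \<cdot>\<^sub>m (const_mat ?A * ((- fls_X_inv) \<cdot>\<^sub>m const_mat (transpose_mat x)))"
      using x c by (intro mult_smult_assoc_mat[of _ ?n ?n _ ?n]) auto
    also have "const_mat ?A * ((- fls_X_inv) \<cdot>\<^sub>m const_mat (transpose_mat x)) = (- fls_X_inv) \<cdot>\<^sub>m (const_mat ?A * const_mat (transpose_mat x))"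
      using x c by (intro mult_smult_distrib[of _ ?n ?n _ ?n]) auto
    also have "const_mat ?A * const_mat (transpose_mat x) = const_mat ?C"
      using x c by (intro const_mat_mult[symmetric, of _ ?n ?n _ ?n]) auto
    finally show ?thesis .
  qed
  finally have main: "J l = (J l + fls_X_inv \<cdot>\<^sub>m const_mat ?A) * 1\<^sub>m ?n + ((- fls_X_inv) \<cdot>\<^sub>m const_mat ?B + fls_X_inv \<cdot>\<^sub>m ((- fls_X_inv) \<cdot>\<^sub>m const_mat ?C))"
    unfolding t[symmetric] eq .
  have entry: "fls_nth ((fls_X_inv * (fls_const (?A $$ (p,q)) - fls_const (?B $$ (p,q))) - fls_X_inv * (fls_X_inv * fls_const (?C $$ (p,q))))) m = 0"
    if pq: "p < ?n" "q < ?n" for p q m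
  proof -
    have "J l $$ (p,q) = J l $$ (p,q) + fls_X_inv * fls_const (?A $$ (p,q)) + ((- fls_X_inv) * fls_const (?B $$ (p,q)) + fls_X_inv * ((- fls_X_inv) * fls_const (?C $$ (p,q))))"
    proof -
      have gen: "((P + s \<cdot>\<^sub>m A) * 1\<^sub>m ?n + (s' \<cdot>\<^sub>m B + s \<cdot>\<^sub>m (s' \<cdot>\<^sub>m C))) $$ (p,q) =
          P $$ (p,q) + s * A $$ (p,q) + (s' * B $$ (p,q) + s * (s' * C $$ (p,q)))"
        if "P \<in> carrier_mat ?n ?n" "A \<in> carrier_mat ?n ?n" "B \<in> carrier_mat ?n ?n" "C \<in> carrier_mat ?n ?n"
        for P A B C :: "complex fls mat" and s s'
        using that pq by (simp add: right_mult_one_mat[of _ ?n ?n])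
      have i: "const_mat D $$ (p,q) = fls_const (D $$ (p,q))" if "D \<in> carrier_mat ?n ?n" for D
        using that pq by simp
      have "J l $$ (p,q) = ((J l + fls_X_inv \<cdot>\<^sub>m const_mat ?A) * 1\<^sub>m ?n + ((- fls_X_inv) \<cdot>\<^sub>m const_mat ?B + fls_X_inv \<cdot>\<^sub>m ((- fls_X_inv) \<cdot>\<^sub>m const_mat ?C))) $$ (p,q)"
        by (rule arg_cong[OF main])
      also have "\<dots> = J l $$ (p,q) + fls_X_inv * const_mat ?A $$ (p,q) + ((- fls_X_inv) * const_mat ?B $$ (p,q) + fls_X_inv * ((- fls_X_inv) * const_mat ?C $$ (p,q)))"
        by (rule gen[OF J_carrier]) (simp_all only: map_carrier_mat c)
      finally show ?thesis unfolding i[OF c(1)] i[OF c(2)] i[OF c(3)] .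
    qed
    then show ?thesis by (simp add: algebra_simps)
  qed
  have AB: "?A $$ (p,q) = ?B $$ (p,q)" and C0: "?C $$ (p,q) = 0" if pq: "p < ?n" "q < ?n" for p q
    using entry[OF pq, of "-1"] entry[OF pq, of "-2"] by (simp_all add: fls_X_inv_times_conv_shift del: index_mult_mat)
  have A: "?A = ?B" using AB c by (intro eq_matI) (auto simp del: index_mult_mat(1))
  have "x * x * J l = x * (x * J l)" using x by (rule assoc_mult_mat[OF _ x J_carrier])
  also have "\<dots> = x * (J l * transpose_mat x)" by (simp only: A)
  also have "\<dots> = ?C" using x by (intro assoc_mult_mat[OF x J_carrier, symmetric]) auto
  also have "\<dots> = 0\<^sub>m ?n ?n" using C0 c(3) by (intro eq_matI) (auto simp del: index_mult_mat(1))
  finally have xxJ: "x * x * J l = 0\<^sub>m ?n ?n" .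
  have "x * x * J l * (- J l) = 0\<^sub>m ?n ?n" unfolding xxJ by (rule left_mult_zero_mat) simp
  moreover have "x * x * J l * (- J l) = x * x * (J l * (- J l))"
    using x by (intro assoc_mult_mat[of _ ?n ?n _ ?n _ ?n]) (auto intro!: mult_carrier_mat)
  ultimately have "x * x = 0\<^sub>m ?n ?n" unfolding J_mult_uminus using x by (simp add: right_mult_one_mat[of _ ?n ?n] mult_carrier_mat[OF x x])
  then show ?thesis using A x by (simp add: self_adjoint_sq0_def)
qed

section \<open>Points of the strata as cosets of \<open>1 + t^(-1) x\<close>\<close>

lemma M_representative:
  assumes b: "b \<in> cocharacters l" and c: "coinv l b = ones_zeros l j" and j: "2*j \<le> l" and z: "z \<in> M l b"
  shows "\<exists>x\<in>std_orbit l j. z = (\<lambda>y. unip l fls_X_inv x * y) ` GO l"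
proof -
  let ?n = "2*l" let ?N = "n_elt l b"
  have N: "?N \<in> carrier (GK l)" by (rule n_elt_GK[OF b])
  obtain h where h: "h \<in> GO l" and zh: "z = (\<lambda>y. h * y) ` (\<lambda>y. ?N * y) ` GO l"
    using z by (auto simp: M_def Gr_stratum_def base_point_def l_coset_GK)
  obtain g where g: "g \<in> GOm l" and zg: "z = (\<lambda>y. g * y) ` GO l"
    using z by (auto simp: M_def Gr0m_def base_point_def l_coset_GK)
  obtain y0 where y0: "y0 \<in> GO l" and A: "g * y0 \<in> GOm0 l" using GOm0_normalize[OF g] by blast
  let ?A = "g * y0"
  have zA: "z = (\<lambda>y. ?A * y) ` GO l" unfolding zg by (rule coset_mult_GO[OF GOm_GK[OF g] y0, symmetric])
  have Am: "?A \<in> GOm l" "const_coeff ?A = 1\<^sub>m ?n" using A by (auto simp: GOm0_def)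
  have Ac: "?A \<in> carrier_mat ?n ?n" using GK_carrier[OF GOm_GK[OF Am(1)]] .
  \<comment> \<open>The normalized representative belongs to the coset, so it is also a product
    \<open>h n y\<close> with \<open>h\<close> and \<open>y\<close> in \<open>GO\<close>. Thus the
    pole bound at \<open>t = 0\<close> applies to the same matrix whose entries are polynomials in
    \<open>t^(-1)\<close>.\<close>
  have "?A \<in> z" unfolding zg using y0 by (rule imageI)
  then obtain y where y: "y \<in> GO l" "?A = h * (?N * y)" unfolding zh by auto
  then have Ay: "?A = h * ?N * y" using GK_assoc[OF GO_GK[OF h] N GO_GK[OF y(1)]] by simp
  note pole = stratum_pole[OF b c j h y(1), folded Ay]
  let ?x = "map_mat (\<lambda>f. fls_nth f (-1)) ?A"
  have xc: "?x \<in> carrier_mat ?n ?n" using Ac by simp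
  have AU: "?A = unip l fls_X_inv ?x"
  proof (rule eq_matI)
    fix p q assume "p < dim_row (unip l fls_X_inv ?x)" "q < dim_col (unip l fls_X_inv ?x)"
    then have pq: "p < ?n" "q < ?n" using unip_carrier[OF xc, of fls_X_inv] by auto
    have "fls_nth (?A $$ (p,q)) m = fls_nth (unip l fls_X_inv ?x $$ (p,q)) m" for m
    proof -
      consider "m > 0" | "m = 0" | "m = -1" | "m < -1" by linarith
      then show ?thesis
      proof cases
        case 1
        have "?A $$ (p,q) \<in> \<O>m" using Am(1) pq Ac by (simp add: GOm_iff entries_in_def del: index_mult_mat)
        then show ?thesis using 1 unfolding unip_neg_index[OF xc pq] by (simp add: \<O>m_def del: index_mult_mat)
      next
        case 2
        have "fls_nth (?A $$ (p,q)) 0 = const_coeff ?A $$ (p,q)" using pq Ac by (simp del: index_mult_mat)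
        also have "\<dots> = (if p = q then 1 else 0)" unfolding Am(2) using pq by simp
        finally show ?thesis using 2 unfolding unip_neg_index[OF xc pq] by simp
      next
        case 3
        then show ?thesis unfolding unip_neg_index[OF xc pq] using pq Ac by (simp del: index_mult_mat)
      next
        case 4
        then show ?thesis using pole(1)[OF pq 4] unfolding unip_neg_index[OF xc pq] by simp
      qed
    qed
    then show "?A $$ (p,q) = unip l fls_X_inv ?x $$ (p,q)" by (intro fls_eqI)
  qed (use Ac unip_carrier[OF xc, of fls_X_inv] in auto)
  have "?A * J l * transpose_mat (twist ?A) = J l" using GOm_GK[OF Am(1)] by (simp add: carrier_GK_iff)
  then have "self_adjoint_sq0 l ?x" using AU unip_coefficients[OF xc] by metis
  then have "?x \<in> std_orbit l j" using pole(2,3) by (simp add: std_orbit_iff[OF j])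
  moreover have "z = (\<lambda>y. unip l fls_X_inv ?x * y) ` GO l" using zA AU by metis
  ultimately show ?thesis by blast
qed

text \<open>Conjugating by a constant \<open>k\<close> from \<open>K\<close> multiplies both outer
  factors of the factorization of the normal form by elements of \<open>GO\<close>, so the middle
  factor \<open>n_elt l b\<close> serves the whole orbit.\<close>

lemma unip_coset_in_M:
  assumes b: "b \<in> cocharacters l" and c: "coinv l b = ones_zeros l j" and j: "2*j \<le> l" and x: "x \<in> std_orbit l j"
  shows "(\<lambda>y. unip l fls_X_inv x * y) ` GO l \<in> M l b"
proof -
  let ?N = "n_elt l b" let ?U = "unip l fls_X_inv x"
  have N: "?N \<in> carrier (GK l)" by (rule n_elt_GK[OF b])
  obtain k where k: "k \<in> K l" and xk: "x = k * std_nilpotent l j * minv k" using x by (auto simp: std_orbit_def)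
  obtain g h where g: "g \<in> GO l" and h: "h \<in> GO l" and L: "unip l fls_X_inv (std_nilpotent l j) = g * ?N * h"
    using unip_std_factor[OF b c j] by blast
  let ?k = "const_mat k" let ?k' = "const_mat (minv k)"
  have kO: "?k \<in> GO l" "?k' \<in> GO l" using K_const_mat_GO k K_inverse(1)[OF k] by auto
  note kg = GO_mult[OF kO(1) g] and hk = GO_mult[OF h kO(2)]
  have U: "?U = ?k * g * ?N * (h * ?k')"
  proof -
    have "?U = ?k * (g * ?N * h) * ?k'" unfolding xk L[symmetric] by (rule unip_conj[OF std_nilpotent_carrier k])
    also have "\<dots> = ?k * g * ?N * (h * ?k')"
      using GK_carrier[OF GO_GK[OF kO(1)]] GK_carrier[OF GO_GK[OF kO(2)]] GK_carrier[OF GO_GK[OF g]] GK_carrier[OF GO_GK[OF h]] GK_carrier[OF N]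
      by (simp add: assoc_mult_mat[of _ "2*l" "2*l" _ "2*l" _ "2*l"] mult_carrier_mat[of _ "2*l" "2*l" _ "2*l"])
    finally show ?thesis .
  qed
  have "(\<lambda>y. ?U * y) ` GO l = (\<lambda>y. ?k * g * ?N * y) ` GO l"
    unfolding U by (rule coset_mult_GO[OF GK_mult[OF GO_GK[OF kg] N] hk])
  also have "\<dots> = (\<lambda>y. ?k * g * y) ` (\<lambda>y. ?N * y) ` GO l"
    unfolding image_image by (intro image_cong refl GK_assoc[OF GO_GK[OF kg] N GO_GK])
  finally have "(\<lambda>y. ?U * y) ` GO l \<in> Gr_stratum l b"
    using kg unfolding Gr_stratum_def base_point_def l_coset_GK by blast
  moreover have "?U \<in> GOm l"
    using unip_neg_GOm0[of l x] x std_orbit_iff[OF j] by (simp add: GOm0_def)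
  then have "(\<lambda>y. ?U * y) ` GO l \<in> Gr0m l" unfolding Gr0m_def base_point_def l_coset_GK by blast
  ultimately show ?thesis by (simp add: M_def)
qed

lemma rep_unip_coset:
  assumes x: "self_adjoint_sq0 l x"
  shows "rep l ((\<lambda>y. unip l fls_X_inv x * y) ` GO l) = unip l fls_X_inv x"
    and "\<pi> l ((\<lambda>y. unip l fls_X_inv x * y) ` GO l) = x"
    and "gr_coord l ((\<lambda>y. unip l fls_X_inv x * y) ` GO l) = linear_coord (2*l) x"
proof -
  let ?z = "(\<lambda>y. unip l fls_X_inv x * y) ` GO l"
  have xc: "x \<in> carrier_mat (2*l) (2*l)" using x by (simp add: self_adjoint_sq0_def)
  show rep: "rep l ?z = unip l fls_X_inv x" by (rule rep_eqI[OF unip_neg_GOm0[OF x] refl])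
  show "\<pi> l ?z = x"
    unfolding \<pi>_def rep using xc unip_carrier[OF xc, of fls_X_inv] by (intro eq_matI) (auto simp: unip_neg_index[OF xc])
  show "gr_coord l ?z = linear_coord (2*l) x"
    unfolding gr_coord_def rep linear_coord_def by (auto simp: fun_eq_iff unip_neg_index[OF xc])
qed

text \<open>Used with \<open>Y\<close> the whole cone and with \<open>Y\<close> a single orbit. The
  inverse of \<open>\<pi>\<close> is the coset map itself, and on these cosets
  \<open>gr_coord\<close> is \<open>linear_coord\<close> of the residue.\<close>

lemma iso_via_unip_cosets:
  assumes Y: "\<And>x. x \<in> Y \<Longrightarrow> self_adjoint_sq0 l x" and qa: "quasi_affine (mat_coord ` Y)"
    and X: "X = (\<lambda>x. (\<lambda>y. unip l fls_X_inv x * y) ` GO l) ` Y"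
  shows "iso_via (gr_coord l) X mat_coord Y (\<pi> l)"
proof (rule iso_via_linear_coord[OF _ qa])
  show "Y \<subseteq> carrier_mat (2*l) (2*l)" using Y by (auto simp: self_adjoint_sq0_def)
  show "bij_betw (\<pi> l) X Y"
    unfolding X by (rule bij_betw_byWitness[where f' = "\<lambda>x. (\<lambda>y. unip l fls_X_inv x * y) ` GO l"])
      (auto simp: rep_unip_coset(2)[OF Y])
  fix z assume "z \<in> X"
  then obtain x where "x \<in> Y" "z = (\<lambda>y. unip l fls_X_inv x * y) ` GO l" unfolding X by blast
  then show "gr_coord l z = linear_coord (2*l) (\<pi> l z)" using rep_unip_coset[OF Y] by simp
qed

lemma M_eq_unip_cosets:
  assumes "b \<in> cocharacters l" "coinv l b = ones_zeros l j" "2*j \<le> l"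
  shows "M l b = (\<lambda>x. (\<lambda>y. unip l fls_X_inv x * y) ` GO l) ` std_orbit l j"
proof (intro equalityI subsetI)
  fix z assume "z \<in> M l b"
  from M_representative[OF assms this]
  obtain x where "x \<in> std_orbit l j" "z = (\<lambda>y. unip l fls_X_inv x * y) ` GO l" by (elim bexE)
  then show "z \<in> (\<lambda>x. (\<lambda>y. unip l fls_X_inv x * y) ` GO l) ` std_orbit l j" by (intro image_eqI)
next
  fix z assume "z \<in> (\<lambda>x. (\<lambda>y. unip l fls_X_inv x * y) ` GO l) ` std_orbit l j"
  then show "z \<in> M l b" by (elim imageE) (simp only: unip_coset_in_M[OF assms])
qed

lemma is_K_orbit_std_orbit: "2*j \<le> l \<Longrightarrow> is_K_orbit l (std_orbit l j)"
proof -
  assume "2*j \<le> l"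
  then have "std_nilpotent l j \<in> N\<pp>2 l" by (simp add: N\<pp>2_iff self_adjoint_sq0_std)
  then have "std_nilpotent l j \<in> \<pp> l" by (simp add: N\<pp>2_def N\<pp>_def)
  then show ?thesis unfolding is_K_orbit_def std_orbit_def by blast
qed

theorem theorem4p6:
  fixes l :: nat and lam :: "nat \<Rightarrow> int list"
  assumes "l \<ge> 2"
    and "\<forall>j \<le> l div 2. lam j \<in> cocharacters l \<and> coinv l (lam j) = ones_zeros l j"
  shows "iso_via (gr_coord l) (\<Union>j\<le>l div 2. M l (lam j)) mat_coord (N\<pp>2 l) (\<pi> l) \<and>
    (\<forall>j \<le> l div 2. is_K_orbit l (jordan_orbit l j) \<and>
       iso_via (gr_coord l) (M l (lam j)) mat_coord (jordan_orbit l j) (\<pi> l))"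
proof (intro conjI allI impI)
  have le: "j \<le> l div 2 \<longleftrightarrow> 2*j \<le> l" for j by auto
  let ?c = "\<lambda>x. (\<lambda>y. unip l fls_X_inv x * y) ` GO l"
  have M: "M l (lam j) = ?c ` std_orbit l j" if "2*j \<le> l" for j
    using assms(2) that by (intro M_eq_unip_cosets) (auto simp: le)
  have sa: "self_adjoint_sq0 l x" if "x \<in> std_orbit l j" "2*j \<le> l" for x j
    using that std_orbit_iff by blast
  \<comment> \<open>The classification splits the cone into the orbits indexed by \<open>j\<close>,
    which turns the union of the \<open>M l (lam j)\<close> into the image of the whole cone under
    the coset map.\<close>
  have N: "N\<pp>2 l = (\<Union>j\<in>{..l div 2}. std_orbit l j)"
  proof (intro equalityI subsetI)
    fix x assume "x \<in> N\<pp>2 l"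
    then have "\<exists>j. 2*j \<le> l \<and> x \<in> std_orbit l j" unfolding N\<pp>2_iff by (rule self_adjoint_sq0_in_std_orbit)
    then obtain j where "2*j \<le> l" "x \<in> std_orbit l j" by (elim exE conjE)
    then show "x \<in> (\<Union>j\<in>{..l div 2}. std_orbit l j)" by (intro UN_I[of j]) (simp_all add: le)
  next
    fix x assume "x \<in> (\<Union>j\<in>{..l div 2}. std_orbit l j)"
    then obtain j where "j \<le> l div 2" "x \<in> std_orbit l j" by (elim UN_E) (simp only: atMost_iff)
    then show "x \<in> N\<pp>2 l" unfolding N\<pp>2_iff le by (intro sa)
  qed
  have "(\<Union>j\<le>l div 2. M l (lam j)) = (\<Union>j\<le>l div 2. ?c ` std_orbit l j)"
    by (rule SUP_cong[OF refl]) (simp only: atMost_iff le M)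
  also have "\<dots> = ?c ` N\<pp>2 l" unfolding N image_UN ..
  finally show "iso_via (gr_coord l) (\<Union>j\<le>l div 2. M l (lam j)) mat_coord (N\<pp>2 l) (\<pi> l)"
    by (intro iso_via_unip_cosets quasi_affine_N\<pp>2) (simp_all add: N\<pp>2_iff)
  fix j assume "j \<le> l div 2"
  then have j: "2*j \<le> l" by (simp add: le)
  show "is_K_orbit l (jordan_orbit l j)"
    unfolding jordan_orbit_eq_std_orbit[OF j] by (rule is_K_orbit_std_orbit[OF j])
  show "iso_via (gr_coord l) (M l (lam j)) mat_coord (jordan_orbit l j) (\<pi> l)"
    unfolding jordan_orbit_eq_std_orbit[OF j]
    using assms(1) by (intro iso_via_unip_cosets sa quasi_affine_std_orbit M j) (auto intro: j)
qed

end
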